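(* Let $M=\mathbb{Q}(\sqrt{6})$ with ring of integers $\mathcal{O}_M$, and let $|q|<1$. Define \[ L_{9}(q) := \sum_{n \geq 1}\sum_{k=1}^{n} \frac{(-1)_n (q)_{n-1}(-1)^{n+k}q^{n + \binom{k+1}{2}} }{(q)_{n-k} (q)_{k-1} (1-q^{2k-1})},\qquad L_{10}(q) := q \sum_{n \geq 1} \sum_{k=1}^{n} \frac{(-1)_n (q)_{n-1}(-1)^{n+k}q^{n + \binom{k}{2}} }{(q)_{n-k} (q)_{k-1} (1-q^{2k-1})}, \] \[ L_{11}(q) := 2 {\sum_{n \geq 0}}^{*}\sum_{k=0}^{n} \frac{(q^2; q^2)_{n}(-1)^{n+k}q^{\binom{k+1}{2}} }{(q)_{n-k} (q)_{k} (1-q^{2k+1})},\qquad L_{12}(q) := -2 + 2 {\sum_{n \geq 0}}^{*}\sum_{k=0}^{n} \frac{(q^2; q^2)_{n}(-1)^{n+k}q^{\binom{k}{2}} }{(q)_{n-k} (q)_{k} (1-q^{2k+1})}. \] Then \[ q^{-9} L_{9}(q^{16}) = \sum_{\substack{\mathfrak{a} \subset \mathcal{O}_{M} \\ N(\mathfrak{a}) \equiv 7 \pmod{16}}} q^{N(\mathfrak{a})},\qquad q^{-17} L_{10}(q^{16}) = \sum_{\substack{\mathfrak{a} \subset \mathcal{O}_{M} \\ N(\mathfrak{a}) \equiv 15 \pmod{16}}} q^{N(\mathfrak{a})}, \] \[ q^{5} L_{11}(q^{48}) = \frac{1}{2} \sum_{\substack{\mathfrak{a} \subset \mathcal{O}_{M}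 \\ N(\mathfrak{a}) \equiv 5 \pmod{48}}} q^{N(\mathfrak{a})},\qquad q^{-19} L_{12}(q^{48}) = \frac{1}{2} \sum_{\substack{\mathfrak{a} \subset \mathcal{O}_{M} \\ N(\mathfrak{a}) \equiv 29 \pmod{48}}} q^{N(\mathfrak{a})}. \]
   Context: For $n\in\mathbb{N}\cup\{\infty\}$, $(a)_n=(a;q)_n=\prod_{k=1}^{n}(1-aq^{k-1})$ (empty product $=1$), and $(a;q^2)_n$ is defined likewise with $q$ replaced by $q^2$. The notation ${\sum_{n\ge 0}}^{*} c_n$ denotes the value defined as the average of the even and odd partial sums, i.e. $\lim_{N\to\infty}\frac12\left(\sum_{n=0}^{2N}c_n+\sum_{n=0}^{2N+1}c_n\right)$ (the series need not converge classically). The sums on the right run over nonzero ideals $\mathfrak{a}$ of $\mathcal{O}_M$ with the given congruence condition on the absolute norm $N(\mathfrak{a})$, each ideal counted once. *)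

theory Defs
  imports "HOL-Analysis.Analysis"
begin

definition qpoch :: "complex \<Rightarrow> complex \<Rightarrow> nat \<Rightarrow> complex" where
  "qpoch a q n = (\<Prod>k<n. (1 - a * q ^ k))"

(* The ring of integers O_M of M = Q(sqrt 6) is Z[sqrt 6];
   the pair (a,b) represents a + b*sqrt 6. *)
definition zs6_mult :: "int \<times> int \<Rightarrow> int \<times> int \<Rightarrow> int \<times> int" where
  "zs6_mult x y = (fst x * fst y + 6 * snd x * snd y, fst x * snd y + snd x * fst y)"

definition zs6_ideal :: "(int \<times> int) set \<Rightarrow> bool" where
  "zs6_ideal I \<longleftrightarrow> (0, 0) \<in> I
     \<and> (\<forall>x\<in>I. \<forall>y\<in>I. (fst x + fst y, snd x + snd y) \<in> I)
     \<and> (\<forall>r. \<forall>x\<in>I. zs6_mult r x \<in> I)"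

definition zs6_nonzero_ideal :: "(int \<times> int) set \<Rightarrow> bool" where
  "zs6_nonzero_ideal I \<longleftrightarrow> zs6_ideal I \<and> I \<noteq> {(0, 0)}"

definition zs6_norm :: "(int \<times> int) set \<Rightarrow> nat" where
  "zs6_norm I = card ((UNIV :: (int \<times> int) set) //
       {(x, y). (fst x - fst y, snd x - snd y) \<in> I})"

definition ideal_series :: "nat \<Rightarrow> nat \<Rightarrow> complex \<Rightarrow> complex" where
  "ideal_series m r q =
     infsum (\<lambda>I. q ^ zs6_norm I) {I. zs6_nonzero_ideal I \<and> zs6_norm I mod m = r}"

definition starsum_conv :: "(nat \<Rightarrow> complex) \<Rightarrow> bool" where
  "starsum_conv c \<longleftrightarrow>
     convergent (\<lambda>N. ((\<Sum>n\<le>2*N. c n) + (\<Sum>n\<le>2*N+1. c n)) / 2)"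

definition starsum :: "(nat \<Rightarrow> complex) \<Rightarrow> complex" where
  "starsum c = lim (\<lambda>N. ((\<Sum>n\<le>2*N. c n) + (\<Sum>n\<le>2*N+1. c n)) / 2)"

definition L9_term :: "complex \<Rightarrow> nat \<Rightarrow> complex" where
  "L9_term q n = (\<Sum>k=1..n. qpoch (-1) q n * qpoch q q (n - 1) * (-1) ^ (n + k)
      * q ^ (n + ((k + 1) choose 2))
      / (qpoch q q (n - k) * qpoch q q (k - 1) * (1 - q ^ (2 * k - 1))))"

definition L10_term :: "complex \<Rightarrow> nat \<Rightarrow> complex" where
  "L10_term q n = (\<Sum>k=1..n. qpoch (-1) q n * qpoch q q (n - 1) * (-1) ^ (n + k)
      * q ^ (n + (k choose 2))
      / (qpoch q q (n - k) * qpoch q q (k - 1) * (1 - q ^ (2 * k - 1))))"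

definition L11_term :: "complex \<Rightarrow> nat \<Rightarrow> complex" where
  "L11_term q n = (\<Sum>k=0..n. qpoch (q^2) (q^2) n * (-1) ^ (n + k)
      * q ^ ((k + 1) choose 2)
      / (qpoch q q (n - k) * qpoch q q k * (1 - q ^ (2 * k + 1))))"

definition L12_term :: "complex \<Rightarrow> nat \<Rightarrow> complex" where
  "L12_term q n = (\<Sum>k=0..n. qpoch (q^2) (q^2) n * (-1) ^ (n + k)
      * q ^ (k choose 2)
      / (qpoch q q (n - k) * qpoch q q k * (1 - q ^ (2 * k + 1))))"

definition L9 :: "complex \<Rightarrow> complex" where
  "L9 q = (\<Sum>n. L9_term q (Suc n))"

definition L10 :: "complex \<Rightarrow> complex" where
  "L10 q = q * (\<Sum>n. L10_term q (Suc n))"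

definition L11 :: "complex \<Rightarrow> complex" where
  "L11 q = 2 * starsum (L11_term q)"

definition L12 :: "complex \<Rightarrow> complex" where
  "L12 q = -2 + 2 * starsum (L12_term q)"

end

(*
  Write q = p^2. Each inner sum is the beta-sequence of a Bailey pair whose alpha-sequence is built from p to a
  quadratic in r times a sum of p^(-2w^2 - w), respectively p^(-2w^2 + 3w - 1), over
  |w| < r with w = r - 1 mod 2. The q-Vandermonde sum reduces this to an identity without the factors
  1/(q)_(n-k), and telescoping in r turns that identity into the evaluation of the alternating sums over w of
  (-1)^w p^(-w^2 - w) / ((q)_(N-w) (q)_(N+w)) and of its analogue with -w^2 + 3w, for which there are
  Wilf-Zeilberger certificates. The remaining outer factors form conjugate Bailey sequences, whose limits
  follow from a first-order recurrence in r, and Tannery's theorem gives each L-series as a double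
  sum over an indefinite quadratic form.

  On the arithmetic side Z[sqrt 6] is Euclidean, so ideals are principal, and a norm congruent to 5 or 7
  mod 8 forces a generator x + y sqrt 6 with 6y^2 - x^2 > 0. The cones |x| < 2y and, in the
  coordinates X = x + 3y, Y = x + 2y, the cone 3|Y| < 2X are fundamental domains for the unit 5 + 2 sqrt 6.
  The lattice points of these cones with the prescribed residues are exactly the index sets of the double sums,
  up to a telescoping correction that explains the -2 in L12.
*)
theory Submission
  imports Defs
begin

section \<open>Bailey pairs\<close>

text \<open>The exponents are completed squares. For p = x^8 the two sequences in w are x^(1 -
  (4w+1)^2) and x^(1 - (4w-3)^2), the same sequence shifted by one, while the factors in r combine
  to x^(24r^2 + 8): this is the form 6y^2 - x^2 at y = 2r. For p = x^24 the outcome is 2X^2 - 3Y^2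
  instead, hence two cones. The sequences in w grow like p^(-2w^2), so their sums have to be treated
  exactly. The index sets for r and r + 2 differ only in the two end points, so the telescoping of
  these sums goes in steps of two. The alternating sums left over are, after q -> 1/q, finite
  pentagonal-type sums with values 1/(q)_N and q^N/(q)_N. Averaging is needed for \<open>L11\<close>
  and \<open>L12\<close> because their outer factor tends, up to the sign (-1)^n, to a nonzero
  limit: the boundary terms of the recurrence alternate rather than vanish. For the given residues
  an ideal has exactly one generator in the cone; y > 0 fixes its sign and leaves (x, y) and (-x, y)
  as different ideals, the source of the factors 2.\<close>

text \<open>Reciprocal of the \<open>q\<close>-factorial, extended by \<open>0\<close> to negative arguments so that sums terminate on their own.\<close>

definition inv_qfact :: "complex \<Rightarrow> int \<Rightarrow> complex" where
  "inv_qfact q m = (if m < 0 then 0 else 1 / qpoch q q (nat m))"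

lemma one_minus_power_nonzero:
  fixes q :: complex
  assumes "norm q < 1" "0 < k"
  shows "1 - q ^ k \<noteq> 0"
proof
  assume "1 - q ^ k = 0"
  then have "norm (q ^ k) = 1" by (metis eq_iff_diff_eq_0 norm_one)
  moreover have "norm q ^ k < 1" using assms by (simp add: power_less_one_iff)
  ultimately show False by (simp add: norm_power)
qed

lemma qpoch_self_nonzero:
  assumes "norm q < 1"
  shows "qpoch q q n \<noteq> 0"
  using one_minus_power_nonzero[OF assms, of "Suc _"] by (auto simp: qpoch_def)

lemma sum_int_telescope:
  fixes G :: "int \<Rightarrow> 'a::ab_group_add"
  assumes "a \<le> b + 1"
  shows "(\<Sum>w=a..b. G (w + 1) - G w) = G (b + 1) - G a"
proof -
  have "(\<Sum>w=a..a + int n - 1. G (w + 1) - G w) = G (a + int n) - G a" for n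
  proof (induction n)
    case (Suc n)
    have "{a..a + int (Suc n) - 1} = insert (a + int n) {a..a + int n - 1}" by auto
    then show ?case using Suc by (simp add: algebra_simps)
  qed simp
  from this[of "nat (b + 1 - a)"] show ?thesis using assms by simp
qed

lemma sum_sym_split:
  fixes h :: "int \<Rightarrow> 'a::comm_monoid_add"
  shows "(\<Sum>w=-int (Suc N)..int (Suc N). h w) = (\<Sum>w=-int N..int N. h w) + (h (int (Suc N)) + h (- int (Suc N)))"
proof -
  have "{-int (Suc N)..int (Suc N)} = insert (int (Suc N)) (insert (- int (Suc N)) {-int N..int N})" by auto
  then show ?thesis by (simp add: algebra_simps)
qed

lemma sum_sym_reflect:
  fixes h :: "int \<Rightarrow> 'a::comm_monoid_add"
  shows "(\<Sum>w=-N..N. h (- w)) = (\<Sum>w=-N..N. h w)"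
  by (rule sum.reindex_bij_witness[of _ uminus uminus]) auto

text \<open>The square root \<open>p\<close> of the base is needed since the exponents of \<open>q\<close> that occur are half-integral.\<close>

locale qbase =
  fixes p q :: complex
  assumes p_nonzero: "p \<noteq> 0" and norm_p: "norm p < 1" and q_eq: "q = p ^ 2"
begin

abbreviation "ip \<equiv> inv_qfact q"

lemma q_nonzero: "q \<noteq> 0" using p_nonzero q_eq by simp

lemma norm_q: "norm q < 1" using norm_p by (simp add: q_eq norm_power power_less_one_iff)

lemma q_powi: "q powi m = p powi (2 * m)"
  by (simp add: q_eq power_int_mult)

lemma ip_neg: "m < 0 \<Longrightarrow> ip m = 0" by (simp add: inv_qfact_def)

lemma ip_0: "ip 0 = 1" by (simp add: inv_qfact_def qpoch_def)

text \<open>Valid at every integer: at m = 0 the factor 1 - q^0 vanishes just as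
  \<open>ip (-1)\<close> does. The telescoping steps below thus hold without case distinctions at
  the ends of the range.\<close>

lemma ip_pred: "ip (m - 1) = (1 - q powi m) * ip m"
proof -
  consider "m < 0" | "m = 0" | k where "m = int (Suc k)"
    by (metis int_cases negative_eq_positive not0_implies_Suc of_nat_0 neg_less_0_iff_less of_nat_0_less_iff zero_less_Suc)
  then show ?thesis
  proof cases
    case (3 k)
    have "qpoch q q (Suc k) = qpoch q q k * (1 - q ^ Suc k)" by (simp add: qpoch_def)
    moreover have "q powi m = q ^ Suc k" using 3 by (metis power_int_of_nat)
    moreover have "ip (m - 1) = 1 / qpoch q q k" "ip m = 1 / qpoch q q (Suc k)"
      unfolding inv_qfact_def 3 by (simp_all del: of_nat_Suc add: nat_diff_distrib)
    ultimately show ?thesis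
      using one_minus_power_nonzero[OF norm_q, of "Suc k"] qpoch_self_nonzero[OF norm_q, of k]
      by (simp del: power_Suc)
  qed (auto simp: inv_qfact_def)
qed

lemma ip_pred2: "ip (m - 2) = (1 - q powi m / q) * (1 - q powi m) * ip m"
  using ip_pred[of m] ip_pred[of "m - 1"] q_nonzero by (simp add: power_int_diff)

section \<open>Telescoping in steps of two\<close>

definition G1 :: "int \<Rightarrow> int \<Rightarrow> complex" where
  "G1 n s = p powi ((s - 1)^2) * ip (n - s) * ip (n + s - 2)"

definition F1 :: "int \<Rightarrow> int \<Rightarrow> complex" where
  "F1 n s = p powi ((s - 1)^2) * (1 - q powi (2 * s)) * ip (n - s) * ip (n + s)"

text \<open>\<open>F1\<close> is a term of the alpha-sequence without its sign and its sum over w,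
  weighted by 1/((q)_(n-s) (q)_(n+s)); \<open>G1\<close> is its antidifference with step two. The
  cleared factor 1 - q^(2n-1) is the origin of the denominators 1 - q^(2k-1) in the series.\<close>

lemma F1_telescope: "(1 - q powi (2 * n - 1)) * F1 n s = G1 n s - G1 n (s + 2)"
proof -
  define A S where "A = q powi n" and "S = q powi s"
  have nz: "A \<noteq> 0" "S \<noteq> 0" using q_nonzero by (auto simp: A_def S_def)
  have 1: "q powi (2 * n - 1) = A^2 / q" using q_nonzero
    by (simp add: A_def power_int_diff power_int_mult mult.commute[of 2])
  have 2: "q powi (2 * s) = S^2" by (simp add: S_def power_int_mult mult.commute[of 2])
  have 3: "p powi ((s + 2 - 1)^2) = p powi ((s - 1)^2) * S^2"
  proof -
    have "(s + 2 - 1)^2 = (s - 1)^2 + 2 * (2 * s)" by (simp add: power2_eq_square algebra_simps)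
    then show ?thesis using p_nonzero 2 by (metis power_int_add q_powi)
  qed
  have 4: "ip (n + s - 2) = (1 - A * S / q) * (1 - A * S) * ip (n + s)"
    using ip_pred2[of "n + s"] q_nonzero by (simp add: A_def S_def power_int_add)
  have 5: "ip (n - s - 2) = (1 - A / S / q) * (1 - A / S) * ip (n - s)"
    using ip_pred2[of "n - s"] q_nonzero by (simp add: A_def S_def power_int_diff)
  have e: "n - (s + 2) = n - s - 2" "n + (s + 2) - 2 = n + s" by simp_all
  define X Y where "X = (1 - A * S / q) * (1 - A * S)" and "Y = (1 - A / S / q) * (1 - A / S)"
  have K: "(1 - A^2 / q) * (1 - S^2) = X - S^2 * Y"
    using nz q_nonzero by (simp add: X_def Y_def field_simps power2_eq_square)
  have "(1 - q powi (2 * n - 1)) * F1 n s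
      = ((1 - A^2 / q) * (1 - S^2)) * (p powi ((s - 1)^2) * ip (n - s) * ip (n + s))"
    unfolding F1_def 1 2 by (simp only: mult_ac)
  also have "\<dots> = G1 n s - G1 n (s + 2)"
    unfolding K G1_def 3 4 5 e X_def[symmetric] Y_def[symmetric] by algebra
  finally show ?thesis .
qed

definition S1 :: "(int \<Rightarrow> complex) \<Rightarrow> nat \<Rightarrow> complex" where
  "S1 \<tau> R = (\<Sum>i<R. \<tau> (int R - 1 - 2 * int i))"

lemma S1_step: "S1 \<tau> (Suc (Suc R)) = S1 \<tau> R + \<tau> (int (Suc R)) + \<tau> (- int (Suc R))"
proof -
  have "S1 \<tau> (Suc (Suc R)) = \<tau> (int (Suc R)) + (\<Sum>i<Suc R. \<tau> (int R - 1 - 2 * int i))"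
    unfolding S1_def by (subst sum.lessThan_Suc_shift) (simp add: algebra_simps)
  then show ?thesis by (simp add: S1_def algebra_simps)
qed

text \<open>Summation by parts with step two: by \<open>S1_step\<close> the difference of
  \<open>S1\<close> at R + 1 and R - 1 is \<open>\<tau> R + \<tau> (- R)\<close>, and the weight
  \<open>G1 n (w + 1)\<close> is p^(w^2) / ((q)_(n-1-w) (q)_(n-1+w)). The double sum collapses to
  one symmetric sum over w.\<close>

lemma F1_S1_sum:
  "(1 - q powi (2 * int n - 1)) * (\<Sum>R<n. (-1) ^ Suc R * F1 (int n) (int (Suc R)) * S1 \<tau> (Suc R)) =
   - (\<Sum>w=-(int n - 1)..int n - 1. (-1) powi w * p powi (w^2) * \<tau> w * ip (int n - 1 - w) * ip (int n - 1 + w))"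
proof (cases n)
  case 0
  then show ?thesis by simp
next
  case (Suc N)
  define g where "g R = G1 (int n) (int R)" for R
  define c where "c w = (-1) powi w * p powi (w^2) * \<tau> w * ip (int n - 1 - w) * ip (int n - 1 + w)" for w
  \<comment> \<open>Step two leaves two boundary terms at the upper end; both vanish for m = n,
    where an argument of \<open>ip\<close> is negative.\<close>
  have step: "(\<Sum>R<m. (-1) ^ Suc R * (g (Suc R) - g (Suc R + 2)) * S1 \<tau> (Suc R)) =
     - (\<Sum>w=-(int m - 1)..int m - 1. c w)
     + (-1) ^ m * g (m+1) * S1 \<tau> (m - 1) - (-1) ^ m * g (m + 2) * S1 \<tau> m" if "m > 0" for m
    using that
  proof (induction m rule: nat_induct_non_zero)
    case 1
    show ?case using Suc by (simp add: c_def g_def G1_def S1_def algebra_simps)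
  next
    case (Suc m)
    have a: "g (Suc m) = p powi (int m ^ 2) * ip (int n - 1 - int m) * ip (int n - 1 + int m)"
      by (simp add: g_def G1_def algebra_simps)
    obtain k where k: "m = Suc k" using Suc(1) by (metis gr0_conv_Suc)
    have m1: "(-1::complex) powi (int m) = (-1) ^ m" "(-1::complex) powi (- int m) = (-1) ^ m"
      by (cases "even m"; simp add: power_int_minus)+
    have "c (int m) + c (- int m) = (-1) ^ m * g (Suc m) * (\<tau> (int m) + \<tau> (- int m))"
      unfolding c_def a m1 by (simp add: algebra_simps)
    also have "\<tau> (int m) + \<tau> (- int m) = S1 \<tau> (Suc m) - S1 \<tau> (m - 1)"
      using S1_step[of \<tau> k] unfolding k by simp
    finally have b: "c (int m) + c (- int m) = (-1) ^ m * g (Suc m) * (S1 \<tau> (Suc m) - S1 \<tau> (m - 1))" .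
    have s: "(\<Sum>w=-(int (Suc m) - 1)..int (Suc m) - 1. c w) = (\<Sum>w=-(int m - 1)..int m - 1. c w) + (c (int m) + c (- int m))"
      using sum_sym_split[of c k] unfolding k by simp
    show ?case unfolding s b sum.lessThan_Suc Suc.IH by (simp add: algebra_simps)
  qed
  have z: "g (n + 1) = 0" "g (n + 2) = 0" by (simp_all add: g_def G1_def ip_neg)
  have "(1 - q powi (2 * int n - 1)) * (\<Sum>R<n. (-1) ^ Suc R * F1 (int n) (int (Suc R)) * S1 \<tau> (Suc R)) =
    (\<Sum>R<n. (-1) ^ Suc R * ((1 - q powi (2 * int n - 1)) * F1 (int n) (int (Suc R))) * S1 \<tau> (Suc R))"
    by (simp add: sum_distrib_left mult_ac)
  also have "\<dots> = (\<Sum>R<n. (-1) ^ Suc R * (g (Suc R) - g (Suc R + 2)) * S1 \<tau> (Suc R))"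
    unfolding F1_telescope g_def by (simp add: algebra_simps)
  also have "\<dots> = - (\<Sum>w=-(int n - 1)..int n - 1. c w)"
    using step[of n] Suc z by simp
  finally show ?thesis unfolding c_def .
qed

lemma neg_one_powi_minus: "(-1::complex) powi (- w) = (-1) powi w"
  by (cases "even w") (auto simp: power_int_minus)

section \<open>A recurrence for the alternating sums\<close>

definition T1 :: "(int \<Rightarrow> complex) \<Rightarrow> int \<Rightarrow> int \<Rightarrow> complex" where
  "T1 h N w = (-1) powi w * p powi (-(w^2)) * h w * ip (N - w) * ip (N + w)"

text \<open>\<open>wz\<close> is the Wilf-Zeilberger equation divided by the common factor of all
  terms: h is the variable part of the summand, g the certificate, and \<mu> determines the ratio of
  consecutive sums. The telescoped \<open>H\<close> vanishes at both ends, -N and N + 1.\<close>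

lemma T1_sum_rec:
  assumes wz: "\<And>w. h w * (1 - q powi N) + \<mu> * h w * (1 - q powi (N - w)) * (1 - q powi (N + w))
      = - (p powi (-2 * w - 1)) * g (w + 1) * (1 - q powi (N - w)) - g w * (1 - q powi (N + w))"
    and N: "N > 0"
  shows "(1 - q powi N) * (\<Sum>w=-N..N. T1 h N w) = - \<mu> * (\<Sum>w=-(N-1)..N-1. T1 h (N - 1) w)"
proof -
  define H where "H w = (-1) powi w * p powi (-(w^2)) * g w * ip (N - w) * ip (N + w - 1)" for w
  have step: "T1 h N w * (1 - q powi N) + \<mu> * T1 h (N - 1) w = H (w + 1) - H w" for w
  proof -
    define c X Y where "c = (-1) powi w * p powi (-(w^2)) * ip (N - w) * ip (N + w)"
      and "X = 1 - q powi (N - w)" and "Y = 1 - q powi (N + w)"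
    have a: "ip (N - 1 - w) = X * ip (N - w)" "ip (N - 1 + w) = Y * ip (N + w)"
      using ip_pred[of "N - w"] ip_pred[of "N + w"] by (simp_all add: X_def Y_def algebra_simps)
    have b: "(-1::complex) powi (w + 1) = - ((-1) powi w)" by (simp add: power_int_add)
    have c: "p powi (-((w+1)^2)) = p powi (-(w^2)) * p powi (-2 * w - 1)"
    proof -
      have e: "-((w+1)^2) = -(w^2) + (-2 * w - 1)" by (simp add: power2_eq_square algebra_simps)
      show ?thesis unfolding e by (rule power_int_add) (use p_nonzero in simp)
    qed
    have i: "N - (w + 1) = N - 1 - w" "N + (w + 1) - 1 = N + w" "N + w - 1 = N - 1 + w" by simp_all
    have "T1 h N w * (1 - q powi N) + \<mu> * T1 h (N - 1) w = c * (h w * (1 - q powi N) + \<mu> * h w * X * Y)"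
      unfolding T1_def c_def a by (simp add: algebra_simps)
    also have "\<dots> = c * (- (p powi (-2 * w - 1)) * g (w + 1) * X - g w * Y)"
      using wz[of w] unfolding X_def Y_def by simp
    also have "\<dots> = H (w + 1) - H w"
      unfolding H_def c_def i a b c by (simp add: algebra_simps)
    finally show ?thesis .
  qed
  have "(\<Sum>w=-N..N. T1 h N w * (1 - q powi N) + \<mu> * T1 h (N - 1) w) = H (N + 1) - H (- N)"
    unfolding step using N by (intro sum_int_telescope) auto
  also have "\<dots> = 0" by (simp add: H_def ip_neg)
  finally have "(1 - q powi N) * (\<Sum>w=-N..N. T1 h N w) + \<mu> * (\<Sum>w=-N..N. T1 h (N - 1) w) = 0"
    by (simp add: sum.distrib sum_distrib_left mult_ac)
  moreover have "(\<Sum>w=-N..N. T1 h (N - 1) w) = (\<Sum>w=-(N-1)..N-1. T1 h (N - 1) w)"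
  proof (rule sum.mono_neutral_right)
    show "\<forall>w\<in>{-N..N} - {-(N-1)..N-1}. T1 h (N - 1) w = 0"
    proof
      fix w assume "w \<in> {-N..N} - {-(N-1)..N-1}"
      then have "N - 1 - w < 0 \<or> N - 1 + w < 0" by auto
      then show "T1 h (N - 1) w = 0" by (auto simp: T1_def ip_neg)
    qed
  qed auto
  ultimately show ?thesis by (simp add: eq_neg_iff_add_eq_0)
qed

text \<open>The exponents 2j + c accumulate over j = 1, ..., N to N^2 + (c + 1) N. The leading 2 is
  \<open>h 0\<close>, since in the applications h is a symmetrised sum of two powers.\<close>

lemma T1_sum_closed:
  assumes rec: "\<And>N::nat. (1 - q powi int (Suc N)) * (\<Sum>w=-int (Suc N)..int (Suc N). T1 h (int (Suc N)) w)
      = - (p powi (- (2 * int (Suc N) + c))) * (\<Sum>w=-int N..int N. T1 h (int N) w)"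
    and h0: "h 0 = 2"
  shows "(\<Sum>w=-int N..int N. T1 h (int N) w) = 2 * (-1) ^ N * p powi (- (int N ^ 2 + (c + 1) * int N)) * ip (int N)"
proof (induction N)
  case 0
  then show ?case by (simp add: T1_def ip_0 h0)
next
  case (Suc N)
  have nz: "1 - q powi int (Suc N) \<noteq> 0"
    using one_minus_power_nonzero[OF norm_q, of "Suc N"] by (metis power_int_of_nat zero_less_Suc)
  have ip: "ip (int N) = (1 - q powi int (Suc N)) * ip (int (Suc N))"
    using ip_pred[of "int (Suc N)"] by simp
  have e: "- (int (Suc N) ^ 2 + (c + 1) * int (Suc N)) = - (2 * int (Suc N) + c) + - (int N ^ 2 + (c + 1) * int N)"
    by (simp add: power2_eq_square algebra_simps)
  have pe: "p powi (- (int (Suc N) ^ 2 + (c + 1) * int (Suc N))) = p powi (- (2 * int (Suc N) + c)) * p powi (- (int N ^ 2 + (c + 1) * int N))"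
    unfolding e using p_nonzero by (intro power_int_add) simp
  have "(1 - q powi int (Suc N)) * (\<Sum>w=-int (Suc N)..int (Suc N). T1 h (int (Suc N)) w)
    = (1 - q powi int (Suc N)) * (2 * (-1) ^ Suc N * p powi (- (int (Suc N) ^ 2 + (c + 1) * int (Suc N))) * ip (int (Suc N)))"
    unfolding rec Suc.IH ip pe by (simp add: mult_ac del: of_nat_Suc)
  then show ?case using nz by (simp only: mult_cancel_left) simp
qed

lemma T1_sum_odd:
  fixes N :: nat
  shows "(\<Sum>w=-int N..int N. (-1) powi w * p powi (- (w^2) + c * w) * ip (int N - w) * ip (int N + w)) =
    (\<Sum>w=-int N..int N. T1 (\<lambda>w. p powi (c * w) + p powi (- c * w)) (int N) w) / 2"
proof -
  define f where "f c w = (-1) powi w * p powi (- (w^2) + c * w) * ip (int N - w) * ip (int N + w)" for c w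
  have pw: "p powi (- (w^2) + c * w) = p powi (- (w^2)) * p powi (c * w)" for c w
    by (rule power_int_add) (use p_nonzero in simp)
  have "f c (- w) = f (- c) w" for w
    unfolding f_def neg_one_powi_minus by (simp add: mult_ac)
  then have "(\<Sum>w=-int N..int N. f c w) = (\<Sum>w=-int N..int N. f (- c) w)"
    using sum_sym_reflect[of "f c" "int N"] by simp
  then have "(\<Sum>w=-int N..int N. f c w) = (\<Sum>w=-int N..int N. f c w + f (- c) w) / 2"
    by (simp add: sum.distrib)
  also have "(\<lambda>w. f c w + f (- c) w) = T1 (\<lambda>w. p powi (c * w) + p powi (- c * w)) (int N)"
    unfolding f_def T1_def pw by (simp add: fun_eq_iff ring_distribs mult_ac)
  finally show ?thesis by (simp only: f_def)
qed

section \<open>q-Vandermonde and the Bailey lemma\<close>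

lemma q_vandermonde:
  fixes M s :: nat
  shows "ip (int M) * ip (int M + int s) = (\<Sum>j\<le>M. q ^ (j^2 + s * j) * ip (int M - int j) * ip (int j) * ip (int j + int s))"
proof (induction M arbitrary: s)
  case 0
  then show ?case by (simp add: ip_0)
next
  case (Suc M)
  define u where "u s j = q ^ (j^2 + s * j) * ip (int M - int j) * ip (int j) * ip (int j + int s)" for s j
  define v where "v j = q ^ (j^2 + s * j) * ip (int (Suc M) - int j) * ip (int j) * ip (int j + int s)" for j
  have nz: "1 - q ^ Suc M \<noteq> 0" using one_minus_power_nonzero[OF norm_q] by blast
  have ip': "ip (int j) = (1 - q ^ Suc j) * ip (int (Suc j))" for j
    using ip_pred[of "int (Suc j)"] by (simp only: power_int_of_nat) simp
  \<comment> \<open>From 1 - q^(M+1) = q^j (1 - q^(M+1-j)) + (1 - q^j): each bracket lowers one of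
    the q-factorials. After shifting j in the second sum the two halves merge into the sum for s + 1
    at M, hence the induction with s arbitrary.\<close>
  have split: "(1 - q ^ Suc M) * v j = q ^ (j^2 + s * j + j) * ip (int M - int j) * ip (int j) * ip (int j + int s)
      + q ^ (j^2 + s * j) * ip (int (Suc M) - int j) * ip (int j - 1) * ip (int j + int s)" if "j \<le> Suc M" for j
  proof -
    have a: "ip (int M - int j) = (1 - q ^ (Suc M - j)) * ip (int (Suc M) - int j)"
      using ip_pred[of "int (Suc M) - int j"] that power_int_of_nat[of q "Suc M - j"] by (simp add: of_nat_diff)
    have b: "ip (int j - 1) = (1 - q ^ j) * ip (int j)"
      using ip_pred[of "int j"] by simp
    have c: "q ^ Suc M = q ^ j * q ^ (Suc M - j)" using that by (simp flip: power_add)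
    show ?thesis unfolding a b c v_def power_add by (simp add: algebra_simps)
  qed
  have "(1 - q ^ Suc M) * (\<Sum>j\<le>Suc M. v j) = (\<Sum>j\<le>Suc M. q ^ (j^2 + s * j + j) * ip (int M - int j) * ip (int j) * ip (int j + int s))
      + (\<Sum>j\<le>Suc M. q ^ (j^2 + s * j) * ip (int (Suc M) - int j) * ip (int j - 1) * ip (int j + int s))"
    unfolding sum_distrib_left sum.distrib[symmetric] by (rule sum.cong[OF refl split]) simp
  also have "(\<Sum>j\<le>Suc M. q ^ (j^2 + s * j + j) * ip (int M - int j) * ip (int j) * ip (int j + int s)) =
     (\<Sum>j\<le>M. q ^ (j^2 + s * j + j) * ip (int M - int j) * ip (int j) * ip (int j + int s))"
    by (simp add: ip_neg)
  also have "(\<Sum>j\<le>Suc M. q ^ (j^2 + s * j) * ip (int (Suc M) - int j) * ip (int j - 1) * ip (int j + int s)) =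
     (\<Sum>j\<le>M. q ^ (Suc j ^ 2 + s * Suc j) * ip (int M - int j) * ip (int j) * ip (int (Suc j) + int s))"
    by (subst sum.atMost_Suc_shift) (simp add: ip_neg)
  also have "(\<Sum>j\<le>M. q ^ (j^2 + s * j + j) * ip (int M - int j) * ip (int j) * ip (int j + int s)) + \<dots> = (\<Sum>j\<le>M. u (Suc s) j)"
    unfolding sum.distrib[symmetric]
  proof (rule sum.cong[OF refl])
    fix j
    have a: "ip (int j + int s) = (1 - q ^ (j + s + 1)) * ip (int j + int (Suc s))"
      using ip'[of "j + s"] by (simp add: algebra_simps)
    have b: "int (Suc j) + int s = int j + int (Suc s)" by simp
    have c: "Suc j ^ 2 + s * Suc j = (j^2 + s * j + j) + (j + s + 1)" "j^2 + Suc s * j = j^2 + s * j + j"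
      by (simp_all add: power2_eq_square)
    show "q ^ (j^2 + s * j + j) * ip (int M - int j) * ip (int j) * ip (int j + int s) +
       q ^ (Suc j ^ 2 + s * Suc j) * ip (int M - int j) * ip (int j) * ip (int (Suc j) + int s) = u (Suc s) j"
      unfolding u_def c a b power_add[of q _ "j + s + 1"] by (simp add: algebra_simps)
  qed
  also have "\<dots> = ip (int M) * ip (int M + int (Suc s))" using Suc.IH[of "Suc s"] by (simp only: u_def)
  also have "\<dots> = (1 - q ^ Suc M) * (ip (int (Suc M)) * ip (int (Suc M) + int s))"
    unfolding ip'[of M] by (simp add: algebra_simps)
  finally show ?case using nz by (simp only: mult_cancel_left v_def) simp
qed

text \<open>\<open>q_vandermonde\<close> with M = n - r, s = 2r + e and k = j + r. This is the
  kernel of Bailey's lemma for a = q^e with both free parameters sent to infinity; e = 0 serves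
  \<open>L9\<close> and \<open>L10\<close>, e = 1 serves \<open>L11\<close> and
  \<open>L12\<close>.\<close>

lemma bailey_vandermonde:
  fixes n r e :: nat
  shows "q ^ (r^2 + e * r) * ip (int n - int r) * ip (int n + int r + int e) =
    (\<Sum>k\<le>n. q ^ (k^2 + e * k) * ip (int n - int k) * ip (int k - int r) * ip (int k + int r + int e))"
proof (cases "r \<le> n")
  case False
  then show ?thesis by (simp add: ip_neg)
next
  case True
  have "(\<Sum>k\<le>n. q ^ (k^2 + e * k) * ip (int n - int k) * ip (int k - int r) * ip (int k + int r + int e)) =
     (\<Sum>k\<in>{r..n}. q ^ (k^2 + e * k) * ip (int n - int k) * ip (int k - int r) * ip (int k + int r + int e))"
    by (rule sum.mono_neutral_right) (auto simp: ip_neg)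
  also have "\<dots> = (\<Sum>j\<le>n - r. q ^ (r^2 + e * r) * (q ^ (j^2 + (2 * r + e) * j) * ip (int (n - r) - int j) * ip (int j) * ip (int j + int (2 * r + e))))"
  proof (rule sum.reindex_bij_witness[of _ "\<lambda>j. j + r" "\<lambda>k. k - r"])
    fix k assume k: "k \<in> {r..n}"
    define j where "j = k - r"
    have kj: "k = j + r" using k by (simp add: j_def)
    have e: "k^2 + e * k = (r^2 + e * r) + (j^2 + (2 * r + e) * j)"
      unfolding kj by (simp add: power2_eq_square algebra_simps)
    show "q ^ (r^2 + e * r) * (q ^ ((k-r)^2 + (2 * r + e) * (k-r)) * ip (int (n - r) - int (k-r)) * ip (int (k-r)) * ip (int (k-r) + int (2 * r + e)))
      = q ^ (k^2 + e * k) * ip (int n - int k) * ip (int k - int r) * ip (int k + int r + int e)"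
      unfolding e power_add j_def[symmetric] using True by (simp add: kj of_nat_diff algebra_simps)
  qed (use True in auto)
  also have "\<dots> = q ^ (r^2 + e * r) * (ip (int (n - r)) * ip (int (n - r) + int (2 * r + e)))"
    unfolding q_vandermonde sum_distrib_left ..
  finally show ?thesis using True by (simp add: of_nat_diff algebra_simps)
qed

lemma bailey_pair_lift:
  fixes n e :: nat
  shows "(\<Sum>r\<le>n. q ^ (r^2 + e * r) * c r * ip (int n - int r) * ip (int n + int r + int e)) =
    (\<Sum>k\<le>n. q ^ (k^2 + e * k) * ip (int n - int k) * (\<Sum>r\<le>k. c r * ip (int k - int r) * ip (int k + int r + int e)))"
proof -
  have "(\<Sum>r\<le>n. q ^ (r^2 + e * r) * c r * ip (int n - int r) * ip (int n + int r + int e)) =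
     (\<Sum>r\<le>n. c r * (q ^ (r^2 + e * r) * ip (int n - int r) * ip (int n + int r + int e)))"
    by (simp add: mult_ac)
  also have "\<dots> = (\<Sum>k\<le>n. \<Sum>r\<le>n. c r * (q ^ (k^2 + e * k) * ip (int n - int k) * ip (int k - int r) * ip (int k + int r + int e)))"
    unfolding bailey_vandermonde sum_distrib_left by (rule sum.swap)
  also have "\<dots> = (\<Sum>k\<le>n. \<Sum>r\<le>k. c r * (q ^ (k^2 + e * k) * ip (int n - int k) * ip (int k - int r) * ip (int k + int r + int e)))"
    by (intro sum.cong refl sum.mono_neutral_right) (auto simp: ip_neg)
  finally show ?thesis by (simp add: sum_distrib_left mult_ac)
qed

end

text \<open>The certificates (the functions \<open>g\<close>) for the two alternating sums below; here \<open>A = p\<^sup>N\<close> and \<open>P = p\<^sup>w\<close>.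
  A certificate exists only after symmetrising the summand in \<open>w\<close>.\<close>

lemma wz_A:
  fixes A P p :: complex
  assumes nz: "A \<noteq> 0" "P \<noteq> 0" "p \<noteq> 0"
  shows "(P + 1 / P) * (1 - A^2) + 1 / A^2 * (P + 1 / P) * (1 - A^2 / P^2) * (1 - A^2 * P^2)
     = - (1 / (P^2 * p)) * (- P * p / A^2) * (1 - A^2 / P^2) - (- P / A^2) * (1 - A^2 * P^2)"
proof -
  define u b s where "u = 1 / P" and "b = 1 / A" and "s = 1 / p"
  have h: "P * u = 1" "A * b = 1" "p * s = 1" using nz by (simp_all add: u_def b_def s_def)
  have "(P + u) * (1 - A^2) + b^2 * (P + u) * (1 - A^2 * u^2) * (1 - A^2 * P^2)
     = - (u^2 * s) * (- P * p * b^2) * (1 - A^2 * u^2) - (- P * b^2) * (1 - A^2 * P^2)"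
    using h by algebra
  then show ?thesis by (simp add: u_def b_def s_def power_divide)
qed

lemma wz_D:
  fixes A P p :: complex
  assumes nz: "A \<noteq> 0" "P \<noteq> 0" "p \<noteq> 0"
  shows "(P^3 + 1 / P^3) * (1 - A^2) + 1 / (A^2 * p^2) * (P^3 + 1 / P^3) * (1 - A^2 / P^2) * (1 - A^2 * P^2)
     = - (1 / (P^2 * p)) * ((- (P^3) * p + P * p - 1 / (P * p)) / A^2 + (1 / p^2 - 1) * (P * p)) * (1 - A^2 / P^2)
       - ((- (P^3) / p^2 + P - 1 / P) / A^2 + (1 / p^2 - 1) * P) * (1 - A^2 * P^2)"
proof -
  define u b s where "u = 1 / P" and "b = 1 / A" and "s = 1 / p"
  have h: "P * u = 1" "A * b = 1" "p * s = 1" using nz by (simp_all add: u_def b_def s_def)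
  have "(P^3 + u^3) * (1 - A^2) + (b^2 * s^2) * (P^3 + u^3) * (1 - A^2 * u^2) * (1 - A^2 * P^2)
     = - (u^2 * s) * ((- (P^3) * p + P * p - u * s) * b^2 + (s^2 - 1) * (P * p)) * (1 - A^2 * u^2)
       - ((- (P^3) * s^2 + P - u) * b^2 + (s^2 - 1) * P) * (1 - A^2 * P^2)"
    using h by algebra
  then show ?thesis by (simp add: u_def b_def s_def power_divide)
qed

context qbase
begin

lemma p_powi_double: "p powi (2 * m) = (p powi m)^2" "p powi (m * 2) = (p powi m)^2"
  by (simp_all add: power_int_mult mult.commute[of 2])

lemma p_powi_triple: "p powi (3 * m) = (p powi m)^3"
  by (simp add: power_int_mult mult.commute[of 3])

lemmas p_powi_simps = power_int_add[OF disjI1[OF p_nonzero]] power_int_diff[OF disjI1[OF p_nonzero]]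
  power_int_minus_divide p_powi_double p_powi_triple

text \<open>Replacing q by 1/q turns this into the sum of (-1)^w q^(w(3w+1)/2) / ((q)_(N-w)
  (q)_(N+w)) with value 1/(q)_N, a finite form of Euler's pentagonal number theorem.\<close>

lemma alternating_sum_A:
  fixes N :: nat
  shows "(\<Sum>w=-int N..int N. (-1) powi w * p powi (- (w^2) + (-1) * w) * ip (int N - w) * ip (int N + w)) =
    (-1) ^ N * p powi (- (int N ^ 2 + int N)) * ip (int N)"
proof -
  define h where "h = (\<lambda>w. p powi ((-1) * w) + p powi (- (-1) * w))"
  have "(1 - q powi N) * (\<Sum>w=-N..N. T1 h N w) = - (p powi (- (2 * N + 0))) * (\<Sum>w=-(N-1)..N-1. T1 h (N - 1) w)"
    if "N > 0" for N
  proof -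
    define g where "g w = - (p powi (w - 2 * N))" for w
    show ?thesis
    proof (rule T1_sum_rec[where g = g, OF _ that])
      fix w
      define A P where "A = p powi N" and "P = p powi w"
      have nz: "A \<noteq> 0" "P \<noteq> 0" using p_nonzero by (auto simp: A_def P_def)
      have i: "-2 * w - 1 = - (2 * w) - 1" by simp
      have e: "q powi N = A^2" "q powi (N - w) = A^2 / P^2" "q powi (N + w) = A^2 * P^2"
          "p powi (-(2 * N + 0)) = 1 / A^2" "h w = P + 1 / P"
          "p powi (-2 * w - 1) = 1 / (P^2 * p)" "g (w + 1) = - P * p / A^2" "g w = - P / A^2"
        unfolding A_def P_def q_powi h_def g_def i
        by (simp_all add: p_powi_simps right_diff_distrib' distrib_left)
      show "h w * (1 - q powi N) + p powi (-(2 * N + 0)) * h w * (1 - q powi (N - w)) * (1 - q powi (N + w))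
        = - (p powi (-2 * w - 1)) * g (w + 1) * (1 - q powi (N - w)) - g w * (1 - q powi (N + w))"
        unfolding e by (rule wz_A[OF nz p_nonzero])
    qed
  qed
  from this[of "int (Suc _)"] T1_sum_closed[of h 0 N]
  show ?thesis unfolding T1_sum_odd h_def by simp
qed

text \<open>After q -> 1/q this is the companion sum with exponent 3w(w-1)/2 and value q^N/(q)_N;
  the additional q^N is what changes the constant c of the recurrence from 0 to 2.\<close>

lemma alternating_sum_D:
  fixes N :: nat
  shows "(\<Sum>w=-int N..int N. (-1) powi w * p powi (- (w^2) + 3 * w) * ip (int N - w) * ip (int N + w)) =
    (-1) ^ N * p powi (- (int N ^ 2 + 3 * int N)) * ip (int N)"
proof -
  define h where "h = (\<lambda>w. p powi (3 * w) + p powi (- 3 * w))"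
  have "(1 - q powi N) * (\<Sum>w=-N..N. T1 h N w) = - (p powi (- (2 * N + 2))) * (\<Sum>w=-(N-1)..N-1. T1 h (N - 1) w)"
    if "N > 0" for N
  proof -
    define g where "g w = p powi (- (2 * N)) * (- (p powi (3 * w - 2)) + p powi w - p powi (- w)) + (p powi (-2) - 1) * p powi w" for w
    show ?thesis
    proof (rule T1_sum_rec[where g = g, OF _ that])
      fix w
      define A P where "A = p powi N" and "P = p powi w"
      have nz: "A \<noteq> 0" "P \<noteq> 0" using p_nonzero by (auto simp: A_def P_def)
      have i: "-2 * w - 1 = - (2 * w) - 1" "3 * (w + 1) - 2 = 3 * w + 1" "- 3 * w = - (3 * w)" by simp_all
      have e: "q powi N = A^2" "q powi (N - w) = A^2 / P^2" "q powi (N + w) = A^2 * P^2"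
          "p powi (-(2 * N + 2)) = 1 / (A^2 * p^2)" "h w = P^3 + 1 / P^3"
          "p powi (-2 * w - 1) = 1 / (P^2 * p)"
        unfolding A_def P_def q_powi h_def i
        by (simp_all add: p_powi_simps right_diff_distrib' distrib_left)
      have g: "g (w + 1) = (- (P^3) * p + P * p - 1 / (P * p)) / A^2 + (1 / p^2 - 1) * (P * p)"
          "g w = (- (P^3) / p^2 + P - 1 / P) / A^2 + (1 / p^2 - 1) * P"
        unfolding A_def P_def g_def i
        by (simp_all add: p_powi_simps power_int_minus_divide[of p 2] power_int_minus_divide[of p "2 * N"])
      show "h w * (1 - q powi N) + p powi (-(2 * N + 2)) * h w * (1 - q powi (N - w)) * (1 - q powi (N + w))
        = - (p powi (-2 * w - 1)) * g (w + 1) * (1 - q powi (N - w)) - g w * (1 - q powi (N + w))"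
        unfolding e g by (rule wz_D[OF nz p_nonzero])
    qed
  qed
  from this[of "int (Suc _)"] T1_sum_closed[of h 2 N]
  show ?thesis unfolding T1_sum_odd h_def by simp
qed

end

lemma double_choose_two: "2 * (Suc k choose 2) = k^2 + k" "2 * (k choose 2) + k = k^2"
  by (induction k) (simp_all add: numeral_2_eq_2 power2_eq_square)

lemma eq_divide_of_mult:
  fixes c :: "'a::field"
  shows "c \<noteq> 0 \<Longrightarrow> c * x = z \<Longrightarrow> x = z / c"
  by (simp add: field_simps)

section \<open>The inner sums as beta-sequences\<close>

context qbase
begin

lemma q_pow: "q ^ m = p powi (2 * int m)"
  using q_powi[of "int m"] by (simp only: power_int_of_nat)

lemma q_pow_mult_powi: "q ^ m * p powi x = p powi (2 * int m + x)"
  unfolding q_pow using p_nonzero by (subst power_int_add[symmetric]) auto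

lemma p_mult_powi: "p * p powi x = p powi (1 + x)"
  using p_nonzero by (simp add: power_int_add)

lemma q_pow_choose: "q ^ (Suc k choose 2) = p powi (int k ^ 2 + int k)" "q ^ (k choose 2) = p powi (int k ^ 2 - int k)"
proof -
  have "int (2 * (Suc k choose 2)) = int (k^2 + k)" "int (2 * (k choose 2) + k) = int (k^2)"
    unfolding double_choose_two by (rule refl)+
  then have "2 * int (Suc k choose 2) = int k ^ 2 + int k" "2 * int (k choose 2) = int k ^ 2 - int k"
    by simp_all
  then show "q ^ (Suc k choose 2) = p powi (int k ^ 2 + int k)" "q ^ (k choose 2) = p powi (int k ^ 2 - int k)"
    unfolding q_pow by simp_all
qed

text \<open>Both exponents are (1 - (4w + c)^2) / 8, with c = 1 here and c = -3 for
  \<open>\<tau>D\<close>. Multiplied by p^(w^2) they become the exponents -w^2 - w and -w^2 + 3w - 1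
  of the alternating sums.\<close>

definition \<tau>A :: "int \<Rightarrow> complex" where "\<tau>A w = p powi (- 2 * w^2 - w)"
definition \<tau>D :: "int \<Rightarrow> complex" where "\<tau>D w = p powi (- 2 * w^2 + 3 * w - 1)"

lemma alternating_\<tau>A:
  "(\<Sum>w=-int N..int N. (-1) powi w * p powi (w^2) * \<tau>A w * ip (int N - w) * ip (int N + w)) =
    (-1) ^ N * p powi (- (int N ^ 2 + int N)) * ip (int N)"
proof -
  have "p powi (w^2) * \<tau>A w = p powi (- (w^2) + (-1) * w)" for w
    unfolding \<tau>A_def using p_nonzero by (subst power_int_add[symmetric]) auto
  then have "(\<Sum>w=-int N..int N. (-1) powi w * p powi (w^2) * \<tau>A w * ip (int N - w) * ip (int N + w))
    = (\<Sum>w=-int N..int N. (-1) powi w * p powi (- (w^2) + (-1) * w) * ip (int N - w) * ip (int N + w))"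
    by (simp only: mult.assoc[of "(-1) powi _" "p powi _"])
  then show ?thesis by (simp only: alternating_sum_A)
qed

lemma alternating_\<tau>D:
  "(\<Sum>w=-int N..int N. (-1) powi w * p powi (w^2) * \<tau>D w * ip (int N - w) * ip (int N + w)) =
    (-1) ^ N * p powi (- (int N ^ 2 + 3 * int N + 1)) * ip (int N)"
proof -
  have a: "p powi (w^2) * \<tau>D w = p powi (- (w^2) + 3 * w) / p" for w
  proof -
    have e: "w^2 + (- 2 * w^2 + 3 * w - 1) = (- (w^2) + 3 * w) - 1" by simp
    have "p powi (w^2) * \<tau>D w = p powi (w^2 + (- 2 * w^2 + 3 * w - 1))"
      unfolding \<tau>D_def using p_nonzero by (subst power_int_add) auto
    also have "\<dots> = p powi (- (w^2) + 3 * w) / p"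
      unfolding e using p_nonzero by (subst power_int_diff) auto
    finally show ?thesis .
  qed
  have b: "p powi (- (int N ^ 2 + 3 * int N + 1)) = p powi (- (int N ^ 2 + 3 * int N)) / p"
  proof -
    have e: "- (int N ^ 2 + 3 * int N + 1) = - (int N ^ 2 + 3 * int N) - 1" by simp
    show ?thesis unfolding e using p_nonzero by (subst power_int_diff) auto
  qed
  have "(\<Sum>w=-int N..int N. (-1) powi w * p powi (w^2) * \<tau>D w * ip (int N - w) * ip (int N + w))
    = (\<Sum>w=-int N..int N. (-1) powi w * (p powi (w^2) * \<tau>D w) * ip (int N - w) * ip (int N + w))"
    by (simp only: mult.assoc)
  also have "\<dots> = (\<Sum>w=-int N..int N. (-1) powi w * p powi (- (w^2) + 3 * w) * ip (int N - w) * ip (int N + w)) / p"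
    unfolding a by (simp add: sum_divide_distrib)
  finally show ?thesis unfolding alternating_sum_D b by simp
qed

text \<open>The alpha-sequence one Bailey step earlier: the factor q^(r^2), respectively q^(r^2 +
  r), is only put on in \<open>B_even\<close> and \<open>B_odd\<close>, by
  \<open>bailey_pair_lift\<close>.\<close>

definition c_even :: "(int \<Rightarrow> complex) \<Rightarrow> nat \<Rightarrow> complex" where
  "c_even \<tau> r = (-1) ^ r * p powi ((int r - 1)^2) * (1 - q powi (2 * int r)) * S1 \<tau> r"

definition c_odd :: "(int \<Rightarrow> complex) \<Rightarrow> nat \<Rightarrow> complex" where
  "c_odd \<tau> r = (-1) ^ r * (p powi (int r ^ 2) * S1 \<tau> (Suc r) + p powi ((int r + 1)^2) * S1 \<tau> r)"

text \<open>\<open>F1_S1_sum\<close> at n = N + 1 returns the alternating sum at N, hence the shift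
  by one between hypothesis and conclusion. The term r = 0 drops out because \<open>S1\<close> is
  empty there.\<close>

lemma c_even_sum:
  assumes alt: "(\<Sum>w=-int N..int N. (-1) powi w * p powi (w^2) * \<tau> w * ip (int N - w) * ip (int N + w)) = (-1) ^ N * \<kappa> * ip (int N)"
  shows "(\<Sum>r\<le>Suc N. c_even \<tau> r * ip (int (Suc N) - int r) * ip (int (Suc N) + int r + int 0))
     = (-1) ^ Suc N * \<kappa> * ip (int N) / (1 - q ^ Suc (2 * N))"
proof -
  have nz: "1 - q ^ Suc (2 * N) \<noteq> 0" using one_minus_power_nonzero[OF norm_q] by blast
  have e: "q powi (2 * int (Suc N) - 1) = q ^ Suc (2 * N)"
  proof -
    have "2 * int (Suc N) - 1 = int (Suc (2 * N))" by simp
    then show ?thesis by (simp only: power_int_of_nat)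
  qed
  have "(\<Sum>r\<le>Suc N. c_even \<tau> r * ip (int (Suc N) - int r) * ip (int (Suc N) + int r + int 0))
    = (\<Sum>R<Suc N. (-1) ^ Suc R * F1 (int (Suc N)) (int (Suc R)) * S1 \<tau> (Suc R))"
    by (subst sum.atMost_Suc_shift) (simp add: c_even_def S1_def[of _ 0] F1_def lessThan_Suc_atMost mult_ac)
  moreover have "(1 - q ^ Suc (2 * N)) * \<dots> = (-1) ^ Suc N * \<kappa> * ip (int N)"
    using F1_S1_sum[of "Suc N" \<tau>] alt unfolding e by simp
  ultimately show ?thesis by (intro eq_divide_of_mult[OF nz]) (simp only:)
qed

text \<open>Reduction to the even case: \<open>c_odd\<close> splits into two parts \<open>X\<close>
  and \<open>Y\<close>, and \<open>X\<close> at r plus \<open>Y\<close> at r + 1 is, up to sign, the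
  \<open>F1\<close> term at n = k + 1, s = r + 1. So the same alternating sums and the same
  denominators appear.\<close>

lemma c_odd_sum:
  assumes alt: "(\<Sum>w=-int k..int k. (-1) powi w * p powi (w^2) * \<tau> w * ip (int k - w) * ip (int k + w)) = (-1) ^ k * \<kappa> * ip (int k)"
  shows "(\<Sum>r\<le>k. c_odd \<tau> r * ip (int k - int r) * ip (int k + int r + int 1))
     = (-1) ^ k * \<kappa> * ip (int k) / (1 - q ^ Suc (2 * k))"
proof -
  have nz: "1 - q ^ Suc (2 * k) \<noteq> 0" using one_minus_power_nonzero[OF norm_q] by blast
  have e: "q powi (2 * int (Suc k) - 1) = q ^ Suc (2 * k)"
  proof -
    have "2 * int (Suc k) - 1 = int (Suc (2 * k))" by simp
    then show ?thesis by (simp only: power_int_of_nat)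
  qed
  define X where "X r = (-1) ^ r * p powi (int r ^ 2) * S1 \<tau> (Suc r) * ip (int k - int r) * ip (int k + int r + 1)" for r
  define Y where "Y r = (-1) ^ r * p powi ((int r + 1) ^ 2) * S1 \<tau> r * ip (int k - int r) * ip (int k + int r + 1)" for r
  have XY: "X r + Y (Suc r) = - ((-1) ^ Suc r * F1 (int (Suc k)) (int (Suc r)) * S1 \<tau> (Suc r))" for r
  proof -
    define A B where "A = q powi int k" and "B = q powi int (Suc r)"
    have nz: "B \<noteq> 0" using q_nonzero by (simp add: B_def)
    have a: "ip (int k + int r + 1) = (1 - A * B * q) * ip (int k + int r + 2)"
      using ip_pred[of "int k + int r + 2"] q_nonzero by (simp add: A_def B_def power_int_add power2_eq_square add_ac mult_ac)
    have b: "ip (int k - int (Suc r)) = (1 - A * q / B) * ip (int k - int r)"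
    proof -
      have "ip (int k - int (Suc r)) = ip (int k - int r - 1)" by (simp add: algebra_simps)
      also have "\<dots> = (1 - q powi (int k - int r)) * ip (int k - int r)" by (rule ip_pred)
      also have "q powi (int k - int r) = A * q / B"
        using q_nonzero by (simp add: A_def B_def power_int_add power_int_diff)
      finally show ?thesis .
    qed
    have c: "p powi ((int (Suc r) + 1)^2) = p powi (int r ^ 2) * B^2"
    proof -
      have "(int (Suc r) + 1)^2 = int r ^ 2 + 2 * (2 * int (Suc r))" by (simp add: power2_eq_square algebra_simps)
      then have "p powi ((int (Suc r) + 1)^2) = p powi (int r ^ 2) * p powi (2 * (2 * int (Suc r)))"
        by (simp only: power_int_add[OF disjI1[OF p_nonzero]])
      then show ?thesis unfolding B_def q_powi by (simp only: p_powi_double)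
    qed
    have d: "q powi (2 * int (Suc r)) = B^2" unfolding B_def by (simp add: power_int_mult mult.commute[of 2] del: of_nat_Suc)
    have i: "int k + int (Suc r) + 1 = int k + int r + 2" "int (Suc k) - int (Suc r) = int k - int r"
      "int (Suc k) + int (Suc r) = int k + int r + 2" "int (Suc r) - 1 = int r" by simp_all
    define U V where "U = 1 - A * B * q" and "V = 1 - A * q / B"
    have K: "U - B^2 * V = 1 - B^2" using nz by (simp add: U_def V_def field_simps power2_eq_square)
    have "X r + Y (Suc r) = (-1) ^ r * p powi (int r ^ 2) * S1 \<tau> (Suc r) * ip (int k - int r) * ip (int k + int r + 2)
       * (U - B^2 * V)"
      unfolding X_def Y_def a b c i U_def[symmetric] V_def[symmetric] by (simp add: algebra_simps)
    also have "\<dots> = - ((-1) ^ Suc r * F1 (int (Suc k)) (int (Suc r)) * S1 \<tau> (Suc r))"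
      unfolding F1_def d i K by (simp add: algebra_simps)
    finally show ?thesis .
  qed
  have "(\<Sum>r\<le>k. c_odd \<tau> r * ip (int k - int r) * ip (int k + int r + int 1)) = (\<Sum>r\<le>k. X r) + (\<Sum>r\<le>k. Y r)"
    unfolding c_odd_def X_def Y_def sum.distrib[symmetric] by (simp add: algebra_simps)
  \<comment> \<open>The shift in r costs nothing: \<open>Y\<close> vanishes at k + 1 by a negative
    argument of \<open>ip\<close>, and at 0 because \<open>S1\<close> is empty.\<close>
  also have "(\<Sum>r\<le>k. Y r) = (\<Sum>r\<le>Suc k. Y r)" by (simp add: Y_def ip_neg)
  also have "\<dots> = (\<Sum>r\<le>k. Y (Suc r))"
    by (subst sum.atMost_Suc_shift) (simp add: Y_def[of 0] S1_def)
  also have "(\<Sum>r\<le>k. X r) + (\<Sum>r\<le>k. Y (Suc r)) = - (\<Sum>R<Suc k. (-1) ^ Suc R * F1 (int (Suc k)) (int (Suc R)) * S1 \<tau> (Suc R))"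
    unfolding sum.distrib[symmetric] XY sum_negf lessThan_Suc_atMost ..
  finally have sum: "(\<Sum>r\<le>k. c_odd \<tau> r * ip (int k - int r) * ip (int k + int r + int 1)) = \<dots>" .
  have "(1 - q ^ Suc (2 * k)) * (\<Sum>R<Suc k. (-1) ^ Suc R * F1 (int (Suc k)) (int (Suc R)) * S1 \<tau> (Suc R)) = - ((-1) ^ k * \<kappa> * ip (int k))"
    using F1_S1_sum[of "Suc k" \<tau>] alt unfolding e by simp
  then show ?thesis
    unfolding sum by (intro eq_divide_of_mult[OF nz]) (simp only: mult_minus_right minus_minus)
qed

definition B_even :: "(int \<Rightarrow> complex) \<Rightarrow> nat \<Rightarrow> complex" where
  "B_even \<tau> n = (\<Sum>r\<le>n. q ^ (r^2) * c_even \<tau> r * ip (int n - int r) * ip (int n + int r))"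

definition B_odd :: "(int \<Rightarrow> complex) \<Rightarrow> nat \<Rightarrow> complex" where
  "B_odd \<tau> n = (\<Sum>r\<le>n. q ^ (r^2 + r) * c_odd \<tau> r * ip (int n - int r) * ip (int n + int r + 1))"

lemma B_even_eq:
  assumes alt: "\<And>N. (\<Sum>w=-int N..int N. (-1) powi w * p powi (w^2) * \<tau> w * ip (int N - w) * ip (int N + w)) = (-1) ^ N * \<kappa> N * ip (int N)"
  shows "B_even \<tau> n = (\<Sum>k=1..n. q ^ (k^2) * \<kappa> (k - 1) * (-1) ^ k * ip (int (n - k)) * ip (int (k - 1)) / (1 - q ^ (2 * k - 1)))"
proof -
  have "B_even \<tau> n = (\<Sum>k\<le>n. q ^ (k^2) * ip (int n - int k) * (\<Sum>r\<le>k. c_even \<tau> r * ip (int k - int r) * ip (int k + int r + int 0)))"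
    unfolding B_even_def using bailey_pair_lift[of 0 "c_even \<tau>" n] by simp
  also have "\<dots> = (\<Sum>k=1..n. q ^ (k^2) * ip (int n - int k) * (\<Sum>r\<le>k. c_even \<tau> r * ip (int k - int r) * ip (int k + int r + int 0)))"
    by (rule sum.mono_neutral_right) (auto simp: c_even_def S1_def not_less_eq_eq)
  also have "\<dots> = (\<Sum>k=1..n. q ^ (k^2) * \<kappa> (k - 1) * (-1) ^ k * ip (int (n - k)) * ip (int (k - 1)) / (1 - q ^ (2 * k - 1)))"
  proof (rule sum.cong[OF refl])
    fix k assume k: "k \<in> {1..n}"
    then obtain N where N: "k = Suc N" by (cases k) auto
    have i: "2 * k - 1 = Suc (2 * N)" "k - 1 = N" by (simp_all add: N)
    have j: "int n - int k = int (n - k)" using k by simp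
    show "q ^ (k^2) * ip (int n - int k) * (\<Sum>r\<le>k. c_even \<tau> r * ip (int k - int r) * ip (int k + int r + int 0))
      = q ^ (k^2) * \<kappa> (k - 1) * (-1) ^ k * ip (int (n - k)) * ip (int (k - 1)) / (1 - q ^ (2 * k - 1))"
      unfolding i j unfolding N c_even_sum[OF alt] by (simp only: times_divide_eq_right mult_ac)
  qed
  finally show ?thesis .
qed

lemma B_odd_eq:
  assumes alt: "\<And>N. (\<Sum>w=-int N..int N. (-1) powi w * p powi (w^2) * \<tau> w * ip (int N - w) * ip (int N + w)) = (-1) ^ N * \<kappa> N * ip (int N)"
  shows "B_odd \<tau> n = (\<Sum>k\<le>n. q ^ (k^2 + k) * \<kappa> k * (-1) ^ k * ip (int (n - k)) * ip (int k) / (1 - q ^ (2 * k + 1)))"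
proof -
  have "B_odd \<tau> n = (\<Sum>k\<le>n. q ^ (k^2 + k) * ip (int n - int k) * (\<Sum>r\<le>k. c_odd \<tau> r * ip (int k - int r) * ip (int k + int r + int 1)))"
    unfolding B_odd_def using bailey_pair_lift[of 1 "c_odd \<tau>" n] by simp
  also have "\<dots> = (\<Sum>k\<le>n. q ^ (k^2 + k) * \<kappa> k * (-1) ^ k * ip (int (n - k)) * ip (int k) / (1 - q ^ (2 * k + 1)))"
    unfolding c_odd_sum[OF alt] by (intro sum.cong refl) (simp add: of_nat_diff)
  finally show ?thesis .
qed

definition \<delta>9 :: "nat \<Rightarrow> complex" where
  "\<delta>9 n = (-1) ^ n * q ^ n * qpoch (-1) q n * qpoch q q (n - 1)"

definition \<delta>11 :: "nat \<Rightarrow> complex" where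
  "\<delta>11 n = (-1) ^ n * qpoch (q^2) (q^2) n"

lemma ip_nat: "ip (int m) = 1 / qpoch q q m"
  by (simp add: inv_qfact_def)

lemma L9_term_eq: "L9_term q n = \<delta>9 n * B_even \<tau>A n"
proof -
  have e: "q ^ (k^2) * p powi (- (int (k - 1) ^ 2 + int (k - 1))) = q ^ (Suc k choose 2)" if "k \<ge> 1" for k
  proof -
    have "2 * int (k^2) + - (int (k - 1) ^ 2 + int (k - 1)) = int k ^ 2 + int k"
      using that by (simp add: of_nat_diff power2_eq_square algebra_simps)
    then show ?thesis by (simp only: q_pow_choose(1) q_pow_mult_powi p_mult_powi)
  qed
  show ?thesis
    unfolding B_even_eq[OF alternating_\<tau>A] \<delta>9_def L9_term_def sum_distrib_left ip_nat
    by (rule sum.cong[OF refl]) (use e in \<open>simp add: power_add mult_ac\<close>)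
qed

text \<open>The exponent 2k^2 - (k-1)^2 - 3(k-1) - 1 = 1 + k(k-1) is odd. The surplus p becomes x^8
  and turns the shift x^9 of the even series into x; the prefactor q = x^16 of \<open>L10\<close>
  then makes it x^17.\<close>

lemma L10_term_eq: "p * L10_term q n = \<delta>9 n * B_even \<tau>D n"
proof -
  have e: "q ^ (k^2) * p powi (- (int (k - 1) ^ 2 + 3 * int (k - 1) + 1)) = p * q ^ (k choose 2)" if "k \<ge> 1" for k
  proof -
    have "2 * int (k^2) + - (int (k - 1) ^ 2 + 3 * int (k - 1) + 1) = 1 + (int k ^ 2 - int k)"
      using that by (simp add: of_nat_diff power2_eq_square algebra_simps)
    then show ?thesis by (simp only: q_pow_choose q_pow_mult_powi p_mult_powi)
  qed
  show ?thesis
    unfolding B_even_eq[OF alternating_\<tau>D] \<delta>9_def L10_term_def sum_distrib_left ip_nat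
    by (rule sum.cong[OF refl]) (use e in \<open>simp add: power_add mult_ac\<close>)
qed

lemma L11_term_eq: "L11_term q n = \<delta>11 n * B_odd \<tau>A n"
proof -
  have e: "q ^ (k^2 + k) * p powi (- (int k ^ 2 + int k)) = q ^ (Suc k choose 2)" for k
  proof -
    have "2 * int (k^2 + k) + - (int k ^ 2 + int k) = int k ^ 2 + int k"
      by (simp add: power2_eq_square algebra_simps)
    then show ?thesis by (simp only: q_pow_choose(1) q_pow_mult_powi p_mult_powi)
  qed
  show ?thesis
    unfolding B_odd_eq[OF alternating_\<tau>A] \<delta>11_def L11_term_def sum_distrib_left ip_nat e
    by (rule sum.cong) (auto simp: power_add mult_ac)
qed

lemma L12_term_eq: "L12_term q n = p * \<delta>11 n * B_odd \<tau>D n"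
proof -
  have e: "p * (q ^ (k^2 + k) * p powi (- (int k ^ 2 + 3 * int k + 1))) = q ^ (k choose 2)" for k
  proof -
    have "1 + (2 * int (k^2 + k) + - (int k ^ 2 + 3 * int k + 1)) = int k ^ 2 - int k"
      by (simp add: power2_eq_square algebra_simps)
    then show ?thesis by (simp only: q_pow_choose q_pow_mult_powi p_mult_powi)
  qed
  show ?thesis
    unfolding B_odd_eq[OF alternating_\<tau>D] \<delta>11_def L12_term_def sum_distrib_left ip_nat e[symmetric]
    by (rule sum.cong) (auto simp: power_add mult_ac)
qed

end

section \<open>Conjugate Bailey pairs and the passage to the limit\<close>

lemma qpoch_tendsto:
  assumes "norm q < 1" and nz: "\<And>k. 1 - a * q ^ k \<noteq> 0"
  shows "\<exists>L. qpoch a q \<longlonglongrightarrow> L \<and> L \<noteq> 0"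
proof -
  define f where "f k = 1 - a * q ^ k" for k
  have "summable (\<lambda>k. norm (f k - 1))"
    unfolding f_def using assms(1) by (simp add: norm_mult norm_power summable_mult)
  then have "convergent_prod f"
    by (intro abs_convergent_prod_imp_convergent_prod summable_imp_abs_convergent_prod)
  then obtain L where L: "(\<lambda>n. \<Prod>i\<le>n. f i) \<longlonglongrightarrow> L" "L \<noteq> 0"
    using convergent_prod_iff_nz_lim[of f] nz by (auto simp: f_def)
  then have "(\<lambda>n. qpoch a q (Suc n)) \<longlonglongrightarrow> L"
    by (simp add: qpoch_def f_def lessThan_Suc_atMost)
  then show ?thesis using L(2) by (auto dest: LIMSEQ_imp_Suc)
qed

lemma summable_square_geometric:
  fixes x :: real
  assumes "\<bar>x\<bar> < 1"
  shows "summable (\<lambda>n. (real n + 1) ^ 2 * x ^ n)"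
proof -
  have "summable (\<lambda>n. diffs (diffs (\<lambda>_. 1)) n * \<bar>x\<bar> ^ n)"
  proof (rule termdiff_converges[where K = 1])
    fix y :: real assume "norm y < 1"
    then obtain K where K: "norm y < K" "K < 1" using dense by blast
    show "summable (\<lambda>n. diffs (\<lambda>_. 1) n * y ^ n)"
      by (rule termdiff_converges[OF K(1)]) (use K in \<open>auto intro!: summable_geometric\<close>)
  qed (use assms in auto)
  then have s: "summable (\<lambda>n. (real n + 1) * (real n + 2) * \<bar>x\<bar> ^ n)"
    by (simp add: diffs_def algebra_simps)
  show ?thesis
  proof (rule summable_comparison_test[OF _ s], intro exI allI impI)
    fix n :: nat
    have "(real n + 1) ^ 2 \<le> (real n + 1) * (real n + 2)" by (simp add: power2_eq_square mult_left_mono)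
    then show "norm ((real n + 1) ^ 2 * x ^ n) \<le> (real n + 1) * (real n + 2) * \<bar>x\<bar> ^ n"
      by (simp add: norm_mult power_abs mult_right_mono abs_mult)
  qed
qed

text \<open>Tannery's theorem in the shape used twice below. The kernel h is bounded only linearly
  in r, because its recurrence in r adds a bounded term at each step; the geometric decay of a
  absorbs this. \<open>K'\<close> is the truncation: K for plain partial sums, 2N + 1 for
  averages.\<close>

lemma weighted_sum_tendsto:
  fixes a H :: "nat \<Rightarrow> complex" and h :: "nat \<Rightarrow> nat \<Rightarrow> complex"
  assumes a: "\<And>r. norm (a r) \<le> A * ((real r + 1) * x ^ r)" and x: "0 \<le> x" "x < 1"
    and h: "\<And>r K. norm (h r K) \<le> C * (real r + 1)"
    and lim: "\<And>r. h r \<longlonglongrightarrow> H r"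
    and zero: "\<And>r K. K' K < r \<Longrightarrow> h r K = 0"
  shows "(\<lambda>K. \<Sum>r\<le>K' K. a r * h r K) \<longlonglongrightarrow> (\<Sum>r. a r * H r)" "summable (\<lambda>r. a r * H r)"
proof -
  define M where "M r = A * C * ((real r + 1) ^ 2 * x ^ r)" for r
  have M: "summable M" unfolding M_def by (intro summable_mult summable_square_geometric) (use x in auto)
  have bound: "norm (a r * h r K) \<le> M r" for r K
  proof -
    have "norm (a r * h r K) \<le> (A * ((real r + 1) * x ^ r)) * (C * (real r + 1))"
      unfolding norm_mult by (intro mult_mono a h) (use order_trans[OF norm_ge_zero a] in auto)
    then show ?thesis by (simp add: M_def power2_eq_square mult_ac)
  qed
  have "eventually (\<lambda>K. summable (\<lambda>r. norm (a r * h r K))) sequentially \<and>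
           summable (\<lambda>r. norm (a r * H r)) \<and>
           ((\<lambda>K. suminf (\<lambda>r. a r * h r K)) \<longlongrightarrow> suminf (\<lambda>r. a r * H r)) sequentially"
    by (rule tannerys_theorem[OF _ _ M]) (auto intro!: tendsto_intros lim bound always_eventually)
  moreover have "suminf (\<lambda>r. a r * h r K) = (\<Sum>r\<le>K' K. a r * h r K)" for K
    by (rule suminf_finite) (auto simp: zero)
  ultimately show "(\<lambda>K. \<Sum>r\<le>K' K. a r * h r K) \<longlonglongrightarrow> (\<Sum>r. a r * H r)" "summable (\<lambda>r. a r * H r)"
    using summable_norm_cancel by auto
qed

context qbase
begin

lemma ip_bounded: "\<exists>C>0. \<forall>m. norm (ip m) \<le> C"
proof -
  have "\<exists>L. qpoch q q \<longlonglongrightarrow> L \<and> L \<noteq> 0"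
  proof (rule qpoch_tendsto[OF norm_q])
    fix k show "1 - q * q ^ k \<noteq> 0" using one_minus_power_nonzero[OF norm_q, of "Suc k"] by simp
  qed
  then obtain L where "qpoch q q \<longlonglongrightarrow> L" "L \<noteq> 0" by blast
  then have "Bseq (\<lambda>n. 1 / qpoch q q n)"
    by (intro convergent_imp_Bseq) (auto intro!: convergentI tendsto_divide)
  then obtain C where C: "C > 0" "\<And>n. norm (1 / qpoch q q n) \<le> C" by (auto elim: BseqE)
  have "norm (ip m) \<le> C" for m
    using C by (auto simp: inv_qfact_def)
  then show ?thesis using C(1) by blast
qed

section \<open>The conjugate sequence for \<open>L9\<close> and \<open>L10\<close>\<close>

lemma \<delta>9_Suc: "n \<ge> 1 \<Longrightarrow> \<delta>9 (Suc n) = - q * (1 - q powi (2 * int n)) * \<delta>9 n"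
proof -
  assume n: "n \<ge> 1"
  then obtain m where m: "n = Suc m" by (cases n) auto
  have e: "q powi (2 * int n) = (q ^ n)^2"
    by (simp add: power_int_mult mult.commute[of 2])
  have h1: "qpoch q q n = qpoch q q (n - 1) * (1 - q ^ n)" unfolding m by (simp add: qpoch_def)
  have h2: "qpoch (-1) q (Suc n) = qpoch (-1) q n * (1 + q ^ n)" by (simp add: qpoch_def)
  show ?thesis
    unfolding \<delta>9_def e diff_Suc_1 h1 h2 by (simp add: algebra_simps power2_eq_square)
qed

lemma \<delta>9_1: "\<delta>9 1 = - 2 * q"
  by (simp add: \<delta>9_def qpoch_def)

lemma \<delta>9_bound: "\<exists>C>0. \<forall>n. norm (\<delta>9 n) \<le> C * norm q ^ n"
proof -
  have "\<exists>L. qpoch (-1) q \<longlonglongrightarrow> L \<and> L \<noteq> 0"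
  proof (rule qpoch_tendsto[OF norm_q])
    fix k
    show "1 - (-1) * q ^ k \<noteq> 0"
    proof (cases "k = 0")
      case False
      then have "norm (q ^ k) < 1" using norm_q by (simp add: norm_power power_less_one_iff)
      then have "q ^ k \<noteq> - 1" by auto
      then show ?thesis by (simp add: add_eq_0_iff)
    qed simp
  qed
  then obtain L where "qpoch (-1) q \<longlonglongrightarrow> L" by blast
  then have "Bseq (qpoch (-1) q)" by (intro convergent_imp_Bseq convergentI)
  then obtain C where C: "C > 0" "\<And>n. norm (qpoch (-1) q n) \<le> C" by (auto elim: BseqE)
  have "\<exists>L. qpoch q q \<longlonglongrightarrow> L \<and> L \<noteq> 0"
  proof (rule qpoch_tendsto[OF norm_q])
    fix k show "1 - q * q ^ k \<noteq> 0" using one_minus_power_nonzero[OF norm_q, of "Suc k"] by simp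
  qed
  then obtain L where "qpoch q q \<longlonglongrightarrow> L" by blast
  then have "Bseq (qpoch q q)" by (intro convergent_imp_Bseq convergentI)
  then obtain D where D: "D > 0" "\<And>n. norm (qpoch q q n) \<le> D" by (auto elim: BseqE)
  have "norm (\<delta>9 n) \<le> (C * D) * norm q ^ n" for n
  proof -
    have "norm (\<delta>9 n) = norm q ^ n * (norm (qpoch (-1) q n) * norm (qpoch q q (n - 1)))"
      by (simp add: \<delta>9_def norm_mult norm_power mult_ac)
    also have "\<dots> \<le> norm q ^ n * (C * D)"
      by (intro mult_left_mono mult_mono C D) (use C(1) in auto)
    finally show ?thesis by (simp add: mult_ac)
  qed
  moreover have "C * D > 0" using C D by simp
  ultimately show ?thesis by blast
qed

text \<open>The factor 1 - q^(2r) of \<open>c_even\<close> is moved into the kernel: with it the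
  recurrence in r has the constant coefficient -q, and the kernel vanishes at r = 0.\<close>

definition \<gamma>9 :: "nat \<Rightarrow> nat \<Rightarrow> complex" where
  "\<gamma>9 r K = (1 - q powi (2 * int r)) * (\<Sum>n=1..K. \<delta>9 n * ip (int n - int r) * ip (int n + int r))"

definition T9 :: "nat \<Rightarrow> nat \<Rightarrow> complex" where
  "T9 r n = - (1 - q powi (2 * int r + 1)) * \<delta>9 n * ip (int n - int r - 1) * ip (int n + int r)"

text \<open>A Wilf-Zeilberger pair in (r, n) with \<open>T9\<close> as its companion; after
  \<open>\<delta>9_Suc\<close> it rests on the rational identity \<open>K\<close> in A = q^n and B =
  q^r. Summation over n leaves only the two ends.\<close>

lemma T9_step:
  assumes "n \<ge> 1"
  shows "(1 - q powi (2 * int (Suc r))) * (\<delta>9 n * ip (int n - int (Suc r)) * ip (int n + int (Suc r)))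
      + q * ((1 - q powi (2 * int r)) * (\<delta>9 n * ip (int n - int r) * ip (int n + int r))) = T9 r (Suc n) - T9 r n"
proof -
  define A B where "A = q powi int n" and "B = q powi int r"
  have nz: "B \<noteq> 0" using q_nonzero by (simp add: B_def)
  define U V where "U = 1 - A / B" and "V = 1 - A * B * q"
  have a: "ip (int n - int (Suc r)) = U * ip (int n - int r)"
  proof -
    have "ip (int n - int (Suc r)) = ip (int n - int r - 1)" by (simp add: algebra_simps)
    also have "\<dots> = (1 - q powi (int n - int r)) * ip (int n - int r)" by (rule ip_pred)
    also have "q powi (int n - int r) = A / B"
      using q_nonzero by (simp add: A_def B_def power_int_diff)
    finally show ?thesis by (simp add: U_def)
  qed
  have b: "ip (int n + int r) = V * ip (int n + int r + 1)"
    using ip_pred[of "int n + int r + 1"] q_nonzero by (simp add: V_def A_def B_def power_int_add)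
  have e: "q powi (2 * int (Suc r)) = B^2 * q^2" "q powi (2 * int r) = B^2" "q powi (2 * int r + 1) = B^2 * q"
      "q powi (2 * int n) = A^2"
    using q_nonzero by (simp_all add: A_def B_def power_int_add power_int_mult mult.commute[of 2] distrib_left power2_eq_square)
  have i: "int (Suc n) - int r - 1 = int n - int r" "int (Suc n) + int r = int n + int r + 1"
     "int n + int (Suc r) = int n + int r + 1" "int n - int r - 1 = int n - int (Suc r)" by simp_all
  have K: "(1 - B^2 * q^2) * U + q * ((1 - B^2) * V) = (1 - B^2 * q) * (q * (1 - A^2) + U * V)"
  proof -
    define u where "u = 1 / B"
    have "B * u = 1" using nz by (simp add: u_def)
    then have "(1 - B^2 * q^2) * (1 - A * u) + q * ((1 - B^2) * (1 - A * B * q))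
        = (1 - B^2 * q) * (q * (1 - A^2) + (1 - A * u) * (1 - A * B * q))"
      by algebra
    then show ?thesis by (simp add: U_def V_def u_def)
  qed
  have "(1 - B^2 * q^2) * (\<delta>9 n * (U * ip (int n - int r)) * ip (int n + int r + 1))
      + q * ((1 - B^2) * (\<delta>9 n * ip (int n - int r) * (V * ip (int n + int r + 1))))
     = \<delta>9 n * ip (int n - int r) * ip (int n + int r + 1) * ((1 - B^2 * q^2) * U + q * ((1 - B^2) * V))"
    by (simp add: algebra_simps)
  also have "\<dots> = - (1 - B^2 * q) * (- q * (1 - A^2) * \<delta>9 n) * ip (int n - int r) * ip (int n + int r + 1)
     - - (1 - B^2 * q) * \<delta>9 n * (U * ip (int n - int r)) * (V * ip (int n + int r + 1))"
    unfolding K by (simp add: algebra_simps)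
  finally show ?thesis unfolding T9_def \<delta>9_Suc[OF assms] i a b e .
qed

lemma \<gamma>9_Suc: "\<gamma>9 (Suc r) K = - q * \<gamma>9 r K + T9 r (Suc K) - T9 r 1"
proof -
  have "\<gamma>9 (Suc r) K + q * \<gamma>9 r K = (\<Sum>n=1..K. T9 r (Suc n) - T9 r n)"
    unfolding \<gamma>9_def sum_distrib_left sum.distrib[symmetric]
    by (rule sum.cong[OF refl T9_step]) simp
  also have "\<dots> = T9 r (Suc K) - T9 r 1"
    by (rule sum_Suc_diff) simp
  finally show ?thesis by (simp add: algebra_simps)
qed

text \<open>The only inhomogeneity that survives the limit. It enters in the step from r = 0 and
  makes the limit -2q at r = 1, after which each step multiplies by -q.\<close>

lemma T9_1: "T9 r 1 = (if r = 0 then 2 * q else 0)"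
proof -
  have "(1 - q) * ip 1 = 1" using ip_pred[of 1] ip_0 by simp
  have "T9 0 1 = 2 * q * ((1 - q) * ip 1)"
    unfolding T9_def \<delta>9_1 by (simp add: ip_0 algebra_simps)
  moreover have "T9 r 1 = 0" if "r > 0"
    using that unfolding T9_def by (simp add: ip_neg)
  ultimately show ?thesis using \<open>(1 - q) * ip 1 = 1\<close> by auto
qed

lemma \<gamma>9_0: "\<gamma>9 0 K = 0"
  by (simp add: \<gamma>9_def)

lemma T9_bound: "\<exists>C>0. \<forall>r n. norm (T9 r n) \<le> C * norm q ^ n"
proof -
  obtain C where C: "C > 0" "\<And>m. norm (ip m) \<le> C" using ip_bounded by blast
  obtain D where D: "D > 0" "\<And>n. norm (\<delta>9 n) \<le> D * norm q ^ n" using \<delta>9_bound by blast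
  have "norm (T9 r n) \<le> (2 * D * C * C) * norm q ^ n" for r n
  proof -
    have "norm (q powi (2 * int r + 1)) \<le> 1"
    proof -
      have "2 * int r + 1 = int (2 * r + 1)" by simp
      then show ?thesis by (simp only: power_int_of_nat norm_power) (use norm_q in \<open>intro power_le_one; simp\<close>)
    qed
    then have "norm (- (1 - q powi (2 * int r + 1))) \<le> 2"
      using norm_triangle_ineq4[of 1 "q powi (2 * int r + 1)"] by (simp add: norm_minus_commute)
    then have "norm (T9 r n) \<le> 2 * (D * norm q ^ n) * C * C"
      unfolding T9_def norm_mult by (intro mult_mono C D) (use C(1) D(1) in \<open>auto intro!: mult_nonneg_nonneg\<close>)
    then show ?thesis by (simp add: mult_ac)
  qed
  moreover have "2 * D * C * C > 0" using C D by simp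
  ultimately show ?thesis by blast
qed

lemma \<gamma>9_bound: "\<exists>C. \<forall>r K. norm (\<gamma>9 r K) \<le> C * (real r + 1)"
proof -
  obtain C where C: "C > 0" "\<And>r n. norm (T9 r n) \<le> C * norm q ^ n" using T9_bound by blast
  have T: "norm (T9 r n) \<le> C" for r n
  proof -
    have "C * norm q ^ n \<le> C * 1" using C(1) norm_q by (intro mult_left_mono power_le_one) auto
    then show ?thesis using C(2)[of r n] by simp
  qed
  have "norm (\<gamma>9 r K) \<le> 2 * C * (real r + 1)" for r K
  proof (induction r)
    case 0
    show ?case using C(1) by (simp add: \<gamma>9_0)
  next
    case (Suc r)
    have "norm (\<gamma>9 (Suc r) K) \<le> norm (- q * \<gamma>9 r K) + norm (T9 r (Suc K)) + norm (T9 r 1)"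
      unfolding \<gamma>9_Suc by (meson add_mono norm_triangle_ineq norm_triangle_ineq4 order_trans order_refl)
    also have "norm (- q * \<gamma>9 r K) \<le> 1 * (2 * C * (real r + 1))"
      unfolding norm_mult using norm_q Suc.IH by (intro mult_mono) auto
    finally show ?case using T[of r "Suc K"] T[of r 1] by (simp add: algebra_simps)
  qed
  then show ?thesis by blast
qed

lemma \<gamma>9_tendsto: "\<gamma>9 r \<longlonglongrightarrow> (if r = 0 then 0 else 2 * (- q) ^ r)"
proof (induction r)
  case 0
  show ?case by (simp add: \<gamma>9_0[abs_def])
next
  case (Suc r)
  obtain C where C: "C > 0" "\<And>r n. norm (T9 r n) \<le> C * norm q ^ n" using T9_bound by blast
  have "(\<lambda>n. T9 r n) \<longlonglongrightarrow> 0"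
  proof (rule Lim_null_comparison)
    show "(\<lambda>n. C * norm q ^ n) \<longlonglongrightarrow> 0"
      using norm_q by (intro tendsto_mult_right_zero LIMSEQ_power_zero) auto
  qed (use C in auto)
  then have "(\<lambda>K. T9 r (Suc K)) \<longlonglongrightarrow> 0" by (rule LIMSEQ_Suc)
  then have "(\<lambda>K. - q * \<gamma>9 r K + T9 r (Suc K) - T9 r 1) \<longlonglongrightarrow> - q * (if r = 0 then 0 else 2 * (- q) ^ r) + 0 - T9 r 1"
    by (intro tendsto_intros Suc.IH)
  moreover have "- q * (if r = 0 then 0 else 2 * (- q) ^ r) + 0 - T9 r 1 = (if Suc r = 0 then 0 else 2 * (- q) ^ Suc r)"
    unfolding T9_1 by simp
  ultimately show ?case by (simp only: \<gamma>9_Suc[abs_def])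
qed

definition a9 :: "(int \<Rightarrow> complex) \<Rightarrow> nat \<Rightarrow> complex" where
  "a9 \<tau> r = (-1) ^ r * q ^ (r^2) * p powi ((int r - 1)^2) * S1 \<tau> r"

lemma \<delta>9_B_even_sum: "(\<Sum>n=1..K. \<delta>9 n * B_even \<tau> n) = (\<Sum>r\<le>K. a9 \<tau> r * \<gamma>9 r K)"
proof -
  have "(\<Sum>n=1..K. \<delta>9 n * B_even \<tau> n) = (\<Sum>n=1..K. \<Sum>r\<le>K. \<delta>9 n * (q ^ (r^2) * c_even \<tau> r * ip (int n - int r) * ip (int n + int r)))"
    unfolding B_even_def sum_distrib_left by (intro sum.cong refl sum.mono_neutral_left) (auto simp: ip_neg)
  also have "\<dots> = (\<Sum>r\<le>K. \<Sum>n=1..K. \<delta>9 n * (q ^ (r^2) * c_even \<tau> r * ip (int n - int r) * ip (int n + int r)))"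
    by (rule sum.swap)
  also have "\<dots> = (\<Sum>r\<le>K. a9 \<tau> r * \<gamma>9 r K)"
    unfolding a9_def \<gamma>9_def c_even_def sum_distrib_left by (intro sum.cong refl) (simp only: mult_ac)
  finally show ?thesis .
qed

lemma \<gamma>9_zero: "K < r \<Longrightarrow> \<gamma>9 r K = 0"
  by (simp add: \<gamma>9_def ip_neg)

section \<open>The conjugate sequence for \<open>L11\<close> and \<open>L12\<close>\<close>

lemma norm_q2: "norm (q^2) < 1"
  using norm_q by (simp add: norm_power power_less_one_iff)

lemma \<delta>11_Suc: "\<delta>11 (Suc n) = - (1 - q powi (2 * int n + 2)) * \<delta>11 n"
proof -
  have "2 * int n + 2 = int (2 * n + 2)" by simp
  then have e: "q powi (2 * int n + 2) = q^2 * (q^2)^n"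
    by (simp only: power_int_of_nat power_add power_mult) (simp add: mult.commute)
  show ?thesis unfolding \<delta>11_def e by (simp add: qpoch_def algebra_simps)
qed

text \<open>Without the sign the limit is the infinite product (q^2; q^2), which is not 0. So
  \<open>\<delta>11\<close> itself does not tend to 0, and averaging has to supply the
  convergence.\<close>

lemma \<delta>11_abs_tendsto: "\<exists>L. (\<lambda>n. (-1) ^ n * \<delta>11 n) \<longlonglongrightarrow> L"
proof -
  have "\<exists>L. qpoch (q^2) (q^2) \<longlonglongrightarrow> L \<and> L \<noteq> 0"
  proof (rule qpoch_tendsto[OF norm_q2])
    fix k show "1 - q^2 * (q^2) ^ k \<noteq> 0" using one_minus_power_nonzero[OF norm_q2, of "Suc k"] by simp
  qed
  moreover have "(-1) ^ n * \<delta>11 n = qpoch (q^2) (q^2) n" for n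
    by (simp add: \<delta>11_def flip: power_mult_distrib mult.assoc)
  ultimately show ?thesis by auto
qed

lemma ip_tendsto: "\<exists>L. (\<lambda>n. ip (int n)) \<longlonglongrightarrow> L"
proof -
  have "\<exists>L. qpoch q q \<longlonglongrightarrow> L \<and> L \<noteq> 0"
  proof (rule qpoch_tendsto[OF norm_q])
    fix k show "1 - q * q ^ k \<noteq> 0" using one_minus_power_nonzero[OF norm_q, of "Suc k"] by simp
  qed
  then obtain L where "qpoch q q \<longlonglongrightarrow> L" "L \<noteq> 0" by blast
  then have "(\<lambda>n. 1 / qpoch q q n) \<longlonglongrightarrow> 1 / L" by (intro tendsto_divide tendsto_const)
  then show ?thesis unfolding ip_nat by blast
qed

lemma ip_tendsto_shift:
  assumes "(\<lambda>n. ip (int n)) \<longlonglongrightarrow> L"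
  shows "(\<lambda>n. ip (int n + s)) \<longlonglongrightarrow> L"
proof (cases "s \<ge> 0")
  case True
  then have "(\<lambda>n. ip (int n + s)) = (\<lambda>n. ip (int (n + nat s)))" by simp
  then show ?thesis using LIMSEQ_ignore_initial_segment[OF assms, of "nat s"] by simp
next
  case False
  then have "(\<lambda>n. ip (int (n + nat (- s)) + s)) = (\<lambda>n. ip (int n))" by simp
  then show ?thesis using assms LIMSEQ_offset[of "\<lambda>n. ip (int n + s)" "nat (- s)"] by simp
qed

text \<open>r is an integer so that the recurrence can be started at r = -1.\<close>

definition \<gamma>11 :: "int \<Rightarrow> nat \<Rightarrow> complex" where
  "\<gamma>11 r K = (\<Sum>n\<le>K. \<delta>11 n * ip (int n - r) * ip (int n + r + 1))"

definition T11 :: "int \<Rightarrow> nat \<Rightarrow> complex" where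
  "T11 r n = - \<delta>11 n * ip (int n - r - 1) * ip (int n + r + 1)"

lemma T11_step:
  "\<delta>11 n * ip (int n - (r + 1)) * ip (int n + (r + 1) + 1) + \<delta>11 n * ip (int n - r) * ip (int n + r + 1)
    = T11 r (Suc n) - T11 r n"
proof -
  define A B where "A = q powi int n" and "B = q powi r"
  have nz: "B \<noteq> 0" using q_nonzero by (simp add: B_def)
  define U V where "U = 1 - A / B" and "V = 1 - A * B * q^2"
  have a: "ip (int n - r - 1) = U * ip (int n - r)"
  proof -
    have "ip (int n - r - 1) = (1 - q powi (int n - r)) * ip (int n - r)" by (rule ip_pred)
    also have "q powi (int n - r) = A / B"
      using q_nonzero by (simp add: A_def B_def power_int_diff)
    finally show ?thesis by (simp add: U_def)
  qed
  have b: "ip (int n + r + 1) = V * ip (int n + r + 2)"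
    using ip_pred[of "int n + r + 2"] q_nonzero by (simp add: V_def A_def B_def power_int_add add_ac)
  have e: "q powi (2 * int n + 2) = A^2 * q^2"
    using q_nonzero by (simp add: A_def power_int_add power_int_mult mult.commute[of 2] power2_eq_square)
  have i: "int (Suc n) - r - 1 = int n - r" "int (Suc n) + r + 1 = int n + r + 2"
     "int n + (r + 1) + 1 = int n + r + 2" "int n - (r + 1) = int n - r - 1" by simp_all
  have K: "U + V = 1 - A^2 * q^2 + U * V"
  proof -
    define u where "u = 1 / B"
    have "B * u = 1" using nz by (simp add: u_def)
    then have "(1 - A * u) + (1 - A * B * q^2) = 1 - A^2 * q^2 + (1 - A * u) * (1 - A * B * q^2)"
      by algebra
    then show ?thesis by (simp add: U_def V_def u_def)
  qed
  have "\<delta>11 n * (U * ip (int n - r)) * ip (int n + r + 2) + \<delta>11 n * ip (int n - r) * (V * ip (int n + r + 2))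
     = \<delta>11 n * ip (int n - r) * ip (int n + r + 2) * (U + V)"
    by (simp add: algebra_simps)
  also have "\<dots> = - (- (1 - A^2 * q^2) * \<delta>11 n) * ip (int n - r) * ip (int n + r + 2)
     - - \<delta>11 n * (U * ip (int n - r)) * (V * ip (int n + r + 2))"
    unfolding K by (simp add: algebra_simps)
  finally show ?thesis unfolding T11_def \<delta>11_Suc i a b e .
qed

lemma \<gamma>11_step: "\<gamma>11 (r + 1) K + \<gamma>11 r K = T11 r (Suc K) - T11 r 0"
  unfolding \<gamma>11_def sum.distrib[symmetric] T11_step lessThan_Suc_atMost[symmetric]
  by (rule sum_lessThan_telescope)

lemma T11_0: "T11 (-1) 0 = -1" "r \<ge> 0 \<Longrightarrow> T11 r 0 = 0"
  by (simp_all add: T11_def ip_0 ip_neg \<delta>11_def qpoch_def)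

text \<open>The pairs \<open>(n - r, n + r + 1)\<close> for \<open>r = 0\<close> and \<open>r = -1\<close> coincide, so the recurrence determines its own initial value.\<close>

lemma \<gamma>11_0: "\<gamma>11 0 K = 1/2 + T11 (-1) (Suc K) / 2"
proof -
  have "\<gamma>11 (-1) K = \<gamma>11 0 K" by (simp add: \<gamma>11_def mult_ac)
  then show ?thesis using \<gamma>11_step[of "-1" K] by (simp add: T11_0 field_simps)
qed

lemma \<gamma>11_Suc: "\<gamma>11 (int (Suc r)) K = - \<gamma>11 (int r) K + T11 (int r) (Suc K)"
  using \<gamma>11_step[of "int r" K] T11_0(2)[of "int r"] by (simp add: algebra_simps eq_neg_iff_add_eq_0)

lemma T11_bound: "\<exists>C>0. \<forall>r n. norm (T11 r n) \<le> C"
proof -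
  obtain C where C: "C > 0" "\<And>m. norm (ip m) \<le> C" using ip_bounded by blast
  obtain L where "(\<lambda>n. (-1) ^ n * \<delta>11 n) \<longlonglongrightarrow> L" using \<delta>11_abs_tendsto by blast
  then have "Bseq (\<lambda>n. (-1) ^ n * \<delta>11 n)" by (intro convergent_imp_Bseq convergentI)
  then obtain D where D: "D > 0" "\<And>n. norm (\<delta>11 n) \<le> D"
    by (auto elim!: BseqE simp: norm_mult norm_power)
  have "norm (T11 r n) \<le> D * C * C" for r n
    unfolding T11_def norm_mult norm_minus_cancel by (intro mult_mono C D) (use C(1) D(1) in auto)
  moreover have "D * C * C > 0" using C D by simp
  ultimately show ?thesis by blast
qed

text \<open>\<open>T11 r n\<close> is (-1)^n times a convergent sequence, so two consecutive values
  cancel in the limit. This cancellation is what the starred sum is for.\<close>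

lemma T11_average: "(\<lambda>N. (T11 r (Suc (2 * N)) + T11 r (Suc (2 * N + 1))) / 2) \<longlonglongrightarrow> 0"
proof -
  define u where "u n = (-1) ^ n * T11 r n" for n
  obtain L where L: "(\<lambda>n. (-1) ^ n * \<delta>11 n) \<longlonglongrightarrow> L" using \<delta>11_abs_tendsto by blast
  obtain M where M: "(\<lambda>n. ip (int n)) \<longlonglongrightarrow> M" using ip_tendsto by blast
  have "(\<lambda>n. - (((-1) ^ n * \<delta>11 n) * ip (int n + (- r - 1)) * ip (int n + (r + 1)))) \<longlonglongrightarrow> - (L * M * M)"
    by (intro tendsto_intros L ip_tendsto_shift M)
  moreover have "(\<lambda>n. - (((-1) ^ n * \<delta>11 n) * ip (int n + (- r - 1)) * ip (int n + (r + 1)))) = u"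
    by (simp add: u_def T11_def fun_eq_iff algebra_simps)
  ultimately have u: "u \<longlonglongrightarrow> - (L * M * M)" by simp
  have "filterlim (\<lambda>N. Suc (2 * N + 1)) sequentially sequentially" "filterlim (\<lambda>N. Suc (2 * N)) sequentially sequentially"
    by (auto intro!: filterlim_subseq strict_monoI)
  then have "(\<lambda>N. u (Suc (2 * N + 1))) \<longlonglongrightarrow> - (L * M * M)" "(\<lambda>N. u (Suc (2 * N))) \<longlonglongrightarrow> - (L * M * M)"
    using filterlim_compose[OF u] by blast+
  then have "(\<lambda>N. (u (Suc (2 * N + 1)) - u (Suc (2 * N))) / 2) \<longlonglongrightarrow> (- (L * M * M) - - (L * M * M)) / 2"
    by (intro tendsto_intros) auto
  then show ?thesis by (simp add: u_def add.commute)
qed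

definition avg11 :: "nat \<Rightarrow> nat \<Rightarrow> complex" where
  "avg11 r N = (\<gamma>11 (int r) (2 * N) + \<gamma>11 (int r) (2 * N + 1)) / 2"

lemma avg11_0: "avg11 0 N = 1/2 + ((T11 (-1) (Suc (2 * N)) + T11 (-1) (Suc (2 * N + 1))) / 2) / 2"
  by (simp add: avg11_def \<gamma>11_0 field_simps)

lemma avg11_Suc: "avg11 (Suc r) N = - avg11 r N + (T11 (int r) (Suc (2 * N)) + T11 (int r) (Suc (2 * N + 1))) / 2"
  unfolding avg11_def \<gamma>11_Suc by (simp add: field_simps)

text \<open>Once the boundary terms average out, the recurrence in r is a mere change of sign. The
  start 1/2 comes from \<open>T11 (-1) 0 = -1\<close>, shared equally between the equal kernels at r
  = -1 and r = 0.\<close>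

lemma avg11_tendsto: "avg11 r \<longlonglongrightarrow> (-1) ^ r / 2"
proof (induction r)
  case 0
  have "(\<lambda>N. 1/2 + ((T11 (-1) (Suc (2 * N)) + T11 (-1) (Suc (2 * N + 1))) / 2) / 2) \<longlonglongrightarrow> 1/2 + 0 / 2"
    by (intro tendsto_add[OF tendsto_const] tendsto_divide[OF T11_average tendsto_const]) simp
  then show ?case by (simp add: avg11_0[abs_def])
next
  case (Suc r)
  have "(\<lambda>N. - avg11 r N + (T11 (int r) (Suc (2 * N)) + T11 (int r) (Suc (2 * N + 1))) / 2) \<longlonglongrightarrow> - ((-1) ^ r / 2) + 0"
    by (intro tendsto_add tendsto_minus Suc.IH T11_average)
  then show ?case by (simp add: avg11_Suc[abs_def])
qed

lemma avg11_bound: "\<exists>C. \<forall>r N. norm (avg11 r N) \<le> C * (real r + 1)"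
proof -
  obtain C where C: "C > 0" "\<And>r n. norm (T11 r n) \<le> C" using T11_bound by blast
  have avg: "norm ((T11 r m + T11 r n) / 2) \<le> C" for r m n
    using norm_triangle_ineq[of "T11 r m" "T11 r n"] C(2)[of r m] C(2)[of r n] by (simp add: norm_divide)
  have "norm (avg11 r N) \<le> (1 + C) * (real r + 1)" for r N
  proof (induction r)
    case 0
    have "norm (avg11 0 N) \<le> norm (1/2 :: complex) + norm (((T11 (-1) (Suc (2 * N)) + T11 (-1) (Suc (2 * N + 1))) / 2) / 2)"
      unfolding avg11_0 by (rule norm_triangle_ineq)
    also have "\<dots> = 1/2 + norm ((T11 (-1) (Suc (2 * N)) + T11 (-1) (Suc (2 * N + 1))) / 2) / 2"
      by (simp add: norm_divide)
    finally show ?case using avg[of "-1" "Suc (2 * N)" "Suc (2 * N + 1)"] C(1) by simp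
  next
    case (Suc r)
    have "norm (avg11 (Suc r) N) \<le> norm (avg11 r N) + norm ((T11 (int r) (Suc (2 * N)) + T11 (int r) (Suc (2 * N + 1))) / 2)"
      unfolding avg11_Suc using norm_triangle_ineq[of "- avg11 r N"] by (metis norm_minus_cancel)
    then show ?case using Suc.IH avg[of "int r" "Suc (2 * N)" "Suc (2 * N + 1)"] by (simp add: algebra_simps)
  qed
  then show ?thesis by blast
qed

lemma \<gamma>11_zero: "K < r \<Longrightarrow> \<gamma>11 (int r) K = 0"
  by (simp add: \<gamma>11_def ip_neg)

lemma avg11_zero: "2 * N + 1 < r \<Longrightarrow> avg11 r N = 0"
  by (simp add: avg11_def \<gamma>11_zero)

definition a11 :: "(int \<Rightarrow> complex) \<Rightarrow> nat \<Rightarrow> complex" where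
  "a11 \<tau> r = q ^ (r^2 + r) * c_odd \<tau> r"

text \<open>M is separate from K so that the partial sums up to 2N and 2N + 1 can be written over
  the same range of r and averaged termwise.\<close>

lemma \<delta>11_B_odd_sum:
  assumes "K \<le> M"
  shows "(\<Sum>n\<le>K. \<delta>11 n * B_odd \<tau> n) = (\<Sum>r\<le>M. a11 \<tau> r * \<gamma>11 (int r) K)"
proof -
  have "(\<Sum>n\<le>K. \<delta>11 n * B_odd \<tau> n) = (\<Sum>n\<le>K. \<Sum>r\<le>M. \<delta>11 n * (q ^ (r^2 + r) * c_odd \<tau> r * ip (int n - int r) * ip (int n + int r + 1)))"
    unfolding B_odd_def sum_distrib_left using assms
    by (intro sum.cong refl sum.mono_neutral_left) (auto simp: ip_neg)
  also have "\<dots> = (\<Sum>r\<le>M. \<Sum>n\<le>K. \<delta>11 n * (q ^ (r^2 + r) * c_odd \<tau> r * ip (int n - int r) * ip (int n + int r + 1)))"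
    by (rule sum.swap)
  also have "\<dots> = (\<Sum>r\<le>M. a11 \<tau> r * \<gamma>11 (int r) K)"
    unfolding a11_def \<gamma>11_def sum_distrib_left by (intro sum.cong refl) (simp only: mult_ac)
  finally show ?thesis .
qed

lemma \<delta>11_B_odd_average:
  "((\<Sum>n\<le>2*N. \<delta>11 n * B_odd \<tau> n) + (\<Sum>n\<le>2*N+1. \<delta>11 n * B_odd \<tau> n)) / 2 = (\<Sum>r\<le>2*N+1. a11 \<tau> r * avg11 r N)"
proof -
  have "(\<Sum>n\<le>2*N. \<delta>11 n * B_odd \<tau> n) = (\<Sum>r\<le>2*N+1. a11 \<tau> r * \<gamma>11 (int r) (2*N))"
    "(\<Sum>n\<le>2*N+1. \<delta>11 n * B_odd \<tau> n) = (\<Sum>r\<le>2*N+1. a11 \<tau> r * \<gamma>11 (int r) (2*N+1))"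
    by (rule \<delta>11_B_odd_sum; simp)+
  then show ?thesis unfolding avg11_def
    by (simp only: sum_divide_distrib sum.distrib[symmetric] distrib_left[symmetric] times_divide_eq_right[symmetric])
qed

text \<open>A lower bound for both exponents \<open>-2w\<^sup>2 - w\<close> and \<open>-2w\<^sup>2 + 3w - 1\<close> that is decreasing in \<open>\<bar>w\<bar>\<close>.\<close>

definition small\<tau> :: "(int \<Rightarrow> complex) \<Rightarrow> bool" where
  "small\<tau> \<tau> \<longleftrightarrow> (\<forall>w. norm (\<tau> w) \<le> norm p powi (- 2 * w^2 - 3 * \<bar>w\<bar> - 1))"

section \<open>Growth bounds and limits\<close>

lemma norm_p_powi_mono: "m \<le> n \<Longrightarrow> norm p powi n \<le> norm p powi m"
  using norm_p p_nonzero by (intro power_int_decreasing) auto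

lemma small_\<tau>A: "small\<tau> \<tau>A" and small_\<tau>D: "small\<tau> \<tau>D"
  unfolding small\<tau>_def \<tau>A_def \<tau>D_def norm_power_int by (intro allI norm_p_powi_mono; simp)+

lemma S1_bound:
  assumes "small\<tau> \<tau>"
  shows "norm (S1 \<tau> R) \<le> real R * norm p powi (- 2 * int R ^ 2 + int R)"
proof -
  have "norm (S1 \<tau> R) \<le> (\<Sum>i<R. norm p powi (- 2 * int R ^ 2 + int R))"
    unfolding S1_def
  proof (rule sum_norm_le)
    fix i assume "i \<in> {..<R}"
    define w where "w = int R - 1 - 2 * int i"
    have w: "\<bar>w\<bar> \<le> int R - 1" using \<open>i \<in> {..<R}\<close> by (auto simp: w_def)
    then have "\<bar>w\<bar>^2 \<le> (int R - 1)^2" by (intro power_mono) auto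
    then have "- 2 * int R ^ 2 + int R \<le> - 2 * w^2 - 3 * \<bar>w\<bar> - 1"
      using w by (simp add: power2_eq_square algebra_simps)
    then show "norm (\<tau> (int R - 1 - 2 * int i)) \<le> norm p powi (- 2 * int R ^ 2 + int R)"
      using assms norm_p_powi_mono unfolding small\<tau>_def w_def[symmetric] by (meson order_trans)
  qed
  then show ?thesis by simp
qed

text \<open>The factor q^(r^2) gained in the Bailey step cancels the growth p^(-2r^2) of
  \<open>S1\<close>; what is left is the exponent (r - 1)^2 + r.\<close>

lemma a9_bound:
  assumes "small\<tau> \<tau>"
  shows "norm (a9 \<tau> r) \<le> 1 * ((real r + 1) * norm p ^ r)"
proof -
  have p0: "norm p \<noteq> 0" using p_nonzero by simp
  have "norm (a9 \<tau> r) = norm p powi (2 * int (r^2)) * norm p powi ((int r - 1)^2) * norm (S1 \<tau> r)"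
    unfolding a9_def q_pow by (simp add: norm_mult norm_power norm_power_int)
  also have "\<dots> \<le> norm p powi (2 * int (r^2)) * norm p powi ((int r - 1)^2) * (real r * norm p powi (- 2 * int r ^ 2 + int r))"
    by (intro mult_left_mono S1_bound assms) auto
  also have "\<dots> = real r * norm p powi (2 * int (r^2) + (int r - 1)^2 + (- 2 * int r ^ 2 + int r))"
    by (simp only: power_int_add[OF disjI1[OF p0]] mult_ac)
  also have "\<dots> \<le> (real r + 1) * norm p powi int r"
  proof (intro mult_mono norm_p_powi_mono)
    have "0 \<le> (int r - 1)^2" by simp
    then show "int r \<le> 2 * int (r^2) + (int r - 1)^2 + (- 2 * int r ^ 2 + int r)" by simp
  qed auto
  finally show ?thesis by (simp only: power_int_of_nat mult_1)
qed

text \<open>The smaller of the two exponents is (r - 1)^2 + r - 2, which is negative for small r;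
  this accounts for the division by \<open>norm p ^ 2\<close>.\<close>

lemma a11_bound:
  assumes "small\<tau> \<tau>"
  shows "norm (a11 \<tau> r) \<le> (2 / norm p ^ 2) * ((real r + 1) * norm p ^ r)"
proof -
  have p0: "norm p \<noteq> 0" using p_nonzero by simp
  have "norm (c_odd \<tau> r) \<le> norm p powi (int r ^ 2) * norm (S1 \<tau> (Suc r)) + norm p powi ((int r + 1)^2) * norm (S1 \<tau> r)"
    unfolding c_odd_def norm_mult
    by (rule order_trans[OF mult_left_mono[OF norm_triangle_ineq]]) (auto simp: norm_mult norm_power norm_power_int)
  then have "norm (a11 \<tau> r) \<le> norm p powi (2 * int (r^2 + r)) * (norm p powi (int r ^ 2) * norm (S1 \<tau> (Suc r)) + norm p powi ((int r + 1)^2) * norm (S1 \<tau> r))"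
    unfolding a11_def q_pow norm_mult norm_power_int by (intro mult_left_mono) auto
  also have "\<dots> \<le> norm p powi (2 * int (r^2 + r)) * (norm p powi (int r ^ 2) * (real (Suc r) * norm p powi (- 2 * int (Suc r) ^ 2 + int (Suc r)))
      + norm p powi ((int r + 1)^2) * (real r * norm p powi (- 2 * int r ^ 2 + int r)))"
    by (intro mult_left_mono add_mono S1_bound assms) auto
  also have "\<dots> = real (Suc r) * norm p powi (2 * int (r^2 + r) + int r ^ 2 + (- 2 * int (Suc r) ^ 2 + int (Suc r)))
      + real r * norm p powi (2 * int (r^2 + r) + (int r + 1)^2 + (- 2 * int r ^ 2 + int r))"
    by (simp only: power_int_add[OF disjI1[OF p0]] mult_ac distrib_left)
  also have "\<dots> \<le> (real r + 1) * norm p powi (int r - 2) + (real r + 1) * norm p powi (int r - 2)"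
  proof (intro add_mono mult_mono norm_p_powi_mono)
    have "0 \<le> (int r - 1)^2" by simp
    then show "int r - 2 \<le> 2 * int (r^2 + r) + int r ^ 2 + (- 2 * int (Suc r) ^ 2 + int (Suc r))"
      by (simp add: power2_eq_square algebra_simps)
    have "0 \<le> int r * int r" by simp
    then show "int r - 2 \<le> 2 * int (r^2 + r) + (int r + 1)^2 + (- 2 * int r ^ 2 + int r)"
      by (simp add: power2_eq_square algebra_simps)
  qed auto
  also have "\<dots> = (2 / norm p ^ 2) * ((real r + 1) * norm p ^ r)"
    using p0 by (simp add: power_int_diff field_simps)
  finally show ?thesis .
qed

lemma even_sums:
  assumes "small\<tau> \<tau>"
  shows "(\<lambda>n. \<delta>9 (Suc n) * B_even \<tau> (Suc n)) sums (\<Sum>r. a9 \<tau> r * (2 * (- q) ^ r))"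
proof -
  obtain C where C: "\<And>r K. norm (\<gamma>9 r K) \<le> C * (real r + 1)" using \<gamma>9_bound by blast
  have "(\<lambda>K. \<Sum>r\<le>K. a9 \<tau> r * \<gamma>9 r K) \<longlonglongrightarrow> (\<Sum>r. a9 \<tau> r * (if r = 0 then 0 else 2 * (- q) ^ r))"
    by (rule weighted_sum_tendsto[OF a9_bound[OF assms] _ norm_p C \<gamma>9_tendsto \<gamma>9_zero]) auto
  \<comment> \<open>The exceptional limit 0 at r = 0 may be replaced by the general formula, since
    \<open>a9\<close> vanishes there.\<close>
  moreover have "(\<lambda>r. a9 \<tau> r * (if r = 0 then 0 else 2 * (- q) ^ r)) = (\<lambda>r. a9 \<tau> r * (2 * (- q) ^ r))"
    by (auto simp: a9_def S1_def)
  moreover have "(\<Sum>n<K. \<delta>9 (Suc n) * B_even \<tau> (Suc n)) = (\<Sum>n=1..K. \<delta>9 n * B_even \<tau> n)" for K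
    by (rule sum.reindex_bij_witness[of _ "\<lambda>n. n - 1" Suc]) auto
  ultimately show ?thesis unfolding sums_def \<delta>9_B_even_sum by simp
qed

lemma odd_starsum:
  assumes "small\<tau> \<tau>"
  shows "(\<lambda>N. ((\<Sum>n\<le>2*N. \<delta>11 n * B_odd \<tau> n) + (\<Sum>n\<le>2*N+1. \<delta>11 n * B_odd \<tau> n)) / 2)
     \<longlonglongrightarrow> (\<Sum>r. a11 \<tau> r * ((-1) ^ r / 2))"
proof -
  obtain C where C: "\<And>r K. norm (avg11 r K) \<le> C * (real r + 1)" using avg11_bound by blast
  show ?thesis unfolding \<delta>11_B_odd_average
    by (rule weighted_sum_tendsto(1)[OF a11_bound[OF assms] _ norm_p C avg11_tendsto avg11_zero]) auto
qed

end

section \<open>Ideals of the quadratic order\<close>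

text \<open>The multiplicity of p is even on the left and odd on the right. Used for the
  irrationality of sqrt 6 (with p = 2) and to exclude 24v^2 = 5M^2 in the Euclidean step (with p =
  5).\<close>

lemma prime_times_square_neq:
  fixes c d v m :: int and p :: nat
  assumes p: "prime p" and "\<not> int p dvd c" "\<not> int p dvd d" "m \<noteq> 0"
  shows "c * v^2 \<noteq> int p * d * m^2"
proof
  assume eq: "c * v^2 = int p * d * m^2"
  have pi: "prime (int p)" using p by simp
  have pe: "prime_elem (int p)" using pi by auto
  have nz: "c \<noteq> 0" "d \<noteq> 0" "int p \<noteq> 0" using assms by (auto simp: prime_gt_0_nat)
  have "v \<noteq> 0" using eq nz assms(4) by auto
  have "multiplicity (int p) (c * v^2) = 2 * multiplicity (int p) v"
    using pe nz \<open>v \<noteq> 0\<close> assms(2)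
    by (simp add: prime_elem_multiplicity_mult_distrib prime_elem_multiplicity_power_distrib not_dvd_imp_multiplicity_0)
  moreover have "multiplicity (int p) (int p * d * m^2) = 1 + 2 * multiplicity (int p) m"
    using pe nz assms(3,4)
    by (simp add: prime_elem_multiplicity_mult_distrib prime_elem_multiplicity_power_distrib not_dvd_imp_multiplicity_0)
  moreover have "2 * i \<noteq> 1 + 2 * j" for i j :: nat by presburger
  ultimately show False using eq by metis
qed

lemma square_neq_six_square: "(y::int) \<noteq> 0 \<Longrightarrow> x^2 \<noteq> 6 * y^2"
  using prime_times_square_neq[of 2 1 3 y x] by simp

definition nrm :: "int \<times> int \<Rightarrow> int" where
  "nrm \<alpha> = fst \<alpha> ^ 2 - 6 * snd \<alpha> ^ 2"

lemma nrm_mult: "nrm (zs6_mult \<alpha> \<beta>) = nrm \<alpha> * nrm \<beta>"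
  by (simp add: nrm_def zs6_mult_def power2_eq_square algebra_simps)

lemma nrm_eq_0_iff: "nrm \<alpha> = 0 \<longleftrightarrow> \<alpha> = (0, 0)"
  using square_neq_six_square[of "snd \<alpha>" "fst \<alpha>"]
  by (cases \<alpha>; cases "snd \<alpha> = 0") (auto simp: nrm_def)

lemma zs6_mult_assoc: "zs6_mult (zs6_mult \<alpha> \<beta>) \<gamma> = zs6_mult \<alpha> (zs6_mult \<beta> \<gamma>)"
  by (simp add: zs6_mult_def algebra_simps)

lemma zs6_mult_one: "zs6_mult (1, 0) \<alpha> = \<alpha>"
  by (simp add: zs6_mult_def)

definition principal :: "int \<times> int \<Rightarrow> (int \<times> int) set" where
  "principal \<alpha> = range (\<lambda>\<rho>. zs6_mult \<rho> \<alpha>)"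

lemma principal_mem: "\<alpha> \<in> principal \<alpha>"
  unfolding principal_def by (metis rangeI zs6_mult_one)

lemma principal_ideal: "zs6_ideal (principal \<alpha>)"
  unfolding zs6_ideal_def
proof (intro conjI allI ballI)
  have "(0, 0) = zs6_mult (0, 0) \<alpha>" by (simp add: zs6_mult_def)
  then show "(0, 0) \<in> principal \<alpha>" unfolding principal_def by blast
next
  fix x y assume "x \<in> principal \<alpha>" "y \<in> principal \<alpha>"
  then obtain \<rho> \<sigma> where "x = zs6_mult \<rho> \<alpha>" "y = zs6_mult \<sigma> \<alpha>" unfolding principal_def by blast
  then have "(fst x + fst y, snd x + snd y) = zs6_mult (fst \<rho> + fst \<sigma>, snd \<rho> + snd \<sigma>) \<alpha>"
    by (simp add: zs6_mult_def algebra_simps)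
  then show "(fst x + fst y, snd x + snd y) \<in> principal \<alpha>" unfolding principal_def by blast
next
  fix r x assume "x \<in> principal \<alpha>"
  then show "zs6_mult r x \<in> principal \<alpha>" unfolding principal_def by (auto simp flip: zs6_mult_assoc)
qed

lemma principal_subset: "zs6_ideal I \<Longrightarrow> \<alpha> \<in> I \<Longrightarrow> principal \<alpha> \<subseteq> I"
  unfolding principal_def zs6_ideal_def by blast

lemma principal_nonzero: "\<alpha> \<noteq> (0, 0) \<Longrightarrow> zs6_nonzero_ideal (principal \<alpha>)"
  unfolding zs6_nonzero_ideal_def using principal_ideal principal_mem by blast

section \<open>Euclidean division and principal ideals\<close>

lemma nearest_multiple:
  fixes s M :: int
  assumes "M > 0"
  shows "\<exists>c. 2 * \<bar>s - M * c\<bar> \<le> M"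
proof -
  define r where "r = s mod M"
  have r: "0 \<le> r" "r < M" "s = M * (s div M) + r" using assms by (auto simp: r_def)
  show ?thesis
  proof (cases "2 * r \<le> M")
    case True
    have "s - M * (s div M) = r" using r(3) by simp
    then show ?thesis using True r(1) by (metis abs_of_nonneg)
  next
    case False
    have "s - M * (s div M + 1) = r - M" using r(3) by (simp add: algebra_simps)
    moreover have "2 * \<bar>r - M\<bar> \<le> M" using False r by simp
    ultimately show ?thesis by metis
  qed
qed

text \<open>For a fixed second coordinate \<open>v\<close> the three candidates \<open>a\<close>, \<open>M - a\<close>, \<open>M + a\<close> cover all cases;
  the only obstruction would be \<open>24v\<^sup>2 = 5M\<^sup>2\<close>.\<close>

lemma euclidean_step:
  fixes s t M :: int
  assumes M: "M > 0"
  shows "\<exists>c d. \<bar>(s - M * c)^2 - 6 * (t - M * d)^2\<bar> < M^2"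
proof -
  obtain c0 where c0: "2 * \<bar>s - M * c0\<bar> \<le> M" using nearest_multiple[OF M] by blast
  obtain d where d: "2 * \<bar>t - M * d\<bar> \<le> M" using nearest_multiple[OF M] by blast
  define v where "v = \<bar>t - M * d\<bar>"
  define a where "a = \<bar>s - M * c0\<bar>"
  define \<epsilon> where "\<epsilon> = (if s - M * c0 \<ge> 0 then 1 else - 1 :: int)"
  have sa: "s - M * c0 = \<epsilon> * a" by (simp add: a_def \<epsilon>_def)
  have \<epsilon>2: "\<epsilon>^2 = 1" by (simp add: \<epsilon>_def)
  have a: "0 \<le> a" "2 * a \<le> M" using c0 by (auto simp: a_def)
  have v: "0 \<le> v" "2 * v \<le> M" using d by (auto simp: v_def)
  have v2: "(t - M * d)^2 = v^2" by (simp add: v_def)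
  have "(2 * v)^2 \<le> M^2" using v by (intro power_mono) auto
  then have v4: "4 * v^2 \<le> M^2" by (simp add: power2_eq_square)
  have "(2 * a)^2 \<le> M^2" using a by (intro power_mono) auto
  then have a4: "4 * a^2 \<le> M^2" by (simp add: power2_eq_square)
  have aM: "2 * (a * M) \<le> M^2" using a M mult_right_mono[of "2 * a" M M] by (simp add: power2_eq_square)
  have aM0: "0 \<le> a * M" using a M by simp
  have M2: "0 < M^2" using M by simp
  have sq: "0 \<le> a^2" "0 \<le> v^2" by simp_all
  have m1: "(M - a)^2 = M^2 - 2 * (a * M) + a^2" "(M + a)^2 = M^2 + 2 * (a * M) + a^2"
    by (simp_all add: power2_eq_square algebra_simps)
  have e1: "(s - M * c0)^2 = a^2" by (simp add: a_def)
  have e2: "(s - M * (c0 + \<epsilon>))^2 = (M - a)^2"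
  proof -
    have "s - M * (c0 + \<epsilon>) = \<epsilon> * (a - M)" using sa by (simp add: algebra_simps)
    then show ?thesis using \<epsilon>2 by (simp add: power_mult_distrib power2_commute)
  qed
  have e3: "(s - M * (c0 - \<epsilon>))^2 = (M + a)^2"
  proof -
    have "s - M * (c0 - \<epsilon>) = \<epsilon> * (M + a)" using sa by (simp add: algebra_simps)
    then show ?thesis using \<epsilon>2 by (simp add: power_mult_distrib)
  qed
  consider "6 * v^2 < M^2 + a^2" | "6 * v^2 \<ge> M^2 + a^2" "6 * v^2 < M^2 + (M - a)^2" | "6 * v^2 \<ge> M^2 + (M - a)^2"
    by linarith
  then show ?thesis
  proof cases
    case 1
    then have "\<bar>(s - M * c0)^2 - 6 * (t - M * d)^2\<bar> < M^2"
      unfolding e1 v2 using a4 M2 sq by linarith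
    then show ?thesis by blast
  next
    case 2
    then have "\<bar>(s - M * (c0 + \<epsilon>))^2 - 6 * (t - M * d)^2\<bar> < M^2"
      unfolding e2 v2 using m1 a4 M2 sq aM0 aM by linarith
    then show ?thesis by blast
  next
    case 3
    have "24 * v^2 \<noteq> 5 * M^2"
      using prime_times_square_neq[of 5 24 1 M v] M by simp
    moreover have "24 * v^2 = 5 * M^2" if "(M + a)^2 - 6 * v^2 \<ge> M^2"
    proof -
      have "2 * (a * M) = M^2" "6 * v^2 = M^2 + (M - a)^2" using that 3 m1 aM by linarith+
      then have "a = M - a" using M by (simp add: power2_eq_square)
      then have "M = 2 * a" by simp
      then show ?thesis using \<open>6 * v^2 = M^2 + (M - a)^2\<close> by (simp add: power2_eq_square)
    qed
    ultimately have "(M + a)^2 - 6 * v^2 < M^2" by linarith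
    moreover have "(M + a)^2 - 6 * v^2 > - (M^2)" using m1 v4 M2 sq aM0 by linarith
    ultimately have "\<bar>(s - M * (c0 - \<epsilon>))^2 - 6 * (t - M * d)^2\<bar> < M^2"
      unfolding e3 v2 by linarith
    then show ?thesis by blast
  qed
qed

lemma division_with_remainder:
  assumes "\<alpha> \<noteq> (0, 0)"
  shows "\<exists>\<gamma>. \<bar>nrm (fst \<beta> - fst (zs6_mult \<gamma> \<alpha>), snd \<beta> - snd (zs6_mult \<gamma> \<alpha>))\<bar> < \<bar>nrm \<alpha>\<bar>"
proof -
  define D where "D = nrm \<alpha>"
  have D: "D \<noteq> 0" using assms nrm_eq_0_iff by (simp add: D_def)
  \<comment> \<open>s + t sqrt 6 is \<beta> times the conjugate of \<alpha>, so \<beta>/\<alpha> =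
    (s + t sqrt 6)/D. The quotient is rounded by \<open>euclidean_step\<close> with M = |D|; the
    form bounded there is D times the norm of the remainder.\<close>
  define s where "s = fst \<beta> * fst \<alpha> - 6 * snd \<beta> * snd \<alpha>"
  define t where "t = snd \<beta> * fst \<alpha> - fst \<beta> * snd \<alpha>"
  obtain c d where cd: "\<bar>(s - \<bar>D\<bar> * c)^2 - 6 * (t - \<bar>D\<bar> * d)^2\<bar> < \<bar>D\<bar>^2"
    using euclidean_step[of "\<bar>D\<bar>" s t] D by auto
  define c' d' where "c' = sgn D * c" and "d' = sgn D * d"
  have cd': "\<bar>D\<bar> * c = D * c'" "\<bar>D\<bar> * d = D * d'" by (simp_all add: c'_def d'_def abs_sgn)
  define \<rho> where "\<rho> = (fst \<beta> - fst (zs6_mult (c', d') \<alpha>), snd \<beta> - snd (zs6_mult (c', d') \<alpha>))"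
  have "nrm \<rho> * D = (s - D * c')^2 - 6 * (t - D * d')^2"
    unfolding \<rho>_def nrm_def D_def s_def t_def zs6_mult_def by simp algebra
  then have "\<bar>nrm \<rho>\<bar> * \<bar>D\<bar> < \<bar>D\<bar> * \<bar>D\<bar>"
    using cd unfolding cd' by (simp add: power2_eq_square flip: abs_mult)
  then have "\<bar>nrm \<rho>\<bar> < \<bar>D\<bar>" by (rule mult_right_less_imp_less) simp
  then show ?thesis unfolding \<rho>_def D_def by blast
qed

lemma nonzero_ideal_principal:
  assumes "zs6_nonzero_ideal I"
  shows "\<exists>\<alpha>. \<alpha> \<noteq> (0, 0) \<and> I = principal \<alpha>"
proof -
  have I: "zs6_ideal I" "(0, 0) \<in> I" using assms by (auto simp: zs6_nonzero_ideal_def zs6_ideal_def)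
  obtain \<alpha>0 where "\<alpha>0 \<in> I" "\<alpha>0 \<noteq> (0, 0)" using assms I(2) unfolding zs6_nonzero_ideal_def by blast
  then obtain \<alpha> where \<alpha>: "\<alpha> \<in> I" "\<alpha> \<noteq> (0, 0)"
    and min: "\<And>\<beta>. \<beta> \<in> I \<Longrightarrow> \<beta> \<noteq> (0, 0) \<Longrightarrow> nat \<bar>nrm \<alpha>\<bar> \<le> nat \<bar>nrm \<beta>\<bar>"
    using arg_min_natI[of "\<lambda>\<alpha>. \<alpha> \<in> I \<and> \<alpha> \<noteq> (0, 0)" \<alpha>0 "\<lambda>\<alpha>. nat \<bar>nrm \<alpha>\<bar>"]
      arg_min_nat_le[of "\<lambda>\<alpha>. \<alpha> \<in> I \<and> \<alpha> \<noteq> (0, 0)" _ "\<lambda>\<alpha>. nat \<bar>nrm \<alpha>\<bar>"] by blast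
  have "\<beta> \<in> principal \<alpha>" if \<beta>: "\<beta> \<in> I" for \<beta>
  proof -
    obtain \<gamma> where \<gamma>: "\<bar>nrm (fst \<beta> - fst (zs6_mult \<gamma> \<alpha>), snd \<beta> - snd (zs6_mult \<gamma> \<alpha>))\<bar> < \<bar>nrm \<alpha>\<bar>"
      using division_with_remainder[OF \<alpha>(2)] by blast
    let ?\<rho> = "(fst \<beta> - fst (zs6_mult \<gamma> \<alpha>), snd \<beta> - snd (zs6_mult \<gamma> \<alpha>))"
    have m: "zs6_mult (- fst \<gamma>, - snd \<gamma>) \<alpha> = (- fst (zs6_mult \<gamma> \<alpha>), - snd (zs6_mult \<gamma> \<alpha>))"
      by (simp add: zs6_mult_def)
    have "(- fst (zs6_mult \<gamma> \<alpha>), - snd (zs6_mult \<gamma> \<alpha>)) \<in> I"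
      using I(1) \<alpha>(1) unfolding m[symmetric] zs6_ideal_def by blast
    then have "?\<rho> \<in> I" using I(1) \<beta> unfolding zs6_ideal_def by fastforce
    then have "?\<rho> = (0, 0)" using min[of ?\<rho>] \<gamma> by force
    then have "\<beta> = zs6_mult \<gamma> \<alpha>" by (simp add: prod_eq_iff)
    then show ?thesis unfolding principal_def by blast
  qed
  then show ?thesis using \<alpha> principal_subset[OF I(1)] by blast
qed

section \<open>The absolute norm of a principal ideal\<close>

lemma card_quotient_kernel:
  "card (UNIV // {(x, y). \<phi> x = \<phi> y}) = card (range \<phi>)"
proof -
  have "UNIV // {(x, y). \<phi> x = \<phi> y} = (\<lambda>v. {y. v = \<phi> y}) ` range \<phi>"
    by (auto simp: quotient_def Image_def)
  moreover have "inj_on (\<lambda>v. {y. v = \<phi> y}) (range \<phi>)"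
    by (rule inj_onI) blast
  ultimately show ?thesis by (simp add: card_image)
qed

text \<open>The ideal is brought into Hermite normal form: it is spanned over the integers by \<open>(e, f)\<close> and \<open>(0, g)\<close>
  with \<open>e = gcd a (6b)\<close> and \<open>e g = \<bar>a\<^sup>2 - 6b\<^sup>2\<bar>\<close>.\<close>

lemma zs6_norm_principal:
  assumes "\<alpha> \<noteq> (0, 0)"
  shows "zs6_norm (principal \<alpha>) = nat \<bar>nrm \<alpha>\<bar>"
proof -
  obtain a b where ab: "\<alpha> = (a, b)" by (cases \<alpha>)
  define e where "e = gcd a (6 * b)"
  have D: "nrm \<alpha> \<noteq> 0" using assms nrm_eq_0_iff by simp
  have e: "e > 0" using assms by (auto simp: e_def ab)
  obtain a' b' where a': "a = e * a'" and b': "6 * b = e * b'"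
    unfolding e_def by (meson dvdE gcd_dvd1 gcd_dvd2)
  obtain u v where "u * a + v * (6 * b) = e" unfolding e_def using bezout_int by blast
  then have "e * (u * a' + v * b') = e * 1" unfolding a' b' by (simp add: algebra_simps)
  then have uv: "u * a' + v * b' = 1" using e by (simp only: mult_cancel_left) auto
  define f where "f = u * b + v * a"
  define D' where "D' = a * a' - b * b'"
  have nD: "nrm \<alpha> = e * D'"
  proof -
    have "nrm \<alpha> = a * a - b * (6 * b)" by (simp add: nrm_def ab power2_eq_square)
    also have "\<dots> = e * D'" unfolding b' unfolding D'_def by (subst (2) a') (simp add: algebra_simps)
    finally show ?thesis .
  qed
  define g where "g = \<bar>D'\<bar>"
  have g: "g > 0" using D nD by (simp add: g_def)
  have mem: "(x, y) \<in> principal \<alpha> \<longleftrightarrow> e dvd x \<and> g dvd (y - f * (x div e))" for x y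
  proof
    assume "(x, y) \<in> principal \<alpha>"
    then obtain \<rho> where "(x, y) = zs6_mult \<rho> \<alpha>" unfolding principal_def by blast
    then obtain r s where rs: "x = r * a + 6 * s * b" "y = r * b + s * a"
      by (simp add: zs6_mult_def ab)
    have x: "x = e * (r * a' + s * b')"
    proof -
      have "x = r * a + s * (6 * b)" using rs by simp
      then show ?thesis unfolding b' by (subst (asm) a') (simp add: algebra_simps)
    qed
    have "y - f * (r * a' + s * b') = D' * (s * u - r * v)"
      unfolding rs(2) f_def D'_def using uv by algebra
    then show "e dvd x \<and> g dvd (y - f * (x div e))"
      using e unfolding x by (simp add: g_def)
  next
    assume *: "e dvd x \<and> g dvd (y - f * (x div e))"
    then obtain k where k: "x = e * k" by blast
    have "D' dvd y - f * k" using * e by (simp add: k g_def)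
    then obtain m where m: "y = f * k + D' * m" by (metis add.commute diff_add_cancel dvdE)
    have "zs6_mult (k * u - m * b', k * v + m * a') \<alpha> = (x, y)"
    proof -
      have "(k * u - m * b') * a + 6 * (k * v + m * a') * b = k * (u * a + v * (6 * b)) + m * (a' * (6 * b) - b' * a)"
        by (simp add: algebra_simps)
      also have "\<dots> = e * k * (u * a' + v * b')" unfolding b' by (subst (1 2) a') (simp add: algebra_simps)
      finally have 1: "(k * u - m * b') * a + 6 * (k * v + m * a') * b = x" using uv k by simp
      have 2: "(k * u - m * b') * b + (k * v + m * a') * a = y" unfolding m f_def D'_def by (simp add: algebra_simps)
      show ?thesis using 1 2 by (simp add: zs6_mult_def ab)
    qed
    then show "(x, y) \<in> principal \<alpha>" unfolding principal_def by (metis rangeI)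
  qed
  define \<phi> where "\<phi> z = (fst z mod e, (snd z - f * (fst z div e)) mod g)" for z :: "int \<times> int"
  have "(fst z - fst w, snd z - snd w) \<in> principal \<alpha> \<longleftrightarrow> \<phi> z = \<phi> w" for z w
  proof (cases "e dvd fst z - fst w")
    case True
    then have m: "fst z mod e = fst w mod e" by (simp add: mod_eq_dvd_iff)
    have h: "(fst z - fst w) div e = fst z div e - fst w div e"
    proof -
      have "fst z - fst w = e * (fst z div e - fst w div e) + (fst z mod e - fst w mod e)"
        by (simp add: algebra_simps minus_mod_eq_mult_div[symmetric])
      then show ?thesis using m e by simp
    qed
    have "snd z - snd w - f * (fst z div e - fst w div e) = (snd z - f * (fst z div e)) - (snd w - f * (fst w div e))"
      by (simp add: algebra_simps)
    then show ?thesis using True m unfolding mem \<phi>_def h by (simp only: mod_eq_dvd_iff prod.inject simp_thms)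
  next
    case False
    then show ?thesis unfolding mem \<phi>_def by (simp add: mod_eq_dvd_iff)
  qed
  then have "zs6_norm (principal \<alpha>) = card (range \<phi>)"
    unfolding zs6_norm_def by (simp add: card_quotient_kernel)
  also have "range \<phi> = {0..<e} \<times> {0..<g}"
  proof
    show "range \<phi> \<subseteq> {0..<e} \<times> {0..<g}" using e g by (auto simp: \<phi>_def)
    have "\<phi> z = z" if "z \<in> {0..<e} \<times> {0..<g}" for z using that by (auto simp: \<phi>_def)
    then show "{0..<e} \<times> {0..<g} \<subseteq> range \<phi>" by (metis rangeI subsetI)
  qed
  also have "card \<dots> = nat \<bar>nrm \<alpha>\<bar>"
    using e g by (simp add: card_cartesian_product nD g_def abs_mult nat_mult_distrib)
  finally show ?thesis .
qed

section \<open>Fundamental domains for the units\<close>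

lemma principal_mult_unit:
  assumes "nrm \<eta> = 1"
  shows "principal (zs6_mult \<eta> \<alpha>) = principal \<alpha>"
proof
  have "zs6_mult \<eta> \<alpha> \<in> principal \<alpha>" unfolding principal_def by blast
  then show "principal (zs6_mult \<eta> \<alpha>) \<subseteq> principal \<alpha>" by (rule principal_subset[OF principal_ideal])
  have "zs6_mult (fst \<eta>, - snd \<eta>) \<eta> = (1, 0)"
    using assms by (simp add: zs6_mult_def nrm_def power2_eq_square)
  then have "\<alpha> = zs6_mult (fst \<eta>, - snd \<eta>) (zs6_mult \<eta> \<alpha>)"
    by (simp add: zs6_mult_one flip: zs6_mult_assoc)
  then have "\<alpha> \<in> principal (zs6_mult \<eta> \<alpha>)" unfolding principal_def by (metis rangeI)
  then show "principal \<alpha> \<subseteq> principal (zs6_mult \<eta> \<alpha>)" by (rule principal_subset[OF principal_ideal])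
qed

text \<open>Equal ideals have equal index, so the norms of the generators agree up to sign; both
  being negative, the connecting unit has norm exactly 1.\<close>

lemma principal_eq_imp_unit:
  assumes eq: "principal \<alpha> = principal \<beta>" and neg: "nrm \<alpha> < 0" "nrm \<beta> < 0"
  shows "\<exists>\<eta>. \<beta> = zs6_mult \<eta> \<alpha> \<and> nrm \<eta> = 1"
proof -
  have "\<beta> \<in> principal \<alpha>" using eq principal_mem by blast
  then obtain \<eta> where \<eta>: "\<beta> = zs6_mult \<eta> \<alpha>" unfolding principal_def by blast
  have "\<alpha> \<noteq> (0, 0)" "\<beta> \<noteq> (0, 0)" using neg by (auto simp: nrm_def)
  then have "nat \<bar>nrm \<alpha>\<bar> = nat \<bar>nrm \<beta>\<bar>" using eq zs6_norm_principal by metis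
  then have "nrm \<beta> = nrm \<alpha>" using neg by linarith
  then have "nrm \<eta> = 1" using \<eta> neg by (simp add: nrm_mult)
  then show ?thesis using \<eta> by blast
qed

lemma square_mod_8:
  fixes x :: int
  shows "x^2 mod 8 = 0 \<or> x^2 mod 8 = 1 \<or> x^2 mod 8 = 4"
proof -
  have "x mod 8 \<in> {0,1,2,3,4,5,6,7}" by simp presburger
  then have "(x mod 8)^2 mod 8 = 0 \<or> (x mod 8)^2 mod 8 = 1 \<or> (x mod 8)^2 mod 8 = 4" by auto
  then show ?thesis by (simp only: power_mod)
qed

text \<open>x^2 - 6y^2 takes only the residues 0, 1, 2, 3, 4, 6 modulo 8, so an absolute value
  congruent to 5 or 7 must come from a negative norm.\<close>

lemma nrm_negative:
  assumes "nat \<bar>nrm \<alpha>\<bar> mod 8 = 5 \<or> nat \<bar>nrm \<alpha>\<bar> mod 8 = 7"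
  shows "nrm \<alpha> < 0"
proof (rule ccontr)
  assume "\<not> nrm \<alpha> < 0"
  then have "nrm \<alpha> = int (nat \<bar>nrm \<alpha>\<bar>)" by simp
  then have "nrm \<alpha> mod 8 = 5 \<or> nrm \<alpha> mod 8 = 7"
    using assms by (metis of_nat_mod of_nat_numeral)
  moreover have "nrm \<alpha> mod 8 = (fst \<alpha> ^ 2 mod 8 - 6 * (snd \<alpha> ^ 2 mod 8)) mod 8"
    unfolding nrm_def by (intro mod_diff_cong) (simp_all only: mod_mult_right_eq mod_mod_trivial)
  ultimately show False
    using square_mod_8[of "fst \<alpha>"] square_mod_8[of "snd \<alpha>"] by (elim disjE) simp_all
qed

text \<open>A unit with v > 0 that keeps y positive moves the cone beyond the line x = 2y, because
  u/v is at most 5/2, the value at the fundamental unit: the difference of the two sides exceeds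
  (10v - 4u) y >= 0.\<close>

lemma unit_orbit_leaves_domain:
  fixes u v x y :: int
  assumes uv: "u^2 - 6 * v^2 = 1" and v: "v > 0" and y: "y > 0" "\<bar>x\<bar> < 2 * y"
    and y': "u * y + v * x > 0"
  shows "u * x + 6 * v * y > 2 * (u * y + v * x)"
proof -
  have vx: "\<bar>v * x\<bar> < 2 * v * y" using y v by (simp add: abs_mult)
  have gt: "\<bar>u\<bar> > 2 * v"
  proof (rule ccontr)
    assume "\<not> ?thesis"
    then have "\<bar>u\<bar>^2 \<le> (2 * v)^2" by (intro power_mono) auto
    then have "1 + 2 * v^2 \<le> 0" using uv by (simp add: power_mult_distrib)
    moreover have "v^2 \<ge> 0" by simp
    ultimately show False by linarith
  qed
  have u: "u > 0"
  proof (rule ccontr)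
    assume "\<not> ?thesis"
    then have "u * y \<le> (- (2 * v)) * y" using gt y by (intro mult_right_mono) auto
    then show False using y' vx by linarith
  qed
  \<comment> \<open>4u^2 = 24v^2 + 4 is at most 25v^2 as soon as v >= 2, and v = 1 would need u^2 =
    7.\<close>
  have "2 * u \<le> 5 * v"
  proof (cases "v = 1")
    case True
    then have u7: "u^2 = 7" using uv by simp
    have "u \<noteq> 3" using u7 by auto
    moreover have "u < 3" if "u \<noteq> 3"
    proof (rule ccontr)
      assume "\<not> u < 3"
      then have "4 * 4 \<le> u * u" using that by (intro mult_mono) auto
      then show False using u7 by (simp add: power2_eq_square)
    qed
    ultimately have "u * u \<le> 2 * 2" using u by (intro mult_mono) auto
    then show ?thesis using u7 by (simp add: power2_eq_square)
  next
    case False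
    then have "2 * 2 \<le> v * v" using v by (intro mult_mono) auto
    then have "(2 * u)^2 \<le> (5 * v)^2" using uv by (simp add: power2_eq_square)
    then show ?thesis by (rule power2_le_imp_le) (use v in simp)
  qed
  then have "(10 * v - 4 * u) * y \<ge> 0" using y by (intro mult_nonneg_nonneg) auto
  moreover have "(u - 2 * v) * x > (u - 2 * v) * (- (2 * y))"
    using gt u y by (intro mult_strict_left_mono) auto
  ultimately show ?thesis by (simp add: algebra_simps)
qed

text \<open>For v < 0 the previous lemma is applied to the inverse unit, which carries (x', y') back
  to (x, y). For v = 0 the sign of u is fixed by y, y' > 0.\<close>

lemma domain_unit_trivial:
  fixes u v x y :: int
  assumes uv: "u^2 - 6 * v^2 = 1" and y: "y > 0" "\<bar>x\<bar> < 2 * y"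
    and x': "x' = u * x + 6 * v * y" and y': "y' = u * y + v * x" "y' > 0" "\<bar>x'\<bar> < 2 * y'"
  shows "u = 1 \<and> v = 0"
proof -
  have "\<not> v > 0" using unit_orbit_leaves_domain[OF uv _ y] x' y' by force
  moreover have "\<not> v < 0"
  proof
    assume v: "v < 0"
    have "(u^2 - 6 * v^2) * y = u * y' + (- v) * x'" "(u^2 - 6 * v^2) * x = u * x' + 6 * (- v) * y'"
      unfolding x' y'(1) by (simp_all add: power2_eq_square algebra_simps)
    then have e: "y = u * y' + (- v) * x'" "x = u * x' + 6 * (- v) * y'" unfolding uv by simp_all
    have "u^2 - 6 * (- v)^2 = 1" using uv by simp
    from unit_orbit_leaves_domain[OF this _ y'(2,3)] v e y show False by force
  qed
  ultimately have "v = 0" by simp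
  then have "u = 1 \<or> u = -1" using uv by (simp add: power2_eq_1_iff)
  then show ?thesis using \<open>v = 0\<close> y y' by auto
qed

text \<open>Descent on y: if |x| > 2y, the unit 5 + 2s sqrt 6 with s opposite in sign to x replaces
  y by 5y - 2|x| < y, still positive since 4x^2 < 24y^2 < 25y^2. S is abstract so that both cones
  can use it. The boundary |x| = 2y remains here and is removed later by parity.\<close>

lemma unit_orbit_meets_domain:
  fixes S :: "(int \<times> int) set"
  assumes ne: "S \<noteq> {}"
    and S: "\<And>x y. (x, y) \<in> S \<Longrightarrow> y > 0 \<and> x^2 < 6 * y^2"
    and closed: "\<And>x y s. (x, y) \<in> S \<Longrightarrow> s = 1 \<or> s = -1 \<Longrightarrow> 5 * y + s * (2 * x) > 0 \<Longrightarrow> (5 * x + s * (12 * y), 5 * y + s * (2 * x)) \<in> S"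
  shows "\<exists>x y. (x, y) \<in> S \<and> \<bar>x\<bar> \<le> 2 * y"
proof -
  obtain z0 where "z0 \<in> S" using ne by blast
  then obtain z where z: "z \<in> S" and min: "\<And>w. w \<in> S \<Longrightarrow> nat (snd z) \<le> nat (snd w)"
    using arg_min_natI[of "\<lambda>z. z \<in> S" z0 "\<lambda>z. nat (snd z)"]
      arg_min_nat_le[of "\<lambda>z. z \<in> S" _ "\<lambda>z. nat (snd z)"] by blast
  obtain x y where xy: "z = (x, y)" by (cases z)
  have y: "y > 0" "x^2 < 6 * y^2" using S z xy by auto
  have "y^2 > 0" using y by simp
  moreover have "\<bar>2 * x\<bar>^2 = 4 * x^2" "(5 * y)^2 = 25 * y^2" by (simp_all add: power_mult_distrib)
  ultimately have "\<bar>2 * x\<bar>^2 < (5 * y)^2" using y(2) by linarith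
  then have b: "\<bar>2 * x\<bar> < 5 * y" by (rule power_less_imp_less_base) (use y in simp)
  have "\<bar>x\<bar> \<le> 2 * y"
  proof (rule ccontr)
    assume n: "\<not> ?thesis"
    define s where "s = (if x > 0 then -1 else 1 :: int)"
    have sx: "s * (2 * x) = - \<bar>2 * x\<bar>" using n y by (auto simp: s_def)
    then have "5 * y + s * (2 * x) > 0" using b by linarith
    then have "(5 * x + s * (12 * y), 5 * y + s * (2 * x)) \<in> S"
      by (intro closed) (use z xy in \<open>auto simp: s_def\<close>)
    from min[OF this] show False using sx n b y xy by auto
  qed
  then show ?thesis using z xy by blast
qed

section \<open>Ideals as points of the two cones\<close>

lemma odd_if_mod_8: "n mod 8 = 5 \<or> n mod 8 = 7 \<Longrightarrow> odd n" for n :: nat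
  by presburger

theorem domain1_bij:
  fixes P :: "nat \<Rightarrow> bool"
  assumes P: "\<And>n. P n \<Longrightarrow> n mod 8 = 5 \<or> n mod 8 = 7"
  shows "bij_betw principal {(x, y). y > 0 \<and> \<bar>x\<bar> < 2 * y \<and> P (nat (6 * y^2 - x^2))}
    {I. zs6_nonzero_ideal I \<and> P (zs6_norm I)}"
proof -
  let ?D = "{(x, y). y > 0 \<and> \<bar>x\<bar> < 2 * y \<and> P (nat (6 * y^2 - x^2))}"
  have neg: "nrm (x, y) < 0" if "(x, y) \<in> ?D" for x y
  proof -
    have "\<bar>x\<bar>^2 < (2 * y)^2" using that by (intro power_strict_mono) auto
    moreover have "y^2 > 0" using that by simp
    moreover have "\<bar>x\<bar>^2 = x^2" "(2 * y)^2 = 4 * y^2" by (simp_all add: power_mult_distrib)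
    moreover have "nrm (x, y) = x^2 - 6 * y^2" by (simp add: nrm_def)
    ultimately show ?thesis by linarith
  qed
  have "inj_on principal ?D"
  proof (rule inj_onI, clarify)
    fix x y x' y' assume D: "y > 0" "\<bar>x\<bar> < 2 * y" "P (nat (6 * y^2 - x^2))" "y' > 0" "\<bar>x'\<bar> < 2 * y'" "P (nat (6 * y'^2 - x'^2))"
      and eq: "principal (x, y) = principal (x', y')"
    have n: "nrm (x, y) < 0" "nrm (x', y') < 0" by (rule neg; use D in simp)+
    obtain \<eta> where \<eta>: "(x', y') = zs6_mult \<eta> (x, y)" "nrm \<eta> = 1"
      using principal_eq_imp_unit[OF eq n] by blast
    obtain u v where uv: "\<eta> = (u, v)" by (cases \<eta>)
    have "u = 1 \<and> v = 0"
      by (rule domain_unit_trivial[of u v y x x' y']) (use \<eta> uv D in \<open>auto simp: nrm_def zs6_mult_def algebra_simps\<close>)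
    then show "x = x' \<and> y = y'" using \<eta> uv by (simp add: zs6_mult_def)
  qed
  moreover have "principal ` ?D = {I. zs6_nonzero_ideal I \<and> P (zs6_norm I)}"
  proof (intro equalityI subsetI)
    fix I assume "I \<in> principal ` ?D"
    then obtain x y where xy: "(x, y) \<in> ?D" "I = principal (x, y)" by blast
    have "(x, y) \<noteq> (0, 0)" using xy by auto
    moreover have "nat \<bar>nrm (x, y)\<bar> = nat (6 * y^2 - x^2)" using neg[OF xy(1)] by (simp add: nrm_def)
    ultimately show "I \<in> {I. zs6_nonzero_ideal I \<and> P (zs6_norm I)}"
      using xy principal_nonzero zs6_norm_principal by auto
  next
    fix I assume "I \<in> {I. zs6_nonzero_ideal I \<and> P (zs6_norm I)}"
    then have I: "zs6_nonzero_ideal I" "P (zs6_norm I)" by auto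
    then obtain \<alpha> where \<alpha>: "\<alpha> \<noteq> (0, 0)" "I = principal \<alpha>" using nonzero_ideal_principal by blast
    define N where "N = - nrm \<alpha>"
    have nI: "zs6_norm I = nat \<bar>nrm \<alpha>\<bar>" using \<alpha> zs6_norm_principal by simp
    have N: "N > 0" using nrm_negative[of \<alpha>] P[OF I(2)] unfolding nI N_def by simp
    have nI': "zs6_norm I = nat N" using nI N by (simp add: N_def)
    have "nat N mod 8 = 5 \<or> nat N mod 8 = 7" using P[OF I(2)] unfolding nI' .
    then have "odd (nat N)" by (rule odd_if_mod_8)
    then have odd: "odd N" using N by (simp add: even_nat_iff)
    define S where "S = {(x, y). y > 0 \<and> 6 * y^2 - x^2 = N \<and> principal (x, y) = I}"
    have "\<exists>x y. (x, y) \<in> S \<and> \<bar>x\<bar> \<le> 2 * y"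
    proof (rule unit_orbit_meets_domain)
      obtain x y where xy: "\<alpha> = (x, y)" by (cases \<alpha>)
      have N1: "6 * y^2 - x^2 = N" by (simp add: N_def nrm_def xy)
      have "y \<noteq> 0" using N1 N by auto
      have "zs6_mult (-1, 0) \<alpha> = (- x, - y)" by (simp add: zs6_mult_def xy)
      then have "principal (- x, - y) = I" using principal_mult_unit[of "(-1, 0)" \<alpha>] \<alpha> by (simp add: nrm_def)
      then have "(x, y) \<in> S \<or> (- x, - y) \<in> S" using N1 \<open>y \<noteq> 0\<close> \<alpha> xy by (auto simp: S_def)
      then show "S \<noteq> {}" by blast
    next
      fix x y assume "(x, y) \<in> S"
      then show "y > 0 \<and> x^2 < 6 * y^2" using N by (auto simp: S_def)
    next
      fix x y s :: int assume *: "(x, y) \<in> S" "s = 1 \<or> s = -1" "5 * y + s * (2 * x) > 0"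
      have s2: "s^2 = 1" using *(2) by auto
      have "zs6_mult (5, 2 * s) (x, y) = (5 * x + s * (12 * y), 5 * y + s * (2 * x))"
        by (simp add: zs6_mult_def algebra_simps)
      moreover have "nrm (5, 2 * s) = 1" using s2 by (simp add: nrm_def power_mult_distrib)
      moreover have "6 * (5 * y + s * (2 * x))^2 - (5 * x + s * (12 * y))^2 = 6 * y^2 - x^2"
        using s2 by algebra
      ultimately show "(5 * x + s * (12 * y), 5 * y + s * (2 * x)) \<in> S"
        using * principal_mult_unit[of "(5, 2 * s)" "(x, y)"] by (simp add: S_def)
    qed
    then obtain x y where xy: "(x, y) \<in> S" "\<bar>x\<bar> \<le> 2 * y" by blast
    have "\<bar>x\<bar> \<noteq> 2 * y"
    proof
      assume "\<bar>x\<bar> = 2 * y"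
      then have "x^2 = (2 * y)^2" by (metis power2_abs)
      then have "N = 2 * y^2" using xy(1) by (auto simp: S_def power_mult_distrib)
      then show False using odd by simp
    qed
    then have "(x, y) \<in> ?D" using xy I(2) nI' by (auto simp: S_def)
    then show "I \<in> principal ` ?D" using xy(1) by (auto simp: S_def intro!: image_eqI[of _ _ "(x, y)"])
  qed
  ultimately show ?thesis unfolding bij_betw_def by blast
qed

text \<open>The inverse of (x, y) -> (x + 3y, x + 2y). This map is integral of determinant -1, so
  every element of the ring has integral coordinates X and Y.\<close>

definition twisted :: "int \<times> int \<Rightarrow> int \<times> int" where
  "twisted z = (3 * snd z - 2 * fst z, fst z - snd z)"

lemma nrm_twisted: "nrm (twisted (X, Y)) = 3 * Y^2 - 2 * X^2"
  by (simp add: nrm_def twisted_def power2_eq_square algebra_simps)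

lemma zs6_mult_twisted: "zs6_mult (u, v) (twisted (X, Y)) = twisted (u * X + 3 * v * Y, u * Y + 2 * v * X)"
  by (simp add: zs6_mult_def twisted_def algebra_simps)

lemma twisted_inj: "twisted z = twisted w \<Longrightarrow> z = w"
  by (cases z; cases w) (auto simp: twisted_def)

text \<open>Factoring \<open>\<alpha> = (\<surd>3 - \<surd>2) (X\<surd>2 + Y\<surd>3)\<close> turns \<open>- nrm \<alpha>\<close> into \<open>2X\<^sup>2 - 3Y\<^sup>2\<close>; the action of the units
  on \<open>(3Y, X)\<close> is the same as that on \<open>(x, y)\<close>.\<close>

theorem domain2_bij:
  fixes P :: "nat \<Rightarrow> bool"
  assumes P: "\<And>n. P n \<Longrightarrow> n mod 8 = 5 \<or> n mod 8 = 7"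
  shows "bij_betw (\<lambda>z. principal (twisted z)) {(X, Y). X > 0 \<and> 3 * \<bar>Y\<bar> < 2 * X \<and> P (nat (2 * X^2 - 3 * Y^2))}
    {I. zs6_nonzero_ideal I \<and> P (zs6_norm I)}"
proof -
  let ?D = "{(X, Y). X > 0 \<and> 3 * \<bar>Y\<bar> < 2 * X \<and> P (nat (2 * X^2 - 3 * Y^2))}"
  have neg: "nrm (twisted (X, Y)) < 0" if "(X, Y) \<in> ?D" for X Y
  proof -
    have "(3 * \<bar>Y\<bar>)^2 < (2 * X)^2" using that by (intro power_strict_mono) auto
    moreover have "X^2 > 0" using that by simp
    moreover have "(3 * \<bar>Y\<bar>)^2 = 9 * Y^2" "(2 * X)^2 = 4 * X^2" by (simp_all add: power_mult_distrib)
    ultimately show ?thesis unfolding nrm_twisted by linarith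
  qed
  have "inj_on (\<lambda>z. principal (twisted z)) ?D"
  proof (rule inj_onI, clarify)
    fix X Y X' Y' assume D: "X > 0" "3 * \<bar>Y\<bar> < 2 * X" "P (nat (2 * X^2 - 3 * Y^2))" "X' > 0" "3 * \<bar>Y'\<bar> < 2 * X'" "P (nat (2 * X'^2 - 3 * Y'^2))"
      and eq: "principal (twisted (X, Y)) = principal (twisted (X', Y'))"
    have n: "nrm (twisted (X, Y)) < 0" "nrm (twisted (X', Y')) < 0" by (rule neg; use D in simp)+
    obtain \<eta> where \<eta>: "twisted (X', Y') = zs6_mult \<eta> (twisted (X, Y))" "nrm \<eta> = 1"
      using principal_eq_imp_unit[OF eq n] by blast
    obtain u v where uv: "\<eta> = (u, v)" by (cases \<eta>)
    have XY': "X' = u * X + 3 * v * Y" "Y' = u * Y + 2 * v * X"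
      using twisted_inj[of "(X', Y')"] \<eta>(1) unfolding uv zs6_mult_twisted by blast+
    have "u = 1 \<and> v = 0"
    proof (rule domain_unit_trivial[of u v X "3 * Y" "3 * Y'" X'])
      show "u^2 - 6 * v^2 = 1" using \<eta>(2) uv by (simp add: nrm_def)
      show "3 * Y' = u * (3 * Y) + 6 * v * X" "X' = u * X + v * (3 * Y)" using XY' by simp_all
    qed (use D in \<open>simp_all add: abs_mult\<close>)
    then show "X = X' \<and> Y = Y'" using XY' by simp
  qed
  moreover have "(\<lambda>z. principal (twisted z)) ` ?D = {I. zs6_nonzero_ideal I \<and> P (zs6_norm I)}"
  proof (intro equalityI subsetI)
    fix I assume "I \<in> (\<lambda>z. principal (twisted z)) ` ?D"
    then obtain X Y where XY: "(X, Y) \<in> ?D" "I = principal (twisted (X, Y))" by blast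
    have "twisted (X, Y) \<noteq> (0, 0)"
    proof
      assume eq: "twisted (X, Y) = (0, 0)"
      show False using neg[OF XY(1)] unfolding eq by (simp add: nrm_def)
    qed
    moreover have "nat \<bar>nrm (twisted (X, Y))\<bar> = nat (2 * X^2 - 3 * Y^2)" using neg[OF XY(1)] by (simp add: nrm_twisted)
    ultimately show "I \<in> {I. zs6_nonzero_ideal I \<and> P (zs6_norm I)}"
      using XY principal_nonzero zs6_norm_principal by auto
  next
    fix I assume "I \<in> {I. zs6_nonzero_ideal I \<and> P (zs6_norm I)}"
    then have I: "zs6_nonzero_ideal I" "P (zs6_norm I)" by auto
    then obtain \<alpha> where \<alpha>: "\<alpha> \<noteq> (0, 0)" "I = principal \<alpha>" using nonzero_ideal_principal by blast
    define N where "N = - nrm \<alpha>"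
    have nI: "zs6_norm I = nat \<bar>nrm \<alpha>\<bar>" using \<alpha> zs6_norm_principal by simp
    have N: "N > 0" using nrm_negative[of \<alpha>] P[OF I(2)] unfolding nI N_def by simp
    have nI': "zs6_norm I = nat N" using nI N by (simp add: N_def)
    have "nat N mod 8 = 5 \<or> nat N mod 8 = 7" using P[OF I(2)] unfolding nI' .
    then have "odd (nat N)" by (rule odd_if_mod_8)
    then have odd: "odd N" using N by (simp add: even_nat_iff)
    define S where "S = {(x, X) | x X Y. x = 3 * Y \<and> X > 0 \<and> 2 * X^2 - 3 * Y^2 = N \<and> principal (twisted (X, Y)) = I}"
    have "\<exists>x y. (x, y) \<in> S \<and> \<bar>x\<bar> \<le> 2 * y"
    proof (rule unit_orbit_meets_domain)
      obtain X Y where XY: "\<alpha> = twisted (X, Y)"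
      proof
        show "\<alpha> = twisted (fst \<alpha> + 3 * snd \<alpha>, fst \<alpha> + 2 * snd \<alpha>)" by (cases \<alpha>) (simp add: twisted_def)
      qed
      have N1: "2 * X^2 - 3 * Y^2 = N" by (simp add: N_def nrm_twisted XY)
      have "X \<noteq> 0" using N1 N by auto
      have "zs6_mult (-1, 0) \<alpha> = twisted (- X, - Y)" by (simp add: zs6_mult_twisted XY)
      then have "principal (twisted (- X, - Y)) = I" using principal_mult_unit[of "(-1, 0)" \<alpha>] \<alpha> by (simp add: nrm_def)
      then have "(3 * Y, X) \<in> S \<or> (3 * (- Y), - X) \<in> S" using N1 \<open>X \<noteq> 0\<close> \<alpha> XY unfolding S_def by force
      then show "S \<noteq> {}" by blast
    next
      fix x y assume "(x, y) \<in> S"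
      then show "y > 0 \<and> x^2 < 6 * y^2" using N by (auto simp: S_def power_mult_distrib)
    next
      fix x X s :: int assume *: "(x, X) \<in> S" "s = 1 \<or> s = -1" "5 * X + s * (2 * x) > 0"
      then obtain Y where Y: "x = 3 * Y" "2 * X^2 - 3 * Y^2 = N" "principal (twisted (X, Y)) = I" by (auto simp: S_def)
      have s2: "s^2 = 1" using *(2) by auto
      define X' Y' where "X' = 5 * X + s * (6 * Y)" and "Y' = 5 * Y + s * (4 * X)"
      have "zs6_mult (5, 2 * s) (twisted (X, Y)) = twisted (X', Y')"
        unfolding zs6_mult_twisted X'_def Y'_def by (simp add: algebra_simps)
      moreover have "nrm (5, 2 * s) = 1" using s2 by (simp add: nrm_def power_mult_distrib)
      ultimately have "principal (twisted (X', Y')) = I"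
        using Y(3) principal_mult_unit[of "(5, 2 * s)" "twisted (X, Y)"] by simp
      moreover have "2 * X'^2 - 3 * Y'^2 = N"
        unfolding X'_def Y'_def Y(2)[symmetric] using s2 by algebra
      moreover have "5 * x + s * (12 * X) = 3 * Y'" "5 * X + s * (2 * x) = X'" by (simp_all add: X'_def Y'_def Y(1))
      ultimately show "(5 * x + s * (12 * X), 5 * X + s * (2 * x)) \<in> S"
        using *(3) unfolding S_def by auto
    qed
    then obtain x X where xX: "(x, X) \<in> S" "\<bar>x\<bar> \<le> 2 * X" by blast
    then obtain Y where Y: "x = 3 * Y" "X > 0" "2 * X^2 - 3 * Y^2 = N" "principal (twisted (X, Y)) = I" by (auto simp: S_def)
    have "\<bar>3 * Y\<bar> \<noteq> 2 * X"
    proof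
      assume "\<bar>3 * Y\<bar> = 2 * X"
      then have "(3 * Y)^2 = (2 * X)^2" by (metis power2_abs)
      then have "3 * N = 2 * X^2" using Y(3) by (simp add: power_mult_distrib)
      then have "even (3 * N)" by simp
      then show False using odd by simp
    qed
    then have "(X, Y) \<in> ?D" using xX Y I(2) nI' by (auto simp: abs_mult)
    then show "I \<in> (\<lambda>z. principal (twisted z)) ` ?D" using Y(4) by (intro image_eqI[of _ _ "(X, Y)"]) auto
  qed
  ultimately show ?thesis unfolding bij_betw_def by blast
qed

section \<open>Comparison of the two series\<close>

text \<open>\<open>ideal_series\<close> is an unordered sum, the analytic side a series in r. Blocks
  of at most linear size with terms below c^n give absolute convergence, which permits the
  grouping.\<close>

lemma infsum_fibers:
  fixes f :: "'a \<Rightarrow> complex" and E :: "nat \<Rightarrow> 'a set"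
  assumes fin: "\<And>n. finite (E n)" and disj: "\<And>m n. m \<noteq> n \<Longrightarrow> E m \<inter> E n = {}"
    and card: "\<And>n. card (E n) \<le> 4 * (n + 1)"
    and bound: "\<And>n z. z \<in> E n \<Longrightarrow> norm (f z) \<le> c ^ n" and c: "0 \<le> c" "c < 1"
  shows "(\<lambda>n. \<Sum>z\<in>E n. f z) sums infsum f (\<Union>n. E n)"
proof -
  define g where "g = (\<lambda>(n :: nat, z). f z)"
  have norm_sum: "(\<Sum>z\<in>E n. norm (f z)) \<le> 4 * ((real n + 1)^2 * c ^ n)" for n
  proof -
    have "(\<Sum>z\<in>E n. norm (f z)) \<le> real (card (E n)) * c ^ n"
      by (rule sum_bounded_above) (rule bound)
    also have "\<dots> \<le> (4 * (real n + 1)^2) * c ^ n"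
    proof (rule mult_right_mono)
      have "real (card (E n)) \<le> 4 * (real n + 1)" using card[of n] of_nat_mono[of "card (E n)" "4 * (n + 1)", where 'a = real] by simp
      also have "\<dots> \<le> 4 * (real n + 1)^2" using self_le_power[of "real n + 1" 2] by simp
      finally show "real (card (E n)) \<le> 4 * (real n + 1)^2" .
    qed (use c in simp)
    finally show ?thesis by simp
  qed
  have "summable (\<lambda>n. 4 * ((real n + 1)^2 * c ^ n))"
    by (intro summable_mult summable_square_geometric) (use c in simp)
  then have sm: "summable (\<lambda>n. norm (\<Sum>z\<in>E n. norm (f z)))"
    by (rule summable_comparison_test[rotated]) (auto simp: norm_sum sum_nonneg)
  have "(\<lambda>z. norm (g z)) summable_on Sigma UNIV E"
    unfolding Infinite_Sum.abs_summable_on_Sigma_iff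
  proof (intro conjI ballI)
    show "(\<lambda>y. norm (g (n, y))) summable_on E n" for n by (simp add: fin)
    have e: "(\<lambda>n. \<Sum>\<^sub>\<infinity>y\<in>E n. norm (g (n, y))) = (\<lambda>n. \<Sum>z\<in>E n. norm (f z))"
      by (simp add: g_def fin)
    show "(\<lambda>n. norm (\<Sum>\<^sub>\<infinity>y\<in>E n. norm (g (n, y)))) summable_on UNIV"
      by (rule norm_summable_imp_summable_on) (use sm in \<open>simp add: fun_cong[OF e]\<close>)
  qed
  then have "g summable_on Sigma UNIV E" by (rule abs_summable_summable)
  then have "(g has_sum infsum g (Sigma UNIV E)) (Sigma UNIV E)" by simp
  then have "((\<lambda>n. \<Sum>z\<in>E n. f z) has_sum infsum g (Sigma UNIV E)) UNIV"
    by (rule has_sum_SigmaD) (simp add: g_def fin has_sum_finite)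
  then have "(\<lambda>n. \<Sum>z\<in>E n. f z) sums infsum g (Sigma UNIV E)" by (rule has_sum_imp_sums)
  moreover have "infsum g (Sigma UNIV E) = infsum f (\<Union>n. E n)"
  proof -
    have "bij_betw snd (Sigma UNIV E) (\<Union>n. E n)"
    proof (rule bij_betw_imageI)
      show "inj_on snd (Sigma UNIV E)"
      proof (rule inj_onI, clarify)
        fix m n z w assume "z \<in> E m" "w \<in> E n" "snd (m, z) = snd (n, w)"
        then show "m = n \<and> z = w" using disj[of m n] by auto
      qed
      show "snd ` Sigma UNIV E = (\<Union>n. E n)" by force
    qed
    from infsum_reindex_bij_betw[OF this, of f] show ?thesis by (simp add: g_def case_prod_unfold)
  qed
  ultimately show ?thesis by simp
qed

text \<open>The negative of a number congruent to 1 modulo 4 is congruent to 3, so the points with s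
  = 1 and s = -1 are distinct and the sum doubles.\<close>

lemma sum_signed:
  fixes f :: "'a \<Rightarrow> complex" and u :: "nat \<Rightarrow> int"
  assumes A: "finite A" "inj_on u A" "\<And>i. i \<in> A \<Longrightarrow> u i mod 4 = 1" and \<psi>: "inj \<psi>"
    and sym: "\<And>k. f (\<psi> (- k)) = f (\<psi> k)"
  shows "(\<Sum>z\<in>(\<lambda>(i, s). \<psi> (s * u i)) ` (A \<times> {1, -1}). f z) = 2 * (\<Sum>i\<in>A. f (\<psi> (u i)))"
proof -
  have "inj_on (\<lambda>(i, s). \<psi> (s * u i)) (A \<times> {1, -1})"
  proof (rule inj_onI, clarify)
    fix i s j t assume *: "i \<in> A" "s \<in> {1, -1 :: int}" "j \<in> A" "t \<in> {1, -1 :: int}" "\<psi> (s * u i) = \<psi> (t * u j)"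
    have e: "s * u i = t * u j" using \<psi> *(5) by (simp add: inj_eq)
    have m: "u i mod 4 = 1" "u j mod 4 = 1" using A(3) * by auto
    have "u i \<noteq> - u j" using m by presburger
    then have "s = t" using e *(2,4) by auto
    moreover have "u i = u j" using e *(2,4) \<open>s = t\<close> by auto
    ultimately show "i = j \<and> s = t" using A(2) * by (simp add: inj_on_eq_iff)
  qed
  then have "(\<Sum>z\<in>(\<lambda>(i, s). \<psi> (s * u i)) ` (A \<times> {1, -1}). f z) = (\<Sum>(i, s)\<in>A \<times> {1, -1}. f (\<psi> (s * u i)))"
    by (simp add: sum.reindex case_prod_unfold)
  also have "\<dots> = (\<Sum>i\<in>A. \<Sum>s\<in>{1, -1}. f (\<psi> (s * u i)))"
    by (simp only: sum.cartesian_product)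
  also have "\<dots> = (\<Sum>i\<in>A. 2 * f (\<psi> (u i)))" by (simp add: sym)
  finally show ?thesis by (simp add: sum_distrib_left)
qed

text \<open>Block r of the cone |x| < 2y: the level y = 2r, with x = s(4w + c) and w running over
  the indices of \<open>S1\<close> at r. The offset c is that of the exponents of \<tau>: 1 for
  residue 7, -3 for residue 15.\<close>

definition E9 :: "int \<Rightarrow> nat \<Rightarrow> (int \<times> int) set" where
  "E9 c r = (\<lambda>(i, s). (s * (4 * (int r - 1 - 2 * int i) + c), 2 * int r)) ` ({..<r} \<times> {1, -1})"

text \<open>Block r of the second cone: the levels X = 6r + 2 and X = 6r + 4, in the order fixed by
  b. For b = 2 (residue 5) they match the two summands of \<open>c_odd\<close>; b = 4 gives residue
  29.\<close>

definition E11 :: "int \<Rightarrow> nat \<Rightarrow> (int \<times> int) set" where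
  "E11 b r = (\<lambda>(i, s). (6 * int r + b, s * (4 * (int r - 2 * int i) + 1))) ` ({..r} \<times> {1, -1})
    \<union> (\<lambda>(i, s). (6 * int r + 6 - b, s * (4 * (int r - 1 - 2 * int i) + 1))) ` ({..<r} \<times> {1, -1})"

section \<open>Residues of the two quadratic forms\<close>

lemma square_mod_16:
  fixes x :: int
  shows "even x \<and> (x^2 mod 16 = 0 \<or> x^2 mod 16 = 4) \<or> odd x \<and> (x^2 mod 16 = 1 \<or> x^2 mod 16 = 9)"
proof -
  have c: "x mod 16 \<in> {0,1,2,3,4,5,6,7,8,9,10,11,12,13,14,15}" by simp presburger
  have e: "even x = even (x mod 16)" by (simp add: dvd_mod_iff)
  have "even (x mod 16) \<and> ((x mod 16)^2 mod 16 = 0 \<or> (x mod 16)^2 mod 16 = 4) \<or> odd (x mod 16) \<and> ((x mod 16)^2 mod 16 = 1 \<or> (x mod 16)^2 mod 16 = 9)"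
    using c by auto
  then show ?thesis by (simp only: power_mod e)
qed

lemma square_mod_24:
  fixes x :: int
  shows "(x mod 6 = 2 \<or> x mod 6 = 4) \<and> (x^2 mod 24 = 4 \<or> x^2 mod 24 = 16) \<or>
    (x mod 6 = 1 \<or> x mod 6 = 5) \<and> x^2 mod 24 = 1 \<or> x mod 6 = 3 \<and> x^2 mod 24 = 9 \<or> x mod 6 = 0 \<and> (x^2 mod 24 = 0 \<or> x^2 mod 24 = 12)"
proof -
  have c: "x mod 24 \<in> {0,1,2,3,4,5,6,7,8,9,10,11,12,13,14,15,16,17,18,19,20,21,22,23}" by simp presburger
  have e: "x mod 6 = (x mod 24) mod 6" by (simp add: mod_mod_cancel)
  define y where "y = x mod 24"
  have "(y mod 6 = 2 \<or> y mod 6 = 4) \<and> (y^2 mod 24 = 4 \<or> y^2 mod 24 = 16) \<or>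
    (y mod 6 = 1 \<or> y mod 6 = 5) \<and> y^2 mod 24 = 1 \<or> y mod 6 = 3 \<and> y^2 mod 24 = 9 \<or> y mod 6 = 0 \<and> (y^2 mod 24 = 0 \<or> y^2 mod 24 = 12)"
    using c unfolding y_def[symmetric] by (simp only: insert_iff empty_iff, elim disjE) simp_all
  then show ?thesis unfolding y_def by (simp only: power_mod e)
qed

lemma odd_signed: "odd (x::int) \<Longrightarrow> \<exists>s t. (s = 1 \<or> s = -1) \<and> x = s * (4 * t + 1)"
proof -
  assume "odd x"
  then have "x mod 4 = 1 \<or> x mod 4 = 3" by presburger
  then show ?thesis
  proof
    assume "x mod 4 = 1"
    then have "x = 1 * (4 * (x div 4) + 1)" using mult_div_mod_eq[of 4 x] by simp
    then show ?thesis by blast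
  next
    assume "x mod 4 = 3"
    then have "x = (-1) * (4 * (- (x div 4) - 1) + 1)" using mult_div_mod_eq[of 4 x] by simp
    then show ?thesis by blast
  qed
qed

text \<open>Serves to rewrite r^2 as 2k - r, so that modulo 16 and 48 the term in r^2 becomes linear
  in r.\<close>

lemma square_parity: "\<exists>k. (x::int)^2 = 2 * k - x"
proof -
  have "even (x^2 + x)" by simp
  then obtain k where "x^2 + x = 2 * k" by (rule evenE)
  then show ?thesis by (intro exI[of _ k]) simp
qed

text \<open>Modulo 48 the two values are 5 - 24(t + r) and 29 - 24(t + r), so only the parity of t +
  r matters.\<close>

lemma quadratic_form_mod_48:
  fixes r t :: int
  shows "(2 * (6 * r + 2)^2 - 3 * (4 * t + 1)^2) mod 48 = (if even (t + r) then 5 else 29)"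
    and "(2 * (6 * r + 4)^2 - 3 * (4 * t + 1)^2) mod 48 = (if even (t + r) then 29 else 5)"
proof -
  have shift: "(a - 24 * (t + r)) mod 48 = (if even (t + r) then a mod 48 else (a - 24) mod 48)" for a
  proof (cases "even (t + r)")
    case True
    then obtain j where j: "t + r = 2 * j" by (rule evenE)
    have "a - 24 * (t + r) = a + (- j) * 48" unfolding j by simp
    then show ?thesis using True by (simp only: mod_mult_self1 if_True)
  next
    case False
    then obtain j where j: "t + r = 2 * j + 1" by (rule oddE)
    have "a - 24 * (t + r) = (a - 24) + (- j) * 48" unfolding j by simp
    then show ?thesis using False by (simp only: mod_mult_self1 if_False)
  qed
  obtain k where k: "r^2 = 2 * k - r" using square_parity by blast
  have "2 * (6 * r + 2)^2 - 3 * (4 * t + 1)^2 = 72 * r^2 + 48 * r + 5 - 48 * t^2 - 24 * t"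
    by (simp add: power2_eq_square algebra_simps)
  also have "\<dots> = (5 - 24 * (t + r)) + (3 * k - t^2) * 48" unfolding k by simp
  finally have "(2 * (6 * r + 2)^2 - 3 * (4 * t + 1)^2) mod 48 = (5 - 24 * (t + r)) mod 48"
    by (simp only: mod_mult_self1)
  also have "\<dots> = (if even (t + r) then 5 else 29)" using shift[of 5] by simp
  finally show "(2 * (6 * r + 2)^2 - 3 * (4 * t + 1)^2) mod 48 = (if even (t + r) then 5 else 29)" .
  have "2 * (6 * r + 4)^2 - 3 * (4 * t + 1)^2 = 72 * r^2 + 96 * r + 29 - 48 * t^2 - 24 * t"
    by (simp add: power2_eq_square algebra_simps)
  also have "\<dots> = (29 - 24 * (t + r)) + (3 * k - t^2 + r) * 48" unfolding k by simp
  finally have "(2 * (6 * r + 4)^2 - 3 * (4 * t + 1)^2) mod 48 = (29 - 24 * (t + r)) mod 48"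
    by (simp only: mod_mult_self1)
  also have "\<dots> = (if even (t + r) then 29 else 5)" using shift[of 29] by simp
  finally show "(2 * (6 * r + 4)^2 - 3 * (4 * t + 1)^2) mod 48 = (if even (t + r) then 29 else 5)" .
qed

text \<open>The residue modulo 16 does two things: it forces x odd and y even, and then it fixes the
  parity of w + r to be that of the indices of \<open>S1\<close>.\<close>

lemma E9_union:
  assumes c: "c = 1 \<and> m = 7 \<or> c = -3 \<and> m = 15"
  shows "(\<Union>r. E9 c r) = {(x, y). y > 0 \<and> \<bar>x\<bar> < 2 * y \<and> nat (6 * y^2 - x^2) mod 16 = m}"
proof (intro equalityI subsetI)
  fix z assume "z \<in> (\<Union>r. E9 c r)"
  then obtain r i s where z: "z = (s * (4 * (int r - 1 - 2 * int i) + c), 2 * int r)" "i < r" "s = 1 \<or> s = -1"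
    unfolding E9_def by auto
  define w where "w = int r - 1 - 2 * int i"
  have w: "\<bar>4 * w + c\<bar> < 4 * int r" using z(2) c by (auto simp: w_def)
  have s2: "(s * (4 * w + c))^2 = 16 * w^2 + 8 * c * w + c^2" using z(3) by (auto simp: power2_eq_square algebra_simps)
  have as: "\<bar>s * (4 * w + c)\<bar> = \<bar>4 * w + c\<bar>" using z(3) by auto
  have N: "6 * (2 * int r)^2 - (s * (4 * w + c))^2 = 24 * int r ^ 2 - 16 * w^2 - 8 * c * w - c^2"
    unfolding s2 by (simp add: power_mult_distrib)
  obtain j where j: "w = 2 * j - int r - 1"
  proof
    show "w = 2 * (int r - int i) - int r - 1" by (simp add: w_def)
  qed
  obtain k where k: "int r ^ 2 = 2 * k - int r" using square_parity by blast
  have "(24 * int r ^ 2 - 16 * w^2 - 8 * c * w - c^2) mod 16 = int m"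
    using c
  proof
    assume *: "c = 1 \<and> m = 7"
    have "24 * (2 * k - int r) - 16 * w^2 - 8 * w - 1 = 7 + (3 * k - int r - w^2 - j) * 16"
      unfolding j by simp
    then have "(24 * (2 * k - int r) - 16 * w^2 - 8 * w - 1) mod 16 = 7 mod 16"
      by (simp only: mod_mult_self1)
    then show ?thesis using * by (simp add: k)
  next
    assume *: "c = -3 \<and> m = 15"
    have "24 * (2 * k - int r) - 16 * w^2 + 24 * w - 9 = 15 + (3 * k - 3 * int r - w^2 + 3 * j - 3) * 16"
      unfolding j by simp
    then have "(24 * (2 * k - int r) - 16 * w^2 + 24 * w - 9) mod 16 = 15 mod 16"
      by (simp only: mod_mult_self1)
    then show ?thesis using * by (simp add: k)
  qed
  then have mod: "(6 * (2 * int r)^2 - (s * (4 * w + c))^2) mod 16 = int m" unfolding N .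
  have "\<bar>s * (4 * w + c)\<bar>^2 \<le> (4 * int r)^2" unfolding as using w by (intro power_mono) auto
  then have "(s * (4 * w + c))^2 \<le> 16 * int r ^ 2" unfolding power2_abs by (simp add: power_mult_distrib)
  moreover have "6 * (2 * int r)^2 = 24 * int r ^ 2" "int r ^ 2 \<ge> 0" by (simp_all add: power_mult_distrib)
  ultimately have "6 * (2 * int r)^2 - (s * (4 * w + c))^2 \<ge> 0" by linarith
  then have "nat (6 * (2 * int r)^2 - (s * (4 * w + c))^2) mod 16 = m"
    using mod by (metis nat_int nat_mod_distrib nat_numeral zero_le_numeral)
  then show "z \<in> {(x, y). y > 0 \<and> \<bar>x\<bar> < 2 * y \<and> nat (6 * y^2 - x^2) mod 16 = m}"
    using w as z(2) unfolding z(1) w_def[symmetric] by auto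
next
  fix z assume "z \<in> {(x, y). y > 0 \<and> \<bar>x\<bar> < 2 * y \<and> nat (6 * y^2 - x^2) mod 16 = m}"
  then obtain x y where z: "z = (x, y)" "y > 0" "\<bar>x\<bar> < 2 * y" "nat (6 * y^2 - x^2) mod 16 = m" by auto
  have "\<bar>x\<bar>^2 \<le> (2 * y)^2" using z by (intro power_mono) auto
  then have "x^2 \<le> 4 * y^2" unfolding power2_abs by (simp add: power_mult_distrib)
  moreover have "y^2 \<ge> 0" by simp
  ultimately have "6 * y^2 - x^2 = int (nat (6 * y^2 - x^2))" by linarith
  then have mod: "(6 * y^2 - x^2) mod 16 = int m" using z(4) by (metis of_nat_mod of_nat_numeral)
  moreover have "(6 * (y^2 mod 16) - x^2 mod 16) mod 16 = (6 * y^2 - x^2) mod 16"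
    by (intro mod_diff_cong) (simp_all only: mod_mult_right_eq mod_mod_trivial)
  ultimately have h: "(6 * (y^2 mod 16) - x^2 mod 16) mod 16 = int m" by simp
  have "odd x \<and> even y"
    using h square_mod_16[of x] square_mod_16[of y] c by (elim disjE conjE) simp_all
  then obtain r' s t where y: "y = 2 * r'" and x: "x = s * (4 * t + 1)" and s: "s = 1 \<or> s = -1"
    using odd_signed[of x] by (metis evenE)
  obtain r where r: "r' = int r" using z(2) y by (metis nonneg_int_cases zero_less_mult_pos zero_less_numeral less_imp_le)
  have x2: "x^2 = 16 * t^2 + 8 * t + 1" using s by (auto simp: x power2_eq_square algebra_simps)
  have N: "6 * y^2 - x^2 = 24 * int r ^ 2 - 16 * t^2 - 8 * t - 1"
    unfolding x2 y r by (simp add: power_mult_distrib)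
  have tb: "\<bar>4 * t + 1\<bar> < 4 * int r" using z(3) s unfolding x y r by auto
  \<comment> \<open>4t + 1 = 4(t + 1) - 3, so passing from c = 1 to c = -3 shifts the index by
    one.\<close>
  define w where "w = (if c = 1 then t else t + 1)"
  have tw: "4 * t + 1 = 4 * w + c" using c by (auto simp: w_def)
  have par: "even (w + int r + 1)"
  proof (rule ccontr)
    assume "odd (w + int r + 1)"
    then have "even (w + int r)" by simp
    then obtain j where j: "w + int r = 2 * j" by (rule evenE)
    obtain k where k: "int r ^ 2 = 2 * k - int r" using square_parity by blast
    from c show False
    proof
      assume *: "c = 1 \<and> m = 7"
      then have "24 * int r ^ 2 - 16 * t^2 - 8 * t - 1 = 15 + (3 * k - int r - t^2 - j - 1) * 16"
        using j unfolding k w_def by simp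
      then show False using mod * unfolding N by (simp only: mod_mult_self1) simp
    next
      assume *: "c = -3 \<and> m = 15"
      then have "24 * int r ^ 2 - 16 * t^2 - 8 * t - 1 = 7 + (3 * k - int r - t^2 - j) * 16"
        using j unfolding k w_def by simp
      then show False using mod * unfolding N by (simp only: mod_mult_self1) simp
    qed
  qed
  \<comment> \<open>The cone gives -r <= w <= r, and both end points have the wrong parity.\<close>
  have wb: "w \<le> int r - 1 \<and> 1 - int r \<le> w"
  proof -
    have "w \<noteq> int r" "w \<noteq> - int r" using par by auto
    moreover have "- int r \<le> w \<and> w \<le> int r" using tb c unfolding w_def by auto
    ultimately show ?thesis by linarith
  qed
  define i where "i = nat ((int r - 1 - w) div 2)"
  have i: "w = int r - 1 - 2 * int i" "i < r" using wb par unfolding i_def by auto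
  have "z = (s * (4 * (int r - 1 - 2 * int i) + c), 2 * int r)"
    unfolding z(1) x y r tw i(1) by simp
  then show "z \<in> (\<Union>r. E9 c r)" using i(2) s unfolding E9_def by force
qed

lemma E11_union:
  assumes b: "b = 2 \<and> m = 5 \<or> b = 4 \<and> m = 29"
  shows "(\<Union>r. E11 b r) = {(X, Y). X > 0 \<and> 3 * \<bar>Y\<bar> < 2 * X \<and> nat (2 * X^2 - 3 * Y^2) mod 48 = m}"
proof (intro equalityI subsetI)
  fix z assume "z \<in> (\<Union>r. E11 b r)"
  then obtain r i s where z: "z = (6 * int r + b, s * (4 * (int r - 2 * int i) + 1)) \<and> i \<le> r \<or>
      z = (6 * int r + 6 - b, s * (4 * (int r - 1 - 2 * int i) + 1)) \<and> i < r" and s: "s = 1 \<or> s = -1"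
    unfolding E11_def by auto
  obtain t where t: "z = (6 * int r + b, s * (4 * t + 1)) \<and> - int r \<le> t \<and> t \<le> int r \<and> even (t + int r) \<or>
      z = (6 * int r + 6 - b, s * (4 * t + 1)) \<and> 1 - int r \<le> t \<and> t \<le> int r - 1 \<and> odd (t + int r)"
  proof -
    from z show ?thesis
    proof
      assume "z = (6 * int r + b, s * (4 * (int r - 2 * int i) + 1)) \<and> i \<le> r"
      then show ?thesis by (intro that[of "int r - 2 * int i"]) simp
    next
      assume "z = (6 * int r + 6 - b, s * (4 * (int r - 1 - 2 * int i) + 1)) \<and> i < r"
      then show ?thesis by (intro that[of "int r - 1 - 2 * int i"]) simp
    qed
  qed
  obtain X where X: "z = (X, s * (4 * t + 1))" "X > 0" "3 * \<bar>4 * t + 1\<bar> < 2 * X"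
    "(X = 6 * int r + 2 \<and> (even (t + int r) \<longleftrightarrow> b = 2) \<or> X = 6 * int r + 4 \<and> (even (t + int r) \<longleftrightarrow> b = 4))"
  proof -
    have b': "b = 2 \<or> b = 4" using b by blast
    from t show ?thesis
    proof (elim disjE conjE)
      assume *: "z = (6 * int r + b, s * (4 * t + 1))" "- int r \<le> t" "t \<le> int r" "even (t + int r)"
      have "3 * \<bar>4 * t + 1\<bar> < 2 * (6 * int r + b)" using *(2,3) b' by presburger
      then show ?thesis by (intro that[OF *(1)]) (use *(4) b' in auto)
    next
      assume *: "z = (6 * int r + 6 - b, s * (4 * t + 1))" "1 - int r \<le> t" "t \<le> int r - 1" "odd (t + int r)"
      have "3 * \<bar>4 * t + 1\<bar> < 2 * (6 * int r + 6 - b)" using *(2,3) b' by presburger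
      then show ?thesis by (intro that[OF *(1)]) (use *(4) b' in auto)
    qed
  qed
  have as: "\<bar>s * (4 * t + 1)\<bar> = \<bar>4 * t + 1\<bar>" using s by auto
  have s2: "(s * (4 * t + 1))^2 = (4 * t + 1)^2" using s by (auto simp add: power2_eq_square algebra_simps)
  have mod: "(2 * X^2 - 3 * (s * (4 * t + 1))^2) mod 48 = int m"
    unfolding s2 using X(4) b by (auto simp: quadratic_form_mod_48 split: if_splits)
  have "(3 * \<bar>s * (4 * t + 1)\<bar>)^2 \<le> (2 * X)^2" unfolding as using X by (intro power_mono) auto
  then have "9 * (s * (4 * t + 1))^2 \<le> 4 * X^2" unfolding power_mult_distrib[of 3] power_mult_distrib[of 2] power2_abs by simp
  then have "2 * X^2 - 3 * (s * (4 * t + 1))^2 \<ge> 0" using zero_le_power2[of X] by linarith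
  then have "nat (2 * X^2 - 3 * (s * (4 * t + 1))^2) mod 48 = m"
    using mod by (metis nat_int nat_mod_distrib nat_numeral zero_le_numeral)
  then show "z \<in> {(X, Y). X > 0 \<and> 3 * \<bar>Y\<bar> < 2 * X \<and> nat (2 * X^2 - 3 * Y^2) mod 48 = m}"
    using X as by auto
next
  fix z assume "z \<in> {(X, Y). X > 0 \<and> 3 * \<bar>Y\<bar> < 2 * X \<and> nat (2 * X^2 - 3 * Y^2) mod 48 = m}"
  then obtain X Y where z: "z = (X, Y)" "X > 0" "3 * \<bar>Y\<bar> < 2 * X" "nat (2 * X^2 - 3 * Y^2) mod 48 = m" by auto
  have "(3 * \<bar>Y\<bar>)^2 \<le> (2 * X)^2" using z by (intro power_mono) auto
  then have "9 * Y^2 \<le> 4 * X^2" unfolding power_mult_distrib power2_abs by simp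
  then have "2 * X^2 - 3 * Y^2 = int (nat (2 * X^2 - 3 * Y^2))" using zero_le_power2[of X] by linarith
  then have mod: "(2 * X^2 - 3 * Y^2) mod 48 = int m" using z(4) by (metis of_nat_mod of_nat_numeral)
  \<comment> \<open>Both residues reduce to 5 modulo 24, which already forces X to be 2 or 4 modulo
    6 and Y to be odd. The residue modulo 48 then decides the parity of t + r.\<close>
  have m24: "n mod 24 = 5" if "n mod 48 = 5 \<or> n mod 48 = 29" for n :: int
  proof -
    have "n mod 24 = (n mod 48) mod 24" by (simp add: mod_mod_cancel)
    then show ?thesis using that by auto
  qed
  have "(2 * X^2 - 3 * Y^2) mod 24 = 5" by (rule m24) (use mod b in auto)
  moreover have "(2 * (X^2 mod 24) - 3 * (Y^2 mod 24)) mod 24 = (2 * X^2 - 3 * Y^2) mod 24"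
    by (intro mod_diff_cong) (simp_all only: mod_mult_right_eq)
  ultimately have h: "(2 * (X^2 mod 24) - 3 * (Y^2 mod 24)) mod 24 = 5" by simp
  then have XY: "(X mod 6 = 2 \<or> X mod 6 = 4) \<and> odd Y"
  proof -
    have "odd Y" if "Y mod 6 = 1 \<or> Y mod 6 = 5 \<or> Y mod 6 = 3"
    proof -
      have "even Y = even (Y mod 6)" by (simp add: dvd_mod_iff)
      then show ?thesis using that by auto
    qed
    then have "odd Y \<and> (Y^2 mod 24 = 1 \<or> Y^2 mod 24 = 9) \<or>
        Y^2 mod 24 = 0 \<or> Y^2 mod 24 = 4 \<or> Y^2 mod 24 = 12 \<or> Y^2 mod 24 = 16"
      using square_mod_24[of Y] by blast
    then show ?thesis using h square_mod_24[of X] by (elim disjE conjE) simp_all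
  qed
  obtain s t where Y: "Y = s * (4 * t + 1)" and s: "s = 1 \<or> s = -1" using odd_signed XY by blast
  define r where "r = nat (X div 6)"
  have r: "int r = X div 6" using z(2) by (simp add: r_def pos_imp_zdiv_nonneg_iff)
  have X: "X = 6 * int r + 2 \<or> X = 6 * int r + 4" using XY unfolding r by presburger
  have Y2: "Y^2 = (4 * t + 1)^2" using s by (auto simp: Y power2_eq_square algebra_simps)
  have "\<bar>Y\<bar> = \<bar>4 * t + 1\<bar>" unfolding Y abs_mult using s by auto
  then have tb: "3 * \<bar>4 * t + 1\<bar> < 2 * X" using z(3) by simp
  have par: "X = 6 * int r + 2 \<and> (even (t + int r) \<longleftrightarrow> b = 2) \<or> X = 6 * int r + 4 \<and> (even (t + int r) \<longleftrightarrow> b = 4)"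
    using X mod b unfolding Y2 by (auto simp: quadratic_form_mod_48 split: if_splits)
  have "X = 6 * int r + b \<and> even (t + int r) \<or> X = 6 * int r + 6 - b \<and> odd (t + int r)"
    using par b by (elim disjE conjE) simp_all
  then consider "X = 6 * int r + b" "even (t + int r)" | "X = 6 * int r + 6 - b" "odd (t + int r)"
    by blast
  moreover have tr': "3 * \<bar>4 * t + 1\<bar> < 12 * int r + 8" using tb par by linarith
  have tr: "- int r \<le> t" "t \<le> int r" using tr' by (simp_all add: abs_if split: if_splits)
  ultimately show "z \<in> (\<Union>r. E11 b r)"
  proof cases
    case 1
    define i where "i = nat ((int r - t) div 2)"
    have i: "t = int r - 2 * int i" "i \<le> r" using tr 1(2) unfolding i_def by auto
    have "z = (6 * int r + b, s * (4 * (int r - 2 * int i) + 1))" unfolding z(1) Y 1(1) i(1) by simp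
    then show ?thesis using i(2) s unfolding E11_def by force
  next
    case 2
    have "1 - int r \<le> t \<and> t \<le> int r - 1"
    proof -
      have "t \<noteq> int r" "t \<noteq> - int r" using 2(2) by auto
      then show ?thesis using tr by linarith
    qed
    define i where "i = nat ((int r - 1 - t) div 2)"
    have i: "t = int r - 1 - 2 * int i" "i < r" using \<open>1 - int r \<le> t \<and> t \<le> int r - 1\<close> 2(2) unfolding i_def by auto
    have "z = (6 * int r + 6 - b, s * (4 * (int r - 1 - 2 * int i) + 1))" unfolding z(1) Y 2(1) i(1) by simp
    then show ?thesis using i(2) s unfolding E11_def by force
  qed
qed

section \<open>The ideal series as sums over blocks\<close>

lemma ideal_series_sums9:
  fixes x :: complex
  assumes c: "c = 1 \<and> m = 7 \<or> c = -3 \<and> m = 15" and x: "norm x < 1"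
  shows "(\<lambda>r. \<Sum>z\<in>E9 c r. x ^ nat (6 * snd z ^ 2 - fst z ^ 2)) sums ideal_series 16 m x"
proof -
  define D where "D = {(x, y). y > 0 \<and> \<bar>x\<bar> < 2 * y \<and> nat (6 * y^2 - x^2) mod 16 = m}"
  define f where "f z = x ^ nat (6 * snd z ^ 2 - fst z ^ 2)" for z :: "int \<times> int"
  \<comment> \<open>Inside the cone the indefinite form still dominates the square of the second
    coordinate; in block n, where that coordinate is 2n, this keeps the exponents at n or
    above.\<close>
  have le: "2 * b^2 \<le> 6 * b^2 - a^2" if "(a, b) \<in> D" for a b
  proof -
    have "\<bar>a\<bar>^2 \<le> (2 * b)^2" using that by (intro power_mono) (auto simp: D_def)
    then show ?thesis by (simp add: power_mult_distrib)
  qed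
  have "bij_betw principal D {I. zs6_nonzero_ideal I \<and> zs6_norm I mod 16 = m}"
    unfolding D_def
  proof (rule domain1_bij[where P = "\<lambda>n. n mod 16 = m"])
    fix n :: nat assume "n mod 16 = m"
    then have "n mod 8 = m mod 8" using mod_mod_cancel[of 8 16 n] by simp
    then show "n mod 8 = 5 \<or> n mod 8 = 7" using c by auto
  qed
  from infsum_reindex_bij_betw[OF this, of "\<lambda>I. x ^ zs6_norm I"]
  have "ideal_series 16 m x = infsum (\<lambda>z. x ^ zs6_norm (principal z)) D"
    by (simp add: ideal_series_def)
  also have "\<dots> = infsum f D"
  proof (rule infsum_cong)
    fix z assume z: "z \<in> D"
    obtain a b where ab: "z = (a, b)" by (cases z)
    have "z \<noteq> (0, 0)" using z by (auto simp: D_def)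
    moreover have "nat \<bar>nrm z\<bar> = nat (6 * b^2 - a^2)"
    proof -
      have "nrm z = - (6 * b^2 - a^2)" by (simp add: ab nrm_def)
      moreover have "6 * b^2 - a^2 \<ge> 0" using le[of a b] z zero_le_power2[of b] unfolding ab by linarith
      ultimately show ?thesis by simp
    qed
    ultimately show "x ^ zs6_norm (principal z) = f z" by (simp add: zs6_norm_principal f_def ab)
  qed
  also have DU: "D = (\<Union>r. E9 c r)" unfolding D_def by (rule E9_union[OF c, symmetric])
  finally have s: "ideal_series 16 m x = infsum f (\<Union>r. E9 c r)" .
  show ?thesis unfolding s f_def[symmetric]
  proof (rule infsum_fibers)
    show "finite (E9 c n)" for n by (simp add: E9_def)
    show "E9 c k \<inter> E9 c n = {}" if "k \<noteq> n" for k n using that by (auto simp: E9_def)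
    show "card (E9 c n) \<le> 4 * (n + 1)" for n
      unfolding E9_def by (rule order_trans[OF card_image_le]) (auto simp: card_cartesian_product)
    fix n z assume z: "z \<in> E9 c n"
    obtain a b where ab: "z = (a, b)" by (cases z)
    have "b = 2 * int n" using z by (auto simp: E9_def ab)
    have "(a, b) \<in> D" using z unfolding DU ab by blast
    then have "int n \<le> 6 * b^2 - a^2"
    proof -
      have "n \<le> n * n" by simp
      then have "int n \<le> int n * int n" by (simp only: of_nat_mult[symmetric] of_nat_le_iff)
      moreover have "2 * b^2 = 8 * (int n * int n)" unfolding \<open>b = 2 * int n\<close> by (simp add: power2_eq_square)
      ultimately have "int n \<le> 2 * b^2" by linarith
      then show ?thesis using le[OF \<open>(a, b) \<in> D\<close>] by linarith
    qed
    then show "norm (f z) \<le> norm x ^ n"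
      unfolding f_def norm_power using x by (intro power_decreasing) (auto simp: ab)
  qed (use x in auto)
qed

lemma ideal_series_sums11:
  fixes x :: complex
  assumes b: "b = 2 \<and> m = 5 \<or> b = 4 \<and> m = 29" and x: "norm x < 1"
  shows "(\<lambda>r. \<Sum>z\<in>E11 b r. x ^ nat (2 * fst z ^ 2 - 3 * snd z ^ 2)) sums ideal_series 48 m x"
proof -
  define D where "D = {(X, Y). X > 0 \<and> 3 * \<bar>Y\<bar> < 2 * X \<and> nat (2 * X^2 - 3 * Y^2) mod 48 = m}"
  define f where "f z = x ^ nat (2 * fst z ^ 2 - 3 * snd z ^ 2)" for z :: "int \<times> int"
  have le: "2 * X^2 \<le> 3 * (2 * X^2 - 3 * Y^2)" if "(X, Y) \<in> D" for X Y
  proof -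
    have "(3 * \<bar>Y\<bar>)^2 \<le> (2 * X)^2" using that by (intro power_mono) (auto simp: D_def)
    then show ?thesis by (simp add: power_mult_distrib)
  qed
  have "bij_betw (\<lambda>z. principal (twisted z)) D {I. zs6_nonzero_ideal I \<and> zs6_norm I mod 48 = m}"
    unfolding D_def
  proof (rule domain2_bij[where P = "\<lambda>n. n mod 48 = m"])
    fix n :: nat assume "n mod 48 = m"
    then have "n mod 8 = m mod 8" using mod_mod_cancel[of 8 48 n] by simp
    then show "n mod 8 = 5 \<or> n mod 8 = 7" using b by auto
  qed
  from infsum_reindex_bij_betw[OF this, of "\<lambda>I. x ^ zs6_norm I"]
  have "ideal_series 48 m x = infsum (\<lambda>z. x ^ zs6_norm (principal (twisted z))) D"
    by (simp add: ideal_series_def)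
  also have "\<dots> = infsum f D"
  proof (rule infsum_cong)
    fix z assume z: "z \<in> D"
    obtain X Y where XY: "z = (X, Y)" by (cases z)
    have n: "nrm (twisted z) = - (2 * X^2 - 3 * Y^2)" unfolding XY nrm_twisted by simp
    have "X^2 > 0" using z by (auto simp: D_def XY)
    then have "0 < 2 * X^2" by simp
    also have "\<dots> \<le> 3 * (2 * X^2 - 3 * Y^2)" using le[OF z[unfolded XY]] .
    finally have pos: "2 * X^2 - 3 * Y^2 > 0" by simp
    then have "twisted z \<noteq> (0, 0)" using n nrm_eq_0_iff[of "twisted z"] by force
    moreover have "nat \<bar>nrm (twisted z)\<bar> = nat (2 * X^2 - 3 * Y^2)"
      using pos n by simp
    ultimately show "x ^ zs6_norm (principal (twisted z)) = f z" by (simp add: zs6_norm_principal f_def XY)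
  qed
  also have DU: "D = (\<Union>r. E11 b r)" unfolding D_def by (rule E11_union[OF b, symmetric])
  finally have s: "ideal_series 48 m x = infsum f (\<Union>r. E11 b r)" .
  have fst: "fst z = 6 * int n + 2 \<or> fst z = 6 * int n + 4" if "z \<in> E11 b n" for z n
    using that b unfolding E11_def by force
  show ?thesis unfolding s f_def[symmetric]
  proof (rule infsum_fibers)
    show "finite (E11 b n)" for n by (simp add: E11_def)
    show "E11 b k \<inter> E11 b n = {}" if "k \<noteq> n" for k n
    proof (rule ccontr)
      assume "\<not> ?thesis"
      then obtain z where "z \<in> E11 b k" "z \<in> E11 b n" by blast
      from fst[OF this(1)] fst[OF this(2)] have "int k = int n" by presburger
      then show False using that by simp
    qed
    show "card (E11 b n) \<le> 4 * (n + 1)" for n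
    proof -
      have "card (E11 b n) \<le> card ({..n} \<times> {1, -1 :: int}) + card ({..<n} \<times> {1, -1 :: int})"
        unfolding E11_def by (intro order_trans[OF card_Un_le] add_mono card_image_le) auto
      then show ?thesis by (simp add: card_cartesian_product)
    qed
    fix n z assume z: "z \<in> E11 b n"
    obtain X Y where XY: "z = (X, Y)" by (cases z)
    have X: "X \<ge> 6 * int n + 2" using fst[OF z] by (auto simp: XY)
    have "(X, Y) \<in> D" using z unfolding DU XY by blast
    define A N where "A = X^2" and "N = 2 * X^2 - 3 * Y^2"
    have "2 * X \<le> A" unfolding A_def power2_eq_square using X by (intro mult_right_mono) auto
    moreover have "2 * A \<le> 3 * N" using le[OF \<open>(X, Y) \<in> D\<close>] by (simp add: A_def N_def)
    moreover have "0 \<le> int n" by simp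
    ultimately have "int n \<le> N" using X by linarith
    then have "int n \<le> 2 * X^2 - 3 * Y^2" by (simp only: N_def)
    then show "norm (f z) \<le> norm x ^ n"
      unfolding f_def norm_power using x by (intro power_decreasing) (auto simp: XY)
  qed (use x in auto)
qed

lemma E9_sum:
  fixes x :: complex
  assumes c: "c = 1 \<or> c = -3"
  shows "(\<Sum>z\<in>E9 c r. x ^ nat (6 * snd z ^ 2 - fst z ^ 2)) = 2 * (\<Sum>i<r. x powi (24 * int r ^ 2 - (4 * (int r - 1 - 2 * int i) + c)^2))"
proof -
  define u where "u i = 4 * (int r - 1 - 2 * int i) + c" for i
  have "(\<Sum>z\<in>E9 c r. x ^ nat (6 * snd z ^ 2 - fst z ^ 2)) = 2 * (\<Sum>i<r. x ^ nat (6 * (2 * int r)^2 - u i ^ 2))"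
    unfolding E9_def u_def[symmetric]
  proof (subst sum_signed[where \<psi> = "\<lambda>k. (k, 2 * int r)"])
    show "u i mod 4 = 1" for i using c unfolding u_def by presburger
  qed (auto simp: inj_on_def u_def)
  also have "(\<Sum>i<r. x ^ nat (6 * (2 * int r)^2 - u i ^ 2)) = (\<Sum>i<r. x powi (24 * int r ^ 2 - u i ^ 2))"
  proof (rule sum.cong[OF refl])
    fix i assume "i \<in> {..<r}"
    then have "\<bar>u i\<bar> \<le> 4 * int r" using c by (auto simp: u_def)
    then have "\<bar>u i\<bar>^2 \<le> (4 * int r)^2" by (intro power_mono) auto
    then have "u i ^ 2 \<le> 16 * int r ^ 2" by (simp add: power_mult_distrib)
    then have "24 * int r ^ 2 - u i ^ 2 \<ge> 0" using zero_le_power2[of "int r"] by linarith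
    then show "x ^ nat (6 * (2 * int r)^2 - u i ^ 2) = x powi (24 * int r ^ 2 - u i ^ 2)"
      by (simp add: power_int_def power_mult_distrib)
  qed
  finally show ?thesis unfolding u_def .
qed

definition h11 :: "complex \<Rightarrow> int \<Rightarrow> nat \<Rightarrow> complex" where
  "h11 x b r = (\<Sum>i<Suc r. x powi (2 * (6 * int r + b)^2 - 3 * (4 * (int r - 2 * int i) + 1)^2))
    + (\<Sum>i<r. x powi (2 * (6 * int r + 6 - b)^2 - 3 * (4 * (int r - 1 - 2 * int i) + 1)^2))"

lemma E11_sum:
  fixes x :: complex
  assumes b: "b = 2 \<or> b = 4"
  shows "(\<Sum>z\<in>E11 b r. x ^ nat (2 * fst z ^ 2 - 3 * snd z ^ 2)) = 2 * h11 x b r"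
proof -
  define F where "F z = x ^ nat (2 * fst z ^ 2 - 3 * snd z ^ 2)" for z :: "int \<times> int"
  define u v where "u i = 4 * (int r - 2 * int i) + 1" and "v i = 4 * (int r - 1 - 2 * int i) + 1" for i
  have um: "u i mod 4 = 1" and vm: "v i mod 4 = 1" for i unfolding u_def v_def by presburger+
  have inj: "inj_on u A" "inj_on v A" for A by (auto simp: inj_on_def u_def v_def)
  have "(\<Sum>z\<in>E11 b r. F z) = (\<Sum>z\<in>(\<lambda>(i, s). (6 * int r + b, s * u i)) ` ({..r} \<times> {1, -1}). F z)
     + (\<Sum>z\<in>(\<lambda>(i, s). (6 * int r + 6 - b, s * v i)) ` ({..<r} \<times> {1, -1}). F z)"
    unfolding E11_def u_def[symmetric] v_def[symmetric]
    by (rule sum.union_disjoint) (use b in auto)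
  also have "(\<Sum>z\<in>(\<lambda>(i, s). (6 * int r + b, s * u i)) ` ({..r} \<times> {1, -1}). F z) = 2 * (\<Sum>i\<le>r. F (6 * int r + b, u i))"
    by (rule sum_signed[where \<psi> = "\<lambda>k. (6 * int r + b, k)"]) (auto simp: um inj F_def intro: injI)
  also have "(\<Sum>z\<in>(\<lambda>(i, s). (6 * int r + 6 - b, s * v i)) ` ({..<r} \<times> {1, -1}). F z) = 2 * (\<Sum>i<r. F (6 * int r + 6 - b, v i))"
    by (rule sum_signed[where \<psi> = "\<lambda>k. (6 * int r + 6 - b, k)"]) (auto simp: vm inj F_def intro: injI)
  finally have sum: "(\<Sum>z\<in>E11 b r. F z) = 2 * (\<Sum>i\<le>r. F (6 * int r + b, u i)) + 2 * (\<Sum>i<r. F (6 * int r + 6 - b, v i))" .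
  have F: "F (X, Y) = x powi (2 * X^2 - 3 * Y^2)" if "3 * \<bar>Y\<bar> \<le> 2 * X" for X Y
  proof -
    have "(3 * \<bar>Y\<bar>)^2 \<le> (2 * X)^2" using that by (intro power_mono) auto
    then have "9 * Y^2 \<le> 4 * X^2" by (simp add: power_mult_distrib)
    then have "2 * X^2 - 3 * Y^2 \<ge> 0" using zero_le_power2[of X] by linarith
    then show ?thesis by (simp add: F_def power_int_def)
  qed
  have "(\<Sum>i\<le>r. F (6 * int r + b, u i)) = (\<Sum>i<Suc r. x powi (2 * (6 * int r + b)^2 - 3 * u i ^ 2))"
    unfolding lessThan_Suc_atMost
  proof (intro sum.cong refl F)
    fix i assume "i \<in> {..r}"
    then have "1 - 4 * int r \<le> u i" "u i \<le> 4 * int r + 1" by (auto simp: u_def)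
    then have "\<bar>u i\<bar> \<le> 4 * int r + 1" by linarith
    then show "3 * \<bar>u i\<bar> \<le> 2 * (6 * int r + b)" using b by auto
  qed
  moreover have "(\<Sum>i<r. F (6 * int r + 6 - b, v i)) = (\<Sum>i<r. x powi (2 * (6 * int r + 6 - b)^2 - 3 * v i ^ 2))"
  proof (intro sum.cong refl F)
    fix i assume "i \<in> {..<r}"
    then have "- (4 * int r) \<le> v i" "v i \<le> 4 * int r" by (auto simp: v_def)
    then have "\<bar>v i\<bar> \<le> 4 * int r" by linarith
    then show "3 * \<bar>v i\<bar> \<le> 2 * (6 * int r + 6 - b)" using b by auto
  qed
  ultimately show ?thesis using sum unfolding h11_def u_def v_def F_def by (simp add: distrib_left)
qed

lemma powi_shift_sum:
  fixes x :: complex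
  assumes "x \<noteq> 0"
  shows "x powi a * (\<Sum>i<n. x powi f i) = (\<Sum>i<n. x powi (a + f i))"
  using assms by (simp add: sum_distrib_left power_int_add)

lemma power_powi: "(x ^ n) powi k = (x :: complex) powi (int n * k)"
  by (simp add: power_int_mult)

section \<open>Specialisation to p = x^8 and p = x^24\<close>

context
  fixes x :: complex
  assumes x: "x \<noteq> 0" "norm x < 1"
begin

lemma qbase_pow: "0 < n \<Longrightarrow> qbase (x ^ n) (x ^ (2 * n))"
  using x by unfold_locales (auto simp: norm_power power_less_one_iff power_mult power2_eq_square power_add mult_2)

interpretation b8: qbase "x ^ 8" "x ^ 16" using qbase_pow[of 8] by simp
interpretation b24: qbase "x ^ 24" "x ^ 48" using qbase_pow[of 24] by simp

text \<open>The sign of \<open>a9\<close> cancels against that of (-q)^r. The factors in r have the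
  exponent 16r^2 + 16r + 8(r - 1)^2 = 24r^2 + 8, and the 1 contributed by \<tau> makes the overall
  shift 9.\<close>

lemma a9_term:
  assumes \<tau>: "\<And>w. \<tau> w = x powi (1 - (4 * w + c)^2)" and c: "c = 1 \<or> c = -3"
  shows "b8.a9 \<tau> r * (2 * (- (x ^ 16)) ^ r) = x ^ 9 * (\<Sum>z\<in>E9 c r. x ^ nat (6 * snd z ^ 2 - fst z ^ 2))"
proof -
  define u where "u i = 4 * (int r - 1 - 2 * int i) + c" for i
  have "(-1) ^ r * (- (x ^ 16)) ^ r = (x ^ 16) ^ r"
    by (simp flip: power_mult_distrib)
  then have "b8.a9 \<tau> r * (2 * (- (x ^ 16)) ^ r)
      = 2 * (((x ^ 16) ^ (r^2) * (x ^ 16) ^ r * (x ^ 8) powi ((int r - 1)^2)) * b8.S1 \<tau> r)"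
    unfolding b8.a9_def by (simp add: mult_ac)
  also have "(x ^ 16) ^ (r^2) * (x ^ 16) ^ r * (x ^ 8) powi ((int r - 1)^2) = x powi (24 * int r ^ 2 + 8)"
  proof -
    have "(x ^ 16) ^ (r^2) * (x ^ 16) ^ r * (x ^ 8) powi ((int r - 1)^2)
        = x powi int (16 * r^2) * x powi int (16 * r) * x powi (8 * (int r - 1)^2)"
      unfolding power_powi power_int_of_nat power_mult by simp
    also have "\<dots> = x powi (int (16 * r^2) + int (16 * r) + 8 * (int r - 1)^2)"
      by (simp only: power_int_add[OF disjI1[OF x(1)]])
    also have "int (16 * r^2) + int (16 * r) + 8 * (int r - 1)^2 = 24 * int r ^ 2 + 8"
      by (simp add: power2_eq_square algebra_simps)
    finally show ?thesis .
  qed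
  also have "x powi (24 * int r ^ 2 + 8) * b8.S1 \<tau> r = (\<Sum>i<r. x powi (24 * int r ^ 2 + 8 + (1 - u i ^ 2)))"
    unfolding b8.S1_def \<tau> u_def powi_shift_sum[OF x(1)] ..
  also have "\<dots> = (\<Sum>i<r. x powi (9 + (24 * int r ^ 2 - u i ^ 2)))"
    by (intro sum.cong refl arg_cong[of _ _ "power_int x"]) simp
  also have "\<dots> = x ^ 9 * (\<Sum>i<r. x powi (24 * int r ^ 2 - u i ^ 2))"
    unfolding powi_shift_sum[OF x(1), symmetric] by simp
  finally show ?thesis unfolding E9_sum[OF c] u_def by simp
qed

text \<open>The r-th term produced by the analytic side for offset c. It is a block sum of
  \<open>E11\<close> for c = 1, but not quite for c = -3.\<close>

definition g11 :: "int \<Rightarrow> nat \<Rightarrow> complex" where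
  "g11 c r = (\<Sum>i<Suc r. x powi (2 * (6 * int r + 2)^2 - 3 * (4 * (int r - 2 * int i) + c)^2))
    + (\<Sum>i<r. x powi (2 * (6 * int r + 4)^2 - 3 * (4 * (int r - 1 - 2 * int i) + c)^2))"

lemma a11_term:
  assumes \<tau>: "\<And>w. \<tau> w = x powi (3 * (1 - (4 * w + c)^2))"
  shows "b24.a11 \<tau> r * (-1) ^ r = x powi (-5) * g11 c r"
proof -
  have sgn: "(-1) ^ r * (-1) ^ r = (1 :: complex)" by (simp flip: power_mult_distrib)
  have q: "(x ^ 48) ^ (r^2 + r) = x powi (48 * int (r^2 + r))"
    by (metis power_int_of_nat power_mult of_nat_mult of_nat_numeral)
  have 1: "(x ^ 48) ^ (r^2 + r) * (x ^ 24) powi (int r ^ 2) = x powi (72 * int r ^ 2 + 48 * int r)"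
  proof -
    have "(x ^ 48) ^ (r^2 + r) * (x ^ 24) powi (int r ^ 2) = x powi (48 * int (r^2 + r) + 24 * int r ^ 2)"
      unfolding q power_powi of_nat_numeral by (rule power_int_add[OF disjI1[OF x(1)], symmetric])
    also have "48 * int (r^2 + r) + 24 * int r ^ 2 = 72 * int r ^ 2 + 48 * int r" by simp
    finally show ?thesis .
  qed
  have 2: "(x ^ 48) ^ (r^2 + r) * (x ^ 24) powi ((int r + 1)^2) = x powi (72 * int r ^ 2 + 96 * int r + 24)"
  proof -
    have "(x ^ 48) ^ (r^2 + r) * (x ^ 24) powi ((int r + 1)^2) = x powi (48 * int (r^2 + r) + 24 * (int r + 1)^2)"
      unfolding q power_powi of_nat_numeral by (rule power_int_add[OF disjI1[OF x(1)], symmetric])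
    also have "48 * int (r^2 + r) + 24 * (int r + 1)^2 = 72 * int r ^ 2 + 96 * int r + 24"
      by (simp add: power2_eq_square algebra_simps)
    finally show ?thesis .
  qed
  have "b24.a11 \<tau> r * (-1) ^ r = ((-1) ^ r * (-1) ^ r) * (((x ^ 48) ^ (r^2 + r) * (x ^ 24) powi (int r ^ 2)) * b24.S1 \<tau> (Suc r)
      + ((x ^ 48) ^ (r^2 + r) * (x ^ 24) powi ((int r + 1)^2)) * b24.S1 \<tau> r)"
    unfolding b24.a11_def b24.c_odd_def by (simp only: ring_distribs mult_ac)
  also have "\<dots> = (\<Sum>i<Suc r. x powi (72 * int r ^ 2 + 48 * int r + 3 * (1 - (4 * (int (Suc r) - 1 - 2 * int i) + c)^2)))
      + (\<Sum>i<r. x powi (72 * int r ^ 2 + 96 * int r + 24 + 3 * (1 - (4 * (int r - 1 - 2 * int i) + c)^2)))"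
    unfolding sgn 1 2 b24.S1_def \<tau> powi_shift_sum[OF x(1)] by simp
  also have "\<dots> = (\<Sum>i<Suc r. x powi (-5 + (2 * (6 * int r + 2)^2 - 3 * (4 * (int r - 2 * int i) + c)^2)))
      + (\<Sum>i<r. x powi (-5 + (2 * (6 * int r + 4)^2 - 3 * (4 * (int r - 1 - 2 * int i) + c)^2)))"
  proof -
    have "72 * int r ^ 2 + 48 * int r + 3 * (1 - (4 * (int (Suc r) - 1 - 2 * i) + c)^2)
        = -5 + (2 * (6 * int r + 2)^2 - 3 * (4 * (int r - 2 * i) + c)^2)" for i
      by (simp add: power2_eq_square algebra_simps)
    moreover have "72 * int r ^ 2 + 96 * int r + 24 + 3 * (1 - (4 * (int r - 1 - 2 * i) + c)^2)
        = -5 + (2 * (6 * int r + 4)^2 - 3 * (4 * (int r - 1 - 2 * i) + c)^2)" for i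
      by (simp add: power2_eq_square algebra_simps)
    ultimately show ?thesis by (simp only:)
  qed
  also have "\<dots> = x powi (-5) * g11 c r"
    unfolding g11_def powi_shift_sum[OF x(1), symmetric] by (simp only: distrib_left)
  finally show ?thesis .
qed

lemma g11_1: "g11 1 r = h11 x 2 r"
proof -
  have "6 * int r + 6 - 2 = 6 * int r + 4" by simp
  then show ?thesis unfolding g11_def h11_def by (simp only:)
qed

text \<open>For \<open>c = -3\<close> the points of the \<open>r\<close>-th block are those of \<open>E11 4 r\<close>, except that \<open>(6r + 2, -4r - 3)\<close>
  replaces \<open>(6r + 4, 4r + 1)\<close>. The former has the norm of the latter with \<open>r\<close> lowered by two, so that
  the excess telescopes to the two terms with \<open>r = 0, 1\<close>; these account for the summand \<open>-2\<close> in \<open>L12\<close>.\<close>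

definition e12 :: "nat \<Rightarrow> complex" where
  "e12 r = x powi (24 * int r ^ 2 - 24 * int r - 19)"

lemma g11_minus_3: "g11 (-3) r = h11 x 4 r + (e12 r - e12 (Suc (Suc r)))"
proof -
  define A where "A = (\<Sum>i<r. x powi (2 * (6 * int r + 2)^2 - 3 * (4 * (int r - 1 - 2 * int i) + 1)^2))"
  define B where "B = (\<Sum>i<r. x powi (2 * (6 * int r + 4)^2 - 3 * (4 * (int r - 2 * int (Suc i)) + 1)^2))"
  have "(\<Sum>i<r. x powi (2 * (6 * int r + 2)^2 - 3 * (4 * (int r - 2 * int i) + (-3))^2)) = A"
    unfolding A_def by (intro sum.cong refl arg_cong[of _ _ "power_int x"]) (simp add: algebra_simps)
  moreover have "2 * (6 * int r + 2)^2 - 3 * (4 * (int r - 2 * int r) + (-3))^2 = 24 * int r ^ 2 - 24 * int r - 19"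
    by (simp add: power2_eq_square algebra_simps)
  moreover have "(\<Sum>i<r. x powi (2 * (6 * int r + 4)^2 - 3 * (4 * (int r - 1 - 2 * int i) + (-3))^2)) = B"
    unfolding B_def by (intro sum.cong refl arg_cong[of _ _ "power_int x"]) (simp add: algebra_simps)
  ultimately have g: "g11 (-3) r = A + e12 r + B"
    unfolding g11_def e12_def by simp
  have E: "2 * (6 * int r + 4)^2 - 3 * (4 * (int r - 2 * int 0) + 1)^2 = 24 * int (Suc (Suc r)) ^ 2 - 24 * int (Suc (Suc r)) - 19"
    by (simp add: power2_eq_square algebra_simps)
  have F: "(\<Sum>i<Suc r. x powi (2 * (6 * int r + 4)^2 - 3 * (4 * (int r - 2 * int i) + 1)^2))
      = x powi (2 * (6 * int r + 4)^2 - 3 * (4 * (int r - 2 * int 0) + 1)^2) + B"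
    unfolding B_def by (rule sum.lessThan_Suc_shift)
  have i: "6 * int r + 6 - 4 = 6 * int r + 2" by simp
  have "h11 x 4 r = e12 (Suc (Suc r)) + B + A"
    unfolding h11_def i A_def[symmetric] F E e12_def ..
  then show ?thesis unfolding g by simp
qed

lemma e12_tendsto: "e12 \<longlonglongrightarrow> 0"
proof -
  have "(\<lambda>r. e12 (Suc (Suc r))) \<longlonglongrightarrow> 0"
  proof (rule Lim_null_comparison)
    show "(\<lambda>r. norm x ^ r) \<longlonglongrightarrow> 0" using x by (intro LIMSEQ_power_zero) simp
    have "norm (e12 (Suc (Suc r))) \<le> norm x ^ r" for r
    proof -
      have e: "24 * int (Suc (Suc r)) ^ 2 - 24 * int (Suc (Suc r)) - 19 = int (24 * r^2 + 72 * r + 29)"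
        by (simp add: power2_eq_square algebra_simps)
      show ?thesis unfolding e12_def e power_int_of_nat norm_power
        using x by (intro power_decreasing) auto
    qed
    then show "\<forall>\<^sub>F r in sequentially. norm (e12 (Suc (Suc r))) \<le> norm x ^ r" by simp
  qed
  then show ?thesis by (auto dest!: LIMSEQ_imp_Suc)
qed

text \<open>A telescope of step two is the sum of two telescopes of step one; the surviving terms
  \<open>e12 0\<close> and \<open>e12 1\<close> both equal x^(-19).\<close>

lemma e12_sums: "(\<lambda>r. e12 r - e12 (Suc (Suc r))) sums (2 * x powi (-19))"
proof -
  have "(\<lambda>r. e12 r - e12 (Suc r)) sums (e12 0 - 0)"
    by (rule telescope_sums'[OF e12_tendsto])
  moreover have "(\<lambda>r. e12 (Suc r) - e12 (Suc (Suc r))) sums (e12 (Suc 0) - 0)"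
    by (rule telescope_sums'[OF LIMSEQ_Suc[OF e12_tendsto]])
  ultimately have "(\<lambda>r. (e12 r - e12 (Suc r)) + (e12 (Suc r) - e12 (Suc (Suc r)))) sums ((e12 0 - 0) + (e12 (Suc 0) - 0))"
    by (rule sums_add)
  then show ?thesis by (simp add: e12_def)
qed

lemma \<tau>_powi8: "b8.\<tau>A w = x powi (1 - (4 * w + 1)^2)" "b8.\<tau>D w = x powi (1 - (4 * w + (-3))^2)"
  unfolding b8.\<tau>A_def b8.\<tau>D_def power_powi
  by (intro arg_cong[of _ _ "power_int x"]; simp add: power2_eq_square algebra_simps)+

lemma \<tau>_powi24: "b24.\<tau>A w = x powi (3 * (1 - (4 * w + 1)^2))" "b24.\<tau>D w = x powi (3 * (1 - (4 * w + (-3))^2))"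
  unfolding b24.\<tau>A_def b24.\<tau>D_def power_powi
  by (intro arg_cong[of _ _ "power_int x"]; simp add: power2_eq_square algebra_simps)+

lemma L9_sums: "(\<lambda>n. L9_term (x ^ 16) (Suc n)) sums (x ^ 9 * ideal_series 16 7 x)"
proof -
  have "(\<lambda>r. b8.a9 b8.\<tau>A r * (2 * (- (x ^ 16)) ^ r)) sums (x ^ 9 * ideal_series 16 7 x)"
    unfolding a9_term[OF \<tau>_powi8(1) disjI1[OF refl]]
    by (intro sums_mult ideal_series_sums9 x) simp
  then show ?thesis
    using b8.even_sums[OF b8.small_\<tau>A] unfolding b8.L9_term_eq by (simp add: sums_iff)
qed

lemma L10_sums: "(\<lambda>n. L10_term (x ^ 16) (Suc n)) sums (x * ideal_series 16 15 x)"
proof -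
  have "(\<lambda>r. b8.a9 b8.\<tau>D r * (2 * (- (x ^ 16)) ^ r)) sums (x ^ 9 * ideal_series 16 15 x)"
    unfolding a9_term[OF \<tau>_powi8(2) disjI2[OF refl]]
    by (intro sums_mult ideal_series_sums9 x) simp
  then have "(\<lambda>n. x ^ 8 * L10_term (x ^ 16) (Suc n)) sums (x ^ 9 * ideal_series 16 15 x)"
    using b8.even_sums[OF b8.small_\<tau>D] unfolding b8.L10_term_eq by (simp add: sums_iff)
  then have "(\<lambda>n. x ^ 8 * L10_term (x ^ 16) (Suc n)) sums (x ^ 8 * (x * ideal_series 16 15 x))"
    by (simp add: mult.assoc[symmetric] flip: power_Suc2)
  then show ?thesis using x by (simp only: sums_mult_iff power_not_zero not_False_eq_True)
qed

text \<open>The 4 is the product of two factors 2: the ideal series counts each term of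
  \<open>h11\<close> with both signs, and the limit of \<open>avg11\<close> is (-1)^r / 2.\<close>

lemma L11_tendsto:
  "(\<lambda>N. ((\<Sum>n\<le>2*N. L11_term (x ^ 48) n) + (\<Sum>n\<le>2*N+1. L11_term (x ^ 48) n)) / 2)
     \<longlonglongrightarrow> x powi (-5) * ideal_series 48 5 x / 4"
proof -
  have "(\<lambda>r. h11 x 2 r) sums (ideal_series 48 5 x / 2)"
    using sums_divide[OF ideal_series_sums11[of 2 5 x], of 2] x unfolding E11_sum[OF disjI1[OF refl]] by simp
  then have "(\<lambda>r. x powi (-5) * g11 1 r / 2) sums (x powi (-5) * (ideal_series 48 5 x / 2) / 2)"
    unfolding g11_1 by (intro sums_mult sums_divide)
  moreover have "b24.a11 b24.\<tau>A r * ((-1) ^ r / 2) = x powi (-5) * g11 1 r / 2" for r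
    using a11_term[OF \<tau>_powi24(1), of r] by simp
  ultimately have "(\<Sum>r. b24.a11 b24.\<tau>A r * ((-1) ^ r / 2)) = x powi (-5) * (ideal_series 48 5 x / 2) / 2"
    by (simp add: sums_iff)
  also have "\<dots> = x powi (-5) * ideal_series 48 5 x / 4" by simp
  finally show ?thesis using b24.odd_starsum[OF b24.small_\<tau>A] unfolding b24.L11_term_eq by (simp only:)
qed

lemma L12_tendsto:
  "(\<lambda>N. ((\<Sum>n\<le>2*N. L12_term (x ^ 48) n) + (\<Sum>n\<le>2*N+1. L12_term (x ^ 48) n)) / 2)
     \<longlonglongrightarrow> x ^ 19 * ideal_series 48 29 x / 4 + 1"
proof -
  have "(\<lambda>r. h11 x 4 r) sums (ideal_series 48 29 x / 2)"
    using sums_divide[OF ideal_series_sums11[of 4 29 x], of 2] x unfolding E11_sum[OF disjI2[OF refl]] by simp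
  then have "(\<lambda>r. x powi (-5) * g11 (-3) r / 2) sums (x powi (-5) * (ideal_series 48 29 x / 2 + 2 * x powi (-19)) / 2)"
    unfolding g11_minus_3 by (intro sums_mult sums_divide sums_add e12_sums)
  moreover have "b24.a11 b24.\<tau>D r * ((-1) ^ r / 2) = x powi (-5) * g11 (-3) r / 2" for r
    using a11_term[OF \<tau>_powi24(2), of r] by simp
  ultimately have s: "(\<Sum>r. b24.a11 b24.\<tau>D r * ((-1) ^ r / 2)) = x powi (-5) * (ideal_series 48 29 x / 2 + 2 * x powi (-19)) / 2"
    by (simp add: sums_iff)
  have lim: "(\<lambda>N. x ^ 24 * (((\<Sum>n\<le>2*N. b24.\<delta>11 n * b24.B_odd b24.\<tau>D n) + (\<Sum>n\<le>2*N+1. b24.\<delta>11 n * b24.B_odd b24.\<tau>D n)) / 2))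
     \<longlonglongrightarrow> x ^ 24 * (x powi (-5) * (ideal_series 48 29 x / 2 + 2 * x powi (-19)) / 2)"
    using b24.odd_starsum[OF b24.small_\<tau>D] unfolding s by (rule tendsto_mult_left)
  \<comment> \<open>x^24 is the surplus p of \<open>L12_term_eq\<close>. With it the telescoped 2
    x^(-19) contributes exactly 1, hence 2 after the doubling in \<open>L12\<close>, which its
    summand -2 removes.\<close>
  have eq: "x ^ 24 * (x powi (-5) * (ideal_series 48 29 x / 2 + 2 * x powi (-19)) / 2) = x ^ 19 * ideal_series 48 29 x / 4 + 1"
  proof -
    have h: "x ^ 24 * x powi (-5) = x ^ 19" "x ^ 19 * x powi (-19) = 1"
      using x by (simp_all add: power_int_minus field_simps flip: power_add)
    have "x ^ 24 * (x powi (-5) * (ideal_series 48 29 x / 2 + 2 * x powi (-19)) / 2)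
        = (x ^ 24 * x powi (-5)) * (ideal_series 48 29 x / 2 + 2 * x powi (-19)) / 2"
      by (simp only: mult.assoc times_divide_eq_right)
    also have "\<dots> = x ^ 19 * ideal_series 48 29 x / 4 + x ^ 19 * x powi (-19)"
      unfolding h(1) by (simp add: distrib_left add_divide_distrib)
    finally show ?thesis unfolding h(2) .
  qed
  have "((\<Sum>n\<le>2*N. L12_term (x ^ 48) n) + (\<Sum>n\<le>2*N+1. L12_term (x ^ 48) n)) / 2
      = x ^ 24 * (((\<Sum>n\<le>2*N. b24.\<delta>11 n * b24.B_odd b24.\<tau>D n) + (\<Sum>n\<le>2*N+1. b24.\<delta>11 n * b24.B_odd b24.\<tau>D n)) / 2)" for N
    by (simp only: b24.L12_term_eq mult.assoc sum_distrib_left[symmetric] distrib_left[symmetric] times_divide_eq_right)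
  then show ?thesis using lim unfolding eq by (simp only:)
qed

end

theorem theorem1p3:
  fixes q :: complex
  assumes "q \<noteq> 0" and "norm q < 1"
  shows "(summable (\<lambda>n. L9_term (q ^ 16) (Suc n))
      \<and> q powi (-9) * L9 (q ^ 16) = ideal_series 16 7 q)
    \<and> (summable (\<lambda>n. L10_term (q ^ 16) (Suc n))
      \<and> q powi (-17) * L10 (q ^ 16) = ideal_series 16 15 q)
    \<and> (starsum_conv (L11_term (q ^ 48))
      \<and> q ^ 5 * L11 (q ^ 48) = ideal_series 48 5 q / 2)
    \<and> (starsum_conv (L12_term (q ^ 48))
      \<and> q powi (-19) * L12 (q ^ 48) = ideal_series 48 29 q / 2)"
  proof (intro conjI)
  show "summable (\<lambda>n. L9_term (q ^ 16) (Suc n))" "summable (\<lambda>n. L10_term (q ^ 16) (Suc n))"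
    using L9_sums[OF assms] L10_sums[OF assms] by (auto simp: sums_iff)
  have "L9 (q ^ 16) = q ^ 9 * ideal_series 16 7 q"
    unfolding L9_def using sums_unique[OF L9_sums[OF assms]] by (rule sym)
  then show "q powi (-9) * L9 (q ^ 16) = ideal_series 16 7 q"
    using assms(1) by (simp add: power_int_minus)
  have "L10 (q ^ 16) = q ^ 17 * ideal_series 16 15 q"
    unfolding L10_def sums_unique[OF L10_sums[OF assms], symmetric] by (simp add: eval_nat_numeral)
  then show "q powi (-17) * L10 (q ^ 16) = ideal_series 16 15 q"
    using assms(1) by (simp add: power_int_minus)
  show "starsum_conv (L11_term (q ^ 48))" "starsum_conv (L12_term (q ^ 48))"
    unfolding starsum_conv_def using L11_tendsto[OF assms] L12_tendsto[OF assms] by (auto simp: convergent_def)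
  have "L11 (q ^ 48) = 2 * (q powi (-5) * ideal_series 48 5 q / 4)"
    unfolding L11_def starsum_def limI[OF L11_tendsto[OF assms]] ..
  then show "q ^ 5 * L11 (q ^ 48) = ideal_series 48 5 q / 2"
    using assms(1) by (simp only:) (simp add: power_int_minus)
  have "L12 (q ^ 48) = - 2 + 2 * (q ^ 19 * ideal_series 48 29 q / 4 + 1)"
    unfolding L12_def starsum_def limI[OF L12_tendsto[OF assms]] ..
  then show "q powi (-19) * L12 (q ^ 48) = ideal_series 48 29 q / 2"
    using assms(1) by (simp only:) (simp add: power_int_minus)
qed

end
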